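(* Let $X\subset\mathbb{R}^d$ be a self-affine sponge with random contractions (as defined in the context). Then almost surely \[ \dim_{\mathrm H}(X)=\dim_{\mathrm M}(X)=\min\{d,s_0\}, \] (in particular the Minkowski dimension exists almost surely). Moreover, if $s_0>d$, then $\mathcal{L}^d(X)>0$ almost surely, where $\mathcal L^d$ is Lebesgue measure on $\mathbb{R}^d$.
   Context: Symbolic notation: fix an integer $N\ge2$, $\mathcal I=\{1,\dots,N\}$, $\Sigma=\mathcal I^{\mathbb N}$ (infinite words), $\Sigma_n=\mathcal I^n$, $\Sigma_0=\{\varnothing\}$, $\Sigma_*=\bigcup_{n\ge0}\Sigma_n$ (finite words). For a word $\mathtt i=i_1i_2\cdots$ and $0\le n<|\mathtt i|$, $\mathtt i|_n=i_1\cdots i_n$ ($\mathtt i|_0=\varnothing$); concatenation is written $\mathtt i\mathtt j$ or $\mathtt i\cdot\mathtt j$. Setting (self-affine sponge with random contractions): fix an integer $d\ge2$, constants $0<\underline\alpha\le\overline\alpha<1$, and vectors $t_1,\dots,t_N\in\mathbb{R}^d$ such that for every $k\in\{1,\dots,d\}$ the set $\{t_1\cdot e_k,\dots,t_N\cdot e_k\}$ has at least two elements ($e_1,\dots,e_d$ the standard basis). On a probability space $(\Omega,\mathcal F,\mathbb P)$ let $\{\alpha^{(k)}_{\mathtt i}:\mathtt i\in\Sigma_*\setminus\{\varnothing\},\,k\in\{1,\dots,d\}\}$ be real random variables with: (R1) the vector-valued random variables $(\alpha^{(\ell)}_{\mathtt i1},\dots,\alpha^{(\ell)}_{\mathtt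 iN})$, $\mathtt i\in\Sigma_*$, $\ell\in\{1,\dots,d\}$, are mutually independent; (R2) for each fixed $\ell$, the vectors $(\alpha^{(\ell)}_{\mathtt i1},\dots,\alpha^{(\ell)}_{\mathtt iN})$, $\mathtt i\in\Sigma_*$, are identically distributed; (R3) $|\alpha^{(k)}_{\mathtt j}|\in[\underline\alpha,\overline\alpha]$ almost surely for all $k$ and $\mathtt j$; (R4) for every $k$ there is $\ell_k\in\mathcal I$ such that the distribution of $\log\alpha^{(k)}_{\ell_k}$ is eventually smooth, i.e. for some $n\in\mathbb N$ its $n$-fold self-convolution is absolutely continuous with a continuous density. Let $A_{\mathtt i}=\mathrm{diag}(\alpha^{(1)}_{\mathtt i},\dots,\alpha^{(d)}_{\mathtt i})$ for $\mathtt i\ne\varnothing$ and $A_\varnothing=I$, and define $f_{\mathtt i}(x)=A_{\mathtt i}x+(I-A_{\mathtt i})t_{i_n}$ for $\mathtt i=i_1\cdots i_n$. The canonical projection $\Pi:\Sigma\to\mathbb{R}^d$ is $\Pi(\mathtt i)=\sum_{n=1}^\infty A_{\mathtt i|_0}A_{\mathtt i|_1}\cdots A_{\mathtt i|_{n-1}}(I-A_{\mathtt i|_n})t_{i_n}$, and $X=\Pi(\Sigma)$ (equivalently $X=\bigcap_{n}\bigcup_{\mathtt i\in\Sigma_n}f_{\mathtt i|_0}\circ\cdots\circ f_{\mathtt i|_n}(B)$ for a suitable compact $B$). For a diagonal matrix $A=\mathrm{diag}(a^{(1)},\dots,a^{(d)})$, a permutation $\tau$ of $\{1,\dots,d\}$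 and $s\ge0$, set $\varphi^s_\tau(A)=|a^{(\tau(1))}|\cdots|a^{(\tau(\lfloor s\rfloor))}|\,|a^{(\tau(\lceil s\rceil))}|^{s-\lfloor s\rfloor}$ if $0\le s\le d$, and $\varphi^s_\tau(A)=(|a^{(1)}|\cdots|a^{(d)}|)^{s/d}$ if $s>d$. Let $s_0$ be the unique real number with $\max_\tau\sum_{i=1}^N\mathbb E\big(\varphi^{s_0}_\tau(A_i)\big)=1$, the maximum over all permutations $\tau$. *)

theory Defs
  imports "HOL-Analysis.Analysis" "HOL-Probability.Probability"
begin

definition hausdorff_pre :: "real \<Rightarrow> real \<Rightarrow> 'a::metric_space set \<Rightarrow> ennreal" where
  "hausdorff_pre s \<delta> E =
     (INF U \<in> {U :: nat \<Rightarrow> 'a set. E \<subseteq> (\<Union>n. U n) \<and> (\<forall>n. bounded (U n) \<and> diameter (U n) \<le> \<delta>)}.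
        (\<Sum>n. ennreal (diameter (U n) powr s)))"

definition hausdorff_measure :: "real \<Rightarrow> 'a::metric_space set \<Rightarrow> ennreal" where
  "hausdorff_measure s E = (SUP \<delta> \<in> {0<..}. hausdorff_pre s \<delta> E)"

definition hausdorff_dim :: "'a::metric_space set \<Rightarrow> real" where
  "hausdorff_dim E = Inf {s. 0 < s \<and> hausdorff_measure s E = 0}"

definition covering_number :: "'a::metric_space set \<Rightarrow> real \<Rightarrow> nat" where
  "covering_number E \<delta> =
     (LEAST n. \<exists>U :: nat \<Rightarrow> 'a set. E \<subseteq> (\<Union>i<n. U i) \<and> (\<forall>i<n. bounded (U i) \<and> diameter (U i) \<le> \<delta>))"

definition has_minkowski_dim :: "'a::metric_space set \<Rightarrow> real \<Rightarrow> bool" where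
  "has_minkowski_dim E D \<longleftrightarrow>
     ((\<lambda>\<delta>. ln (real (covering_number E \<delta>)) / (- ln \<delta>)) \<longlongrightarrow> D) (at_right 0)"

primrec conv_power :: "real measure \<Rightarrow> nat \<Rightarrow> real measure" where
  "conv_power \<mu> 0 = return borel 0"
| "conv_power \<mu> (Suc n) = convolution (conv_power \<mu> n) \<mu>"

definition eventually_smooth :: "real measure \<Rightarrow> bool" where
  "eventually_smooth \<mu> \<longleftrightarrow>
     (\<exists>n\<ge>1. \<exists>f :: real \<Rightarrow> real. continuous_on UNIV f \<and> (\<forall>x. 0 \<le> f x) \<and>
        conv_power \<mu> n = density lborel (\<lambda>x. ennreal (f x)))"

definition fin_words :: "nat \<Rightarrow> nat list set" where
  "fin_words N = {u. set u \<subseteq> {1..N}}"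

definition inf_words :: "nat \<Rightarrow> (nat \<Rightarrow> nat) set" where
  "inf_words N = {w. \<forall>n. w n \<in> {1..N}}"

definition prefix_word :: "(nat \<Rightarrow> nat) \<Rightarrow> nat \<Rightarrow> nat list" where
  "prefix_word w n = map w [0..<n]"

definition diagA :: "('d \<Rightarrow> nat list \<Rightarrow> 'w \<Rightarrow> real) \<Rightarrow> 'd \<Rightarrow> nat list \<Rightarrow> 'w \<Rightarrow> real" where
  "diagA \<alpha> k u \<omega> = (if u = [] then 1 else \<alpha> k u \<omega>)"

text \<open>Canonical projection: coordinate k of
  sum_{n>=1} A_{w|0}...A_{w|n-1} (I - A_{w|n}) t_{w_n}, written with j = n - 1.\<close>
definition sponge_proj ::
  "('d::finite \<Rightarrow> nat list \<Rightarrow> 'w \<Rightarrow> real) \<Rightarrow> (nat \<Rightarrow> real^'d) \<Rightarrow> 'w \<Rightarrow> (nat \<Rightarrow> nat) \<Rightarrow> real^'d" where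
  "sponge_proj \<alpha> t \<omega> w =
     (\<chi> k. \<Sum>j. (\<Prod>m<Suc j. diagA \<alpha> k (prefix_word w m) \<omega>)
               * (1 - diagA \<alpha> k (prefix_word w (Suc j)) \<omega>) * (t (w j) $ k))"

definition sponge :: "nat \<Rightarrow> ('d::finite \<Rightarrow> nat list \<Rightarrow> 'w \<Rightarrow> real) \<Rightarrow> (nat \<Rightarrow> real^'d) \<Rightarrow> 'w \<Rightarrow> (real^'d) set" where
  "sponge N \<alpha> t \<omega> = sponge_proj \<alpha> t \<omega> ` inf_words N"

text \<open>Random vector (alpha^l_{u1}, ..., alpha^l_{uN}) as an element of PiM {1..N} borel.\<close>
definition child_vec :: "nat \<Rightarrow> ('d \<Rightarrow> nat list \<Rightarrow> 'w \<Rightarrow> real) \<Rightarrow> 'd \<Rightarrow> nat list \<Rightarrow> 'w \<Rightarrow> (nat \<Rightarrow> real)" where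
  "child_vec N \<alpha> l u \<omega> = restrict (\<lambda>j. \<alpha> l (u @ [j]) \<omega>) {1..N}"

text \<open>phi^s_tau(diag(a)); a permutation tau of {1..d} is encoded as a bijection
  tau : {0..<d} -> 'd, so tau(1),...,tau(d) of the paper are tau 0, ..., tau (d-1).\<close>
definition phi_tau :: "real \<Rightarrow> (nat \<Rightarrow> 'd::finite) \<Rightarrow> ('d \<Rightarrow> real) \<Rightarrow> real" where
  "phi_tau s \<tau> a =
     (if s \<le> real CARD('d) then
        (\<Prod>j<nat \<lfloor>s\<rfloor>. \<bar>a (\<tau> j)\<bar>) *
        (if s = of_int \<lfloor>s\<rfloor> then 1 else \<bar>a (\<tau> (nat \<lceil>s\<rceil> - 1))\<bar> powr (s - of_int \<lfloor>s\<rfloor>))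
      else (\<Prod>k\<in>UNIV. \<bar>a k\<bar>) powr (s / real CARD('d)))"

definition perms_of :: "(nat \<Rightarrow> 'd::finite) set" where
  "perms_of = {\<tau>. bij_betw \<tau> {..<CARD('d)} (UNIV :: 'd set)}"

definition pressure :: "'w measure \<Rightarrow> nat \<Rightarrow> ('d::finite \<Rightarrow> nat list \<Rightarrow> 'w \<Rightarrow> real) \<Rightarrow> real \<Rightarrow> real" where
  "pressure M N \<alpha> s =
     Max ((\<lambda>\<tau>. \<Sum>i=1..N. (\<integral>\<omega>. phi_tau s \<tau> (\<lambda>k. \<alpha> k [i] \<omega>) \<partial>M)) ` perms_of)"

end

(*
Upper bound: a cylinder is cut off when at most floor(s) of its sides exceed the mesh size delta; it
is then covered by about delta^-s * phi_tau^s(A_u) cubes, tau listing the long sides first. For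
s > s0 the expectation of phi_tau^s(A_u), summed over all words u, is a convergent geometric series.

Lower bound: phi_tau^s is a product of powers of the independent coordinates, with exponents e_k in
[0,1] and sum s. Append to every word of a fixed length one fixed suffix which contains, for every
coordinate k, a run of the letter from (R4) followed by a long run of a letter with another k-th
translation. Conditionally on everything else, the k-th coordinate of a point is then an affine
function, with slope comparable to the contraction at the branching point, of a variable whose
logarithm has a bounded density. Hence two words that branch below p are within distance r with
conditional probability O(prod_k min(1, r / |A_p^(k)|)) = O(r^s / prod_k |A_p^(k)|^(e_k)), which
exactly absorbs the square of the weight of p. Finite random point masses in the sponge thus have
bounded mean energy; energy bounds at infinitely many levels already bound Hausdorff contents from
below (and, at a single scale, Lebesgue measure), so no limit measure is needed. Letting the first m
blocks carry deterministic uniform weights makes the variance of the mass O(|L|^-m), which turns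
positive probability into probability one.
*)
theory Submission
  imports Defs
begin

subsection \<open>Sub-sigma-algebras of an independent family\<close>

text \<open>The fixed suffix multiplies the mean weight of every block by the same positive
  constant, while the free letters before it contribute the \<open>n0\<close>-th power of
  \<open>press e\<close>; once \<open>press e > 1\<close>, a large \<open>n0\<close> outweighs the
  suffix. So exponents with strictly supercritical pressure are needed, and they come from shrinking
  an extremal exponent vector at \<open>s0\<close> proportionally. The main obstacle is that the
  weight of a word is built from the very variables that are supposed to spread out the points.
  Coordinates are independent, so proximity is measured coordinatewise: weight and proximity are
  then both products over the coordinates, and only one coordinate has to be treated at a time. All
  independence claims are reduced to disjointness of sets of indices (word, coordinate).\<close>

lemma (in prob_space) indep_var_nn_integral_iterated:
  assumes ind: "indep_var S X T Y"
    and F [measurable]: "F \<in> borel_measurable (S \<Otimes>\<^sub>M T)"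
  shows "(\<integral>\<^sup>+\<omega>. F (X \<omega>, Y \<omega>) \<partial>M) = (\<integral>\<^sup>+\<omega>. (\<integral>\<^sup>+\<eta>. F (X \<eta>, Y \<omega>) \<partial>M) \<partial>M)"
proof -
  have [measurable]: "X \<in> measurable M S" "Y \<in> measurable M T"
    and eq: "distr M S X \<Otimes>\<^sub>M distr M T Y = distr M (S \<Otimes>\<^sub>M T) (\<lambda>x. (X x, Y x))"
    using ind unfolding indep_var_distribution_eq by auto
  interpret X: prob_space "distr M S X" by (rule prob_space_distr) simp
  interpret Y: prob_space "distr M T Y" by (rule prob_space_distr) simp
  interpret XY: pair_prob_space "distr M S X" "distr M T Y" ..
  have "(\<integral>\<^sup>+\<omega>. F (X \<omega>, Y \<omega>) \<partial>M) = (\<integral>\<^sup>+z. F z \<partial>(distr M S X \<Otimes>\<^sub>M distr M T Y))"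
    unfolding eq by (subst nn_integral_distr) auto
  also have "\<dots> = (\<integral>\<^sup>+y. (\<integral>\<^sup>+x. F (x, y) \<partial>distr M S X) \<partial>distr M T Y)"
    by (subst XY.nn_integral_snd [symmetric]) auto
  also have "\<dots> = (\<integral>\<^sup>+\<omega>. (\<integral>\<^sup>+x. F (x, Y \<omega>) \<partial>distr M S X) \<partial>M)"
    by (subst nn_integral_distr) auto
  also have "\<dots> = (\<integral>\<^sup>+\<omega>. (\<integral>\<^sup>+\<eta>. F (X \<eta>, Y \<omega>) \<partial>M) \<partial>M)"
    by (intro nn_integral_cong, subst nn_integral_distr) auto
  finally show ?thesis .
qed

locale indep_family = prob_space M for M :: "'w measure" +
  fixes S :: "'i \<Rightarrow> 's measure" and X :: "'i \<Rightarrow> 'w \<Rightarrow> 's" and I :: "'i set"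
  assumes indep: "indep_vars S X I"
begin

text \<open>The information carried by the variables with index in \<open>K\<close>. Functions
  measurable for \<open>gen K\<close> and \<open>gen L\<close> with \<open>K\<close>,
  \<open>L\<close> disjoint are independent, so later independence arguments only compare index
  sets.\<close>

definition gen :: "'i set \<Rightarrow> 'w measure" where
  "gen K = sigma (space M) (\<Union>i\<in>K. {X i -` A \<inter> space M | A. A \<in> sets (S i)})"

lemma space_gen [simp]: "space (gen K) = space M"
  by (simp add: gen_def space_measure_of_conv)

lemma X_measurable [measurable]: "i \<in> I \<Longrightarrow> X i \<in> measurable M (S i)"
  using indep unfolding indep_vars_def by auto

lemma sets_gen: "sets (gen K) = sigma_sets (space M) (\<Union>i\<in>K. {X i -` A \<inter> space M | A. A \<in> sets (S i)})"
  unfolding gen_def by (rule sets_measure_of) auto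

lemma measurable_gen: "i \<in> K \<Longrightarrow> i \<in> I \<Longrightarrow> X i \<in> measurable (gen K) (S i)"
proof (rule measurableI)
  show "X i x \<in> space (S i)" if "i \<in> I" "x \<in> space (gen K)" for x
    using X_measurable [OF that(1)] that(2) by (auto dest: measurable_space)
  show "X i -` A \<inter> space (gen K) \<in> sets (gen K)" if "i \<in> K" "A \<in> sets (S i)" for A
    unfolding sets_gen space_gen using that by (intro sigma_sets.Basic) auto
qed

lemma gen_subset: "K \<subseteq> I \<Longrightarrow> sets (gen K) \<subseteq> sets M"
  unfolding sets_gen by (rule sets.sigma_sets_subset) (auto intro!: measurable_sets X_measurable)

lemma gen_mono: "K \<subseteq> K' \<Longrightarrow> sets (gen K) \<subseteq> sets (gen K')"
  unfolding sets_gen by (rule sigma_sets_mono') auto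

lemma measurable_gen_mono: "K \<subseteq> K' \<Longrightarrow> f \<in> measurable (gen K) T \<Longrightarrow> f \<in> measurable (gen K') T"
  by (rule measurable_mono [THEN subsetD, of T T]) (auto dest: gen_mono)

lemma gen_measurableD: "K \<subseteq> I \<Longrightarrow> f \<in> measurable (gen K) T \<Longrightarrow> f \<in> measurable M T"
  by (rule measurable_mono [THEN subsetD, of T T]) (auto dest: gen_subset)

text \<open>Preimages of measurable sets under one \<open>X i\<close> form an intersection-stable
  generator, and independence of such generators passes to the sigma-algebras generated by disjoint
  groups of them; the two groups are encoded by \<open>case_bool K L\<close>.\<close>

lemma indep_var_gen:
  assumes K: "K \<inter> L = {}" "K \<subseteq> I" "L \<subseteq> I"
    and Y: "Y \<in> measurable (gen K) T" and Z: "Z \<in> measurable (gen L) U"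
  shows "indep_var T Y U Z"
proof -
  let ?E = "\<lambda>i. {X i -` A \<inter> space M | A. A \<in> sets (S i)}"
  have "indep_sets ?E I"
    using indep unfolding indep_vars_def2 by blast
  then have "indep_sets ?E (\<Union>b\<in>UNIV. case_bool K L b)"
    using K by (intro indep_sets_mono_index [OF _ \<open>indep_sets ?E I\<close>]) (auto split: bool.splits)
  then have "indep_sets (\<lambda>b. sigma_sets (space M) (\<Union>i\<in>case_bool K L b. ?E i)) UNIV"
  proof (rule indep_sets_collect_sigma)
    show "Int_stable (?E i)" for i
    proof (rule Int_stableI, clarsimp)
      fix A B assume "A \<in> sets (S i)" "B \<in> sets (S i)"
      then show "\<exists>C. X i -` A \<inter> space M \<inter> (X i -` B \<inter> space M) = X i -` C \<inter> space M \<and> C \<in> sets (S i)"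
        by (intro exI [of _ "A \<inter> B"]) auto
    qed
    show "disjoint_family_on (case_bool K L) UNIV"
      using K(1) by (auto simp: disjoint_family_on_def split: bool.splits)
  qed
  then have "indep_set (sets (gen K)) (sets (gen L))"
    unfolding indep_set_def sets_gen
    by (rule indep_sets_mono_sets) (auto split: bool.splits)
  moreover have "sigma_sets (space M) {Y -` A \<inter> space M | A. A \<in> sets T} \<subseteq> sets (gen K)"
    using measurable_sets [OF Y] by (auto intro!: sets.sigma_sets_subset [of _ "gen K", simplified])
  moreover have "sigma_sets (space M) {Z -` A \<inter> space M | A. A \<in> sets U} \<subseteq> sets (gen L)"
    using measurable_sets [OF Z] by (auto intro!: sets.sigma_sets_subset [of _ "gen L", simplified])
  ultimately have "indep_set (sigma_sets (space M) {Y -` A \<inter> space M | A. A \<in> sets T})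
      (sigma_sets (space M) {Z -` A \<inter> space M | A. A \<in> sets U})"
    unfolding indep_sets2_eq by blast
  then show ?thesis
    unfolding indep_var_eq using gen_measurableD K Y Z by auto
qed

lemma nn_integral_gen_mult:
  fixes f g :: "'w \<Rightarrow> ennreal"
  assumes K: "K \<inter> L = {}" "K \<subseteq> I" "L \<subseteq> I"
    and f: "f \<in> borel_measurable (gen K)" and g: "g \<in> borel_measurable (gen L)"
  shows "(\<integral>\<^sup>+\<omega>. f \<omega> * g \<omega> \<partial>M) = (\<integral>\<^sup>+\<omega>. f \<omega> \<partial>M) * (\<integral>\<^sup>+\<omega>. g \<omega> \<partial>M)"
proof -
  have [measurable]: "f \<in> borel_measurable M" "g \<in> borel_measurable M"
    using gen_measurableD K f g by auto
  have "(\<integral>\<^sup>+\<omega>. f \<omega> * g \<omega> \<partial>M) = (\<integral>\<^sup>+\<omega>. (\<integral>\<^sup>+\<eta>. f \<eta> * g \<omega> \<partial>M) \<partial>M)"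
    using indep_var_nn_integral_iterated [OF indep_var_gen [OF K f g], of "\<lambda>(x, y). x * y"] by simp
  then show ?thesis
    by (simp add: nn_integral_multc nn_integral_cmult)
qed

text \<open>\<open>Q\<close> spreads its mass, so the affine function \<open>c + Q R\<close> hits a window of radius \<open>r\<close>
  with conditional probability at most \<open>C r / \<bar>R\<bar>\<close>.\<close>

lemma nn_integral_gen_window:
  fixes Q c R :: "'w \<Rightarrow> real" and H :: "'w \<Rightarrow> ennreal"
  assumes K: "K \<inter> L = {}" "K \<subseteq> I" "L \<subseteq> I"
    and Q: "Q \<in> borel_measurable (gen K)" and c: "c \<in> borel_measurable (gen L)"
    and R: "R \<in> borel_measurable (gen L)" and H: "H \<in> borel_measurable (gen L)"
    and R0: "\<And>\<omega>. R \<omega> \<noteq> 0" and r: "r > 0"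
    and conc: "\<And>z \<delta>. \<delta> > 0 \<Longrightarrow> emeasure M {\<omega>\<in>space M. \<bar>Q \<omega> - z\<bar> \<le> \<delta>} \<le> ennreal (C * \<delta>)"
  shows "(\<integral>\<^sup>+\<omega>. H \<omega> * indicator {\<omega>. \<bar>c \<omega> + Q \<omega> * R \<omega>\<bar> \<le> r} \<omega> \<partial>M)
    \<le> (\<integral>\<^sup>+\<omega>. H \<omega> * ennreal (min 1 (C * (r / \<bar>R \<omega>\<bar>))) \<partial>M)"
proof -
  have [measurable]: "Q \<in> borel_measurable M" "c \<in> borel_measurable M" "R \<in> borel_measurable M"
    using gen_measurableD K Q c R by auto
  \<comment> \<open>Both variables of an \<open>indep_var\<close> must take values in one type, so
    \<open>Q\<close> is padded with constants to the type of the triple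
    \<open>(c, R, H)\<close>.\<close>
  have "indep_var (borel \<Otimes>\<^sub>M borel \<Otimes>\<^sub>M borel) (\<lambda>\<omega>. (Q \<omega>, 0 :: real, 0 :: ennreal))
      (borel \<Otimes>\<^sub>M borel \<Otimes>\<^sub>M borel) (\<lambda>\<omega>. (c \<omega>, R \<omega>, H \<omega>))"
    by (intro indep_var_gen [OF K] measurable_Pair Q c R H measurable_const) auto
  note ind = this
  have "(\<lambda>z. if \<bar>fst (snd z) + fst (fst z) * fst (snd (snd z))\<bar> \<le> r then snd (snd (snd z)) else 0) \<in> borel_measurable
      ((borel \<Otimes>\<^sub>M borel \<Otimes>\<^sub>M borel) \<Otimes>\<^sub>M (borel \<Otimes>\<^sub>M borel \<Otimes>\<^sub>M (borel :: ennreal measure)))"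
    by measurable
  from indep_var_nn_integral_iterated [OF ind this] have "(\<integral>\<^sup>+\<omega>. (if \<bar>c \<omega> + Q \<omega> * R \<omega>\<bar> \<le> r then H \<omega> else 0) \<partial>M)
      = (\<integral>\<^sup>+\<omega>. (\<integral>\<^sup>+\<eta>. (if \<bar>c \<omega> + Q \<eta> * R \<omega>\<bar> \<le> r then H \<omega> else 0) \<partial>M) \<partial>M)"
    by (simp only: fst_conv snd_conv)
  moreover have "h * indicator {x. P x} y = (if P y then h else 0)" for h :: ennreal and P and y :: 'w
    by (simp add: indicator_def)
  ultimately have "(\<integral>\<^sup>+\<omega>. H \<omega> * indicator {\<omega>. \<bar>c \<omega> + Q \<omega> * R \<omega>\<bar> \<le> r} \<omega> \<partial>M)
      = (\<integral>\<^sup>+\<omega>. (\<integral>\<^sup>+\<eta>. H \<omega> * indicator {\<eta>. \<bar>c \<omega> + Q \<eta> * R \<omega>\<bar> \<le> r} \<eta> \<partial>M) \<partial>M)"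
    by (simp only:)
  also have "\<dots> \<le> (\<integral>\<^sup>+\<omega>. H \<omega> * ennreal (min 1 (C * (r / \<bar>R \<omega>\<bar>))) \<partial>M)"
  proof (rule nn_integral_mono)
    fix \<omega>
    have eq: "\<bar>c \<omega> + Q \<eta> * R \<omega>\<bar> \<le> r \<longleftrightarrow> \<bar>Q \<eta> - (- c \<omega> / R \<omega>)\<bar> \<le> r / \<bar>R \<omega>\<bar>" for \<eta>
    proof -
      have "\<bar>c \<omega> + Q \<eta> * R \<omega>\<bar> = \<bar>Q \<eta> - (- c \<omega> / R \<omega>)\<bar> * \<bar>R \<omega>\<bar>"
        using R0 [of \<omega>] by (simp add: abs_mult [symmetric] field_simps)
      then show ?thesis using R0 [of \<omega>] by (simp add: pos_le_divide_eq)
    qed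
    have "(\<integral>\<^sup>+\<eta>. H \<omega> * indicator {\<eta>. \<bar>c \<omega> + Q \<eta> * R \<omega>\<bar> \<le> r} \<eta> \<partial>M)
        = H \<omega> * (\<integral>\<^sup>+\<eta>. indicator {\<eta>\<in>space M. \<bar>c \<omega> + Q \<eta> * R \<omega>\<bar> \<le> r} \<eta> \<partial>M)"
      by (subst nn_integral_cmult [symmetric])
        (auto intro!: nn_integral_cong simp: indicator_def)
    also have "(\<integral>\<^sup>+\<eta>. indicator {\<eta>\<in>space M. \<bar>c \<omega> + Q \<eta> * R \<omega>\<bar> \<le> r} \<eta> \<partial>M)
        = emeasure M {\<eta>\<in>space M. \<bar>Q \<eta> - (- c \<omega> / R \<omega>)\<bar> \<le> r / \<bar>R \<omega>\<bar>}"
      by (subst nn_integral_indicator) (auto simp: eq)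
    also have "\<dots> \<le> ennreal (min 1 (C * (r / \<bar>R \<omega>\<bar>)))"
    proof -
      have "r / \<bar>R \<omega>\<bar> > 0" using r R0 [of \<omega>] by simp
      from conc [OF this, of "- c \<omega> / R \<omega>"] show ?thesis
        using emeasure_le_1 [of "{\<eta>\<in>space M. \<bar>Q \<eta> - (- c \<omega> / R \<omega>)\<bar> \<le> r / \<bar>R \<omega>\<bar>}"]
        by (cases "1 \<le> C * (r / \<bar>R \<omega>\<bar>)") (simp_all only: min_def if_True if_False ennreal_1)
    qed
    finally show "(\<integral>\<^sup>+\<eta>. H \<omega> * indicator {\<eta>. \<bar>c \<omega> + Q \<eta> * R \<omega>\<bar> \<le> r} \<eta> \<partial>M)
        \<le> H \<omega> * ennreal (min 1 (C * (r / \<bar>R \<omega>\<bar>)))"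
      by (simp add: mult_left_mono)
  qed
  finally show ?thesis .
qed

end

subsection \<open>Coding by words\<close>

primrec cprod :: "(nat list \<Rightarrow> real) \<Rightarrow> nat list \<Rightarrow> nat list \<Rightarrow> real" where
  "cprod a p [] = 1"
| "cprod a p (i # u) = a (p @ [i]) * cprod a (p @ [i]) u"

text \<open>One coordinate of the image of \<open>c\<close> under the maps along \<open>u\<close> in the subtree rooted at \<open>p\<close>.\<close>

primrec ppt :: "(nat list \<Rightarrow> real) \<Rightarrow> (nat \<Rightarrow> real) \<Rightarrow> nat list \<Rightarrow> nat list \<Rightarrow> real \<Rightarrow> real" where
  "ppt a t p [] c = c"
| "ppt a t p (i # u) c = (1 - a (p @ [i])) * t i + a (p @ [i]) * ppt a t (p @ [i]) u c"

text \<open>One coordinate of the canonical projection of the subtree rooted at \<open>p\<close>.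
  Keeping \<open>p\<close> as an argument turns the shift of the word into a recursion
  (\<open>proj_step\<close>), although the contractions differ from node to node.\<close>

definition proj :: "(nat list \<Rightarrow> real) \<Rightarrow> (nat \<Rightarrow> real) \<Rightarrow> nat list \<Rightarrow> (nat \<Rightarrow> nat) \<Rightarrow> real" where
  "proj a t p w = (\<Sum>j. cprod a p (prefix_word w j) * (1 - a (p @ prefix_word w (Suc j))) * t (w j))"

lemma cprod_append: "cprod a p (u @ v) = cprod a p u * cprod a (p @ u) v"
  by (induction u arbitrary: p) auto

lemma ppt_append: "ppt a t p (u @ v) c = ppt a t p u (ppt a t (p @ u) v c)"
  by (induction u arbitrary: p) auto

lemma ppt_diff: "ppt a t p u c - ppt a t p u d = cprod a p u * (c - d)"
proof (induction u arbitrary: p)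
  case (Cons i u)
  have "ppt a t p (i # u) c - ppt a t p (i # u) d
      = a (p @ [i]) * (ppt a t (p @ [i]) u c - ppt a t (p @ [i]) u d)"
    by (simp add: algebra_simps)
  then show ?case by (simp add: Cons.IH)
qed simp

text \<open>Every map whose word ends in \<open>i\<close> fixes \<open>t i\<close>, so a run of
  \<open>i\<close> is a pure contraction towards \<open>t i\<close>, with the product over the run
  as its ratio. This makes points affine in that product.\<close>

lemma ppt_replicate: "ppt a t p (replicate n i) c = t i + cprod a p (replicate n i) * (c - t i)"
proof (induction n arbitrary: p)
  case (Suc n)
  show ?case by (simp add: Suc.IH algebra_simps)
qed simp

lemma cprod_measurable:
  assumes "\<And>j. j < length u \<Longrightarrow> a (p @ take (Suc j) u) \<in> borel_measurable F"
  shows "(\<lambda>\<omega>. cprod (\<lambda>v. a v \<omega>) p u) \<in> borel_measurable F"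
  using assms
proof (induction u arbitrary: p)
  case (Cons i u)
  have "a (p @ [i]) \<in> borel_measurable F" using Cons.prems [of 0] by simp
  moreover have "(\<lambda>\<omega>. cprod (\<lambda>v. a v \<omega>) (p @ [i]) u) \<in> borel_measurable F"
    by (rule Cons.IH) (use Cons.prems [of "Suc _"] in auto)
  ultimately show ?case by simp
qed simp

lemma ppt_measurable:
  assumes "\<And>j. j < length u \<Longrightarrow> a (p @ take (Suc j) u) \<in> borel_measurable F"
    and "c \<in> borel_measurable F"
  shows "(\<lambda>\<omega>. ppt (\<lambda>v. a v \<omega>) t p u (c \<omega>)) \<in> borel_measurable F"
  using assms
proof (induction u arbitrary: p)
  case (Cons i u)
  have "a (p @ [i]) \<in> borel_measurable F" using Cons.prems(1) [of 0] by simp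
  moreover have "(\<lambda>\<omega>. ppt (\<lambda>v. a v \<omega>) t (p @ [i]) u (c \<omega>)) \<in> borel_measurable F"
    by (rule Cons.IH) (use Cons.prems(1) [of "Suc _"] Cons.prems(2) in auto)
  ultimately show ?case by simp
qed simp

lemma prefix_word_0 [simp]: "prefix_word w 0 = []"
  by (simp add: prefix_word_def)

lemma prefix_word_Suc: "prefix_word w (Suc n) = prefix_word w n @ [w n]"
  by (simp add: prefix_word_def)

lemma prefix_word_Suc': "prefix_word w (Suc n) = w 0 # prefix_word (\<lambda>j. w (Suc j)) n"
  by (simp add: prefix_word_def map_upt_Suc del: upt_Suc)

lemma length_prefix_word [simp]: "length (prefix_word w n) = n"
  by (simp add: prefix_word_def)

lemma prefix_word_in: "w \<in> inf_words N \<Longrightarrow> prefix_word w n \<in> fin_words N"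
  by (auto simp: prefix_word_def inf_words_def fin_words_def)

text \<open>One coordinate of one realization. The bounds are imposed on every list of numbers, also
  outside the alphabet, so that no side conditions on words arise; the final theorem arranges this
  by truncation.\<close>

locale environment =
  fixes a :: "nat list \<Rightarrow> real" and t :: "nat \<Rightarrow> real" and lo hi T :: real
  assumes lo: "0 < lo" and hi: "hi < 1"
    and a_ge: "lo \<le> \<bar>a v\<bar>" and a_le: "\<bar>a v\<bar> \<le> hi" and t_le: "\<bar>t i\<bar> \<le> T"
begin

text \<open>The solution of \<open>T * (1 + hi) + hi * R = R\<close>: the interval of radius
  \<open>Rb\<close> around 0 is mapped into itself by all the maps.\<close>

definition Rb :: real where "Rb = T * (1 + hi) / (1 - hi)"

lemma lo_le_hi: "lo \<le> hi"
  using a_ge a_le order_trans by blast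

lemma hi_pos: "0 < hi" using lo lo_le_hi by simp

lemma T_nonneg: "0 \<le> T" using t_le [of 0] by linarith

lemma Rb_eq: "T * (1 + hi) + hi * Rb = Rb"
  using hi by (simp add: Rb_def field_simps)

lemma Rb_nonneg: "0 \<le> Rb"
  using T_nonneg hi hi_pos by (simp add: Rb_def)

lemma T_le_Rb: "T \<le> Rb"
proof -
  have "T * 1 \<le> T * (1 + hi)" using T_nonneg hi_pos by (intro mult_left_mono) auto
  then show ?thesis using Rb_eq Rb_nonneg hi_pos by (smt (verit) mult_nonneg_nonneg)
qed

lemma a_nonzero: "a v \<noteq> 0" using a_ge [of v] lo by auto

lemma cprod_ge: "lo ^ length u \<le> \<bar>cprod a p u\<bar>"
  using a_ge lo by (induction u arbitrary: p) (auto simp: abs_mult intro!: mult_mono)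

lemma cprod_le: "\<bar>cprod a p u\<bar> \<le> hi ^ length u"
  using a_le hi_pos by (induction u arbitrary: p) (auto simp: abs_mult intro!: mult_mono)

lemma cprod_le_1: "\<bar>cprod a p u\<bar> \<le> 1"
  using cprod_le [of p u] power_le_one [of hi "length u"] hi hi_pos by linarith

lemma cprod_nonzero: "cprod a p u \<noteq> 0"
  using a_nonzero by (induction u arbitrary: p) auto

lemma step_le:
  assumes "\<bar>x\<bar> \<le> Rb"
  shows "\<bar>(1 - a v) * t i + a v * x\<bar> \<le> Rb"
proof -
  have "\<bar>(1 - a v) * t i\<bar> \<le> (1 + hi) * T"
    unfolding abs_mult using a_le [of v] t_le [of i] hi_pos by (intro mult_mono) auto
  moreover have "\<bar>a v * x\<bar> \<le> hi * Rb"
    unfolding abs_mult using a_le [of v] assms hi_pos by (intro mult_mono) auto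
  ultimately show ?thesis using Rb_eq by (simp add: mult.commute)
qed

lemma ppt_le: "\<bar>c\<bar> \<le> Rb \<Longrightarrow> \<bar>ppt a t p u c\<bar> \<le> Rb"
  by (induction u arbitrary: p) (auto intro: step_le)

lemma proj_term_le:
  "\<bar>cprod a p (prefix_word w j) * (1 - a (p @ prefix_word w (Suc j))) * t (w j)\<bar> \<le> ((1 + hi) * T) * hi ^ j"
proof -
  have "\<bar>cprod a p (prefix_word w j) * (1 - a (p @ prefix_word w (Suc j))) * t (w j)\<bar>
      \<le> hi ^ j * (1 + hi) * T"
    unfolding abs_mult
    using cprod_le [of p "prefix_word w j"] a_le [of "p @ prefix_word w (Suc j)"] t_le [of "w j"] hi_pos
    by (intro mult_mono) auto
  then show ?thesis by (simp add: mult_ac)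
qed

lemma summable_bound: "summable (\<lambda>j. ((1 + hi) * T) * hi ^ j)"
  using hi hi_pos by (intro summable_mult summable_geometric) auto

lemma proj_summable:
  "summable (\<lambda>j. cprod a p (prefix_word w j) * (1 - a (p @ prefix_word w (Suc j))) * t (w j))"
  by (rule summable_comparison_test' [OF summable_bound]) (use proj_term_le in auto)

lemma proj_step:
  "proj a t p w = (1 - a (p @ [w 0])) * t (w 0) + a (p @ [w 0]) * proj a t (p @ [w 0]) (\<lambda>j. w (Suc j))"
proof -
  let ?w = "\<lambda>j. w (Suc j)" and ?p = "p @ [w 0]"
  have "proj a t p w = (\<Sum>j. cprod a p (prefix_word w (Suc j)) * (1 - a (p @ prefix_word w (Suc (Suc j)))) * t (w (Suc j)))
      + cprod a p (prefix_word w 0) * (1 - a (p @ prefix_word w (Suc 0))) * t (w 0)"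
    unfolding proj_def using suminf_split_head [OF proj_summable [of p w]] by simp
  also have "(\<lambda>j. cprod a p (prefix_word w (Suc j)) * (1 - a (p @ prefix_word w (Suc (Suc j)))) * t (w (Suc j)))
      = (\<lambda>j. a ?p * (cprod a ?p (prefix_word ?w j) * (1 - a (?p @ prefix_word ?w (Suc j))) * t (?w j)))"
    unfolding prefix_word_Suc' [of w] by (simp add: mult_ac)
  also have "(\<Sum>j. a ?p * (cprod a ?p (prefix_word ?w j) * (1 - a (?p @ prefix_word ?w (Suc j))) * t (?w j)))
      = a ?p * proj a t ?p ?w"
    unfolding proj_def by (rule suminf_mult [OF proj_summable])
  finally show ?thesis by (simp add: prefix_word_Suc)
qed

lemma proj_prefix:
  "proj a t p w = ppt a t p (prefix_word w n) (proj a t (p @ prefix_word w n) (\<lambda>j. w (n + j)))"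
proof (induction n)
  case (Suc n)
  show ?case
    unfolding Suc.IH
    by (subst proj_step) (simp add: prefix_word_Suc ppt_append)
qed simp

lemma proj_le: "\<bar>proj a t p w\<bar> \<le> Rb"
proof -
  let ?f = "\<lambda>j. cprod a p (prefix_word w j) * (1 - a (p @ prefix_word w (Suc j))) * t (w j)"
  have *: "\<bar>?f j\<bar> \<le> ((1 + hi) * T) * hi ^ j" for j
    by (rule proj_term_le)
  have sum: "summable (\<lambda>j. \<bar>?f j\<bar>)"
  proof (rule summable_comparison_test' [OF summable_bound])
    show "norm \<bar>?f j\<bar> \<le> ((1 + hi) * T) * hi ^ j" if "0 \<le> j" for j
      using * [of j] by (simp only: real_norm_def abs_abs)
  qed
  have "\<bar>proj a t p w\<bar> \<le> (\<Sum>j. \<bar>?f j\<bar>)"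
    unfolding proj_def by (rule summable_rabs [OF sum])
  also have "\<dots> \<le> (\<Sum>j. ((1 + hi) * T) * hi ^ j)"
    by (rule suminf_le [OF * sum summable_bound])
  also have "\<dots> = Rb"
    using hi hi_pos by (simp add: suminf_mult suminf_geometric Rb_def)
  finally show ?thesis .
qed

text \<open>Peeling off \<open>n\<close> letters, whose maps all fix \<open>t z\<close>, leaves an
  error of order \<open>hi ^ n\<close>. Hence a finitely coded point based at \<open>t z\<close> is
  the projection of an infinite word (\<open>ppt_eq_proj\<close>).\<close>

lemma proj_const: "proj a t p (\<lambda>_. z) = t z"
proof -
  have "\<bar>proj a t p (\<lambda>_. z) - t z\<bar> \<le> hi ^ n * (Rb + Rb)" for n
  proof -
    have "proj a t p (\<lambda>_. z) = ppt a t p (replicate n z) (proj a t (p @ replicate n z) (\<lambda>_. z))"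
      using proj_prefix [of p "\<lambda>_. z" n] by (simp add: prefix_word_def map_replicate_const)
    then have "proj a t p (\<lambda>_. z) - t z = cprod a p (replicate n z) * (proj a t (p @ replicate n z) (\<lambda>_. z) - t z)"
      by (simp add: ppt_replicate)
    also have "\<bar>\<dots>\<bar> \<le> hi ^ n * (Rb + Rb)"
      unfolding abs_mult
      using cprod_le [of p "replicate n z"] proj_le [of "p @ replicate n z" "\<lambda>_. z"] t_le [of z] T_le_Rb hi_pos
      by (intro mult_mono) auto
    finally show ?thesis .
  qed
  moreover have "(\<lambda>n. hi ^ n * (Rb + Rb)) \<longlonglongrightarrow> 0 * (Rb + Rb)"
    using hi hi_pos by (intro tendsto_intros LIMSEQ_realpow_zero) auto
  ultimately have "\<bar>proj a t p (\<lambda>_. z) - t z\<bar> \<le> 0"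
    by (intro LIMSEQ_le_const [of _ "0 :: real"]) auto
  then show ?thesis by simp
qed

lemma ppt_eq_proj: "ppt a t [] u (t z) = proj a t [] (\<lambda>j. if j < length u then u ! j else z)"
proof -
  have "prefix_word (\<lambda>j. if j < length u then u ! j else z) (length u) = u"
    by (rule nth_equalityI) (auto simp: prefix_word_def)
  then show ?thesis
    using proj_prefix [of "[]" "\<lambda>j. if j < length u then u ! j else z" "length u"] by (simp add: proj_const)
qed

lemma proj_close:
  assumes "prefix_word w n = prefix_word w' n"
  shows "\<bar>proj a t p w - proj a t p w'\<bar> \<le> hi ^ n * (2 * Rb)"
proof -
  let ?q = "p @ prefix_word w' n"
  have "proj a t p w - proj a t p w'
      = cprod a p (prefix_word w' n) * (proj a t ?q (\<lambda>j. w (n + j)) - proj a t ?q (\<lambda>j. w' (n + j)))"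
    using proj_prefix [of p w n] proj_prefix [of p w' n] assms by (simp add: ppt_diff)
  also have "\<bar>\<dots>\<bar> \<le> hi ^ n * (Rb + Rb)"
    unfolding abs_mult
    using cprod_le [of p "prefix_word w' n"] proj_le [of ?q "\<lambda>j. w (n + j)"] proj_le [of ?q "\<lambda>j. w' (n + j)"] hi_pos
    by (intro mult_mono) auto
  finally show ?thesis by simp
qed

end

text \<open>The product in \<open>sponge_proj\<close> runs over the prefixes of length 0 to
  \<open>j\<close>; the empty one contributes the factor 1, which leaves \<open>cprod\<close> along
  the prefix of length \<open>j\<close>.\<close>

lemma sponge_proj_nth:
  "sponge_proj \<alpha> t \<omega> w $ k = proj (\<lambda>u. \<alpha> k u \<omega>) (\<lambda>i. t i $ k) [] w"
proof -
  have "(\<Prod>m<Suc j. diagA \<alpha> k (prefix_word w m) \<omega>) = cprod (\<lambda>u. \<alpha> k u \<omega>) [] (prefix_word w j)" for j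
  proof (induction j)
    case (Suc j)
    then show ?case
      by (subst prod.lessThan_Suc) (simp add: prefix_word_Suc cprod_append diagA_def)
  qed (simp add: diagA_def)
  then show ?thesis
    unfolding sponge_proj_def proj_def by (simp add: diagA_def prefix_word_Suc)
qed

section \<open>Compactness of the sponge\<close>

lemma compact_inf_words: "compact (inf_words N)"
proof -
  have "inf_words N = PiE UNIV (\<lambda>_. {1..N})"
    by (auto simp: inf_words_def)
  moreover have "compactin (product_topology (\<lambda>_. euclidean) (UNIV :: nat set)) (PiE UNIV (\<lambda>_. {1..N}))"
    by (subst compactin_PiE) (auto intro!: finite_imp_compact)
  ultimately show ?thesis
    by (simp add: euclidean_product_topology)
qed

lemma open_cylinder: "open {w' :: nat \<Rightarrow> nat. prefix_word w' n = prefix_word w n}"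
proof -
  have "{w'. prefix_word w' n = prefix_word w n} = (\<Inter>j\<in>{..<n}. (\<lambda>w'. w' j) -` {w j})"
    by (auto simp: prefix_word_def)
  also have "open \<dots>"
  proof (intro open_INT finite_lessThan ballI open_vimage)
    show "open {w j}" for j by (rule Topological_Spaces.open_discrete)
    show "continuous_on UNIV (\<lambda>w' :: nat \<Rightarrow> nat. w' j)" for j
      by (rule continuous_on_product_coordinates)
  qed
  finally show ?thesis .
qed

text \<open>The sponge is the image of a compact product of finite sets; words with a common prefix
  of length \<open>n\<close> have coordinates within a multiple of \<open>hi ^ n\<close>, which is
  continuity in the product topology.\<close>

lemma compact_sponge:
  fixes \<alpha> :: "'d::finite \<Rightarrow> nat list \<Rightarrow> 'w \<Rightarrow> real"
  assumes env: "\<And>k. environment (\<lambda>u. \<alpha> k u \<omega>) (\<lambda>i. t i $ k) lo hi T"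
  shows "compact (sponge N \<alpha> t \<omega>)"
proof -
  have "continuous_on (inf_words N) (\<lambda>w. proj (\<lambda>u. \<alpha> k u \<omega>) (\<lambda>i. t i $ k) [] w)" for k
    unfolding continuous_on_topological
  proof (intro ballI allI impI)
    interpret environment "\<lambda>u. \<alpha> k u \<omega>" "\<lambda>i. t i $ k" lo hi T by (rule env)
    let ?f = "proj (\<lambda>u. \<alpha> k u \<omega>) (\<lambda>i. t i $ k) []"
    fix w B assume "open B" "?f w \<in> B"
    then obtain e where e: "e > 0" "ball (?f w) e \<subseteq> B" by (meson openE)
    have "(\<lambda>n. hi ^ n * (2 * Rb)) \<longlonglongrightarrow> 0 * (2 * Rb)"
      using hi hi_pos by (intro tendsto_intros LIMSEQ_realpow_zero) auto
    then have "\<forall>\<^sub>F n in sequentially. hi ^ n * (2 * Rb) < e"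
      using e(1) by (auto dest: order_tendstoD(2))
    then obtain n where n: "hi ^ n * (2 * Rb) < e"
      by (auto simp: eventually_sequentially)
    have "?f w' \<in> B" if "prefix_word w' n = prefix_word w n" for w'
      using proj_close [OF that, of "[]"] n e(2) by (auto simp: dist_real_def subset_iff abs_minus_commute)
    then show "\<exists>A. open A \<and> w \<in> A \<and> (\<forall>y\<in>inf_words N. y \<in> A \<longrightarrow> ?f y \<in> B)"
      by (intro exI [of _ "{w'. prefix_word w' n = prefix_word w n}"] conjI open_cylinder) auto
  qed
  then have "continuous_on (inf_words N) (\<lambda>w. \<chi> k. proj (\<lambda>u. \<alpha> k u \<omega>) (\<lambda>i. t i $ k) [] w)"
    by (rule continuous_on_vec_lambda)
  moreover have "sponge_proj \<alpha> t \<omega> = (\<lambda>w. \<chi> k. proj (\<lambda>u. \<alpha> k u \<omega>) (\<lambda>i. t i $ k) [] w)"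
    by (simp add: vec_eq_iff fun_eq_iff sponge_proj_nth)
  ultimately show ?thesis
    unfolding sponge_def by (intro compact_continuous_image compact_inf_words) simp
qed

subsection \<open>Moments and runs of a letter\<close>

text \<open>A continuous density need not be bounded on the line; because the law lives on a compact
  interval, the maximum there serves as a uniform constant.\<close>

lemma conv_power_window:
  fixes f :: "real \<Rightarrow> real"
  assumes f: "continuous_on UNIV f" "\<And>x. 0 \<le> f x"
    and D: "D = density lborel (\<lambda>x. ennreal (f x))"
    and supp: "AE x in D. a \<le> x \<and> x \<le> b"
  obtains C where "C \<ge> 0" "\<And>x y. x \<le> y \<Longrightarrow> emeasure D {x..y} \<le> ennreal (C * (y - x))"
proof -
  have "bounded (f ` {a..b})"
    by (intro compact_imp_bounded compact_continuous_image continuous_on_subset [OF f(1)]) auto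
  then obtain C where C: "\<forall>x\<in>{a..b}. \<bar>f x\<bar> \<le> C"
    unfolding bounded_iff by auto
  have [measurable]: "f \<in> borel_measurable borel"
    using f(1) by (rule borel_measurable_continuous_onI)
  have "emeasure D {x..y} \<le> ennreal (\<bar>C\<bar> * (y - x))" if "x \<le> y" for x y
  proof -
    have "emeasure D {x..y} = emeasure D ({x..y} \<inter> {a..b})"
      by (rule emeasure_eq_AE) (use supp in \<open>auto simp: D\<close>)
    also have "\<dots> = (\<integral>\<^sup>+z. ennreal (f z) * indicator ({x..y} \<inter> {a..b}) z \<partial>lborel)"
      unfolding D by (rule emeasure_density) auto
    also have "\<dots> \<le> (\<integral>\<^sup>+z. ennreal \<bar>C\<bar> * indicator {x..y} z \<partial>lborel)"
      by (intro nn_integral_mono) (use C in \<open>force simp: indicator_def intro: ennreal_leI\<close>)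
    also have "\<dots> = ennreal \<bar>C\<bar> * ennreal (y - x)"
      using that by (simp add: nn_integral_cmult)
    finally show ?thesis using that by (simp add: ennreal_mult)
  qed
  then show ?thesis by (intro that [of "\<bar>C\<bar>"]) auto
qed

lemma fin_words_append [simp]: "u @ v \<in> fin_words N \<longleftrightarrow> u \<in> fin_words N \<and> v \<in> fin_words N"
  by (auto simp: fin_words_def)

lemma fin_words_Nil [simp]: "[] \<in> fin_words N" by (simp add: fin_words_def)

lemma fin_words_Cons [simp]: "i # u \<in> fin_words N \<longleftrightarrow> i \<in> {1..N} \<and> u \<in> fin_words N"
  by (simp add: fin_words_def)

lemma fin_words_replicate: "i \<in> {1..N} \<Longrightarrow> replicate n i \<in> fin_words N"
  by (auto simp: fin_words_def)

lemma fin_words_take: "u \<in> fin_words N \<Longrightarrow> take j u \<in> fin_words N"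
  by (auto simp: fin_words_def dest: in_set_takeD)

lemma fin_words_nth: "u \<in> fin_words N \<Longrightarrow> j < length u \<Longrightarrow> u ! j \<in> {1..N}"
  unfolding fin_words_def using nth_mem by blast

locale random_sponge = prob_space M for M :: "'w measure" +
  fixes N :: nat and \<alpha> :: "'d::finite \<Rightarrow> nat list \<Rightarrow> 'w \<Rightarrow> real" and t :: "nat \<Rightarrow> real^'d"
    and lo hi T :: real
  assumes env: "\<And>k \<omega>. environment (\<lambda>u. \<alpha> k u \<omega>) (\<lambda>i. t i $ k) lo hi T"
    and indep_children: "indep_vars (\<lambda>_. PiM {1..N} (\<lambda>_. borel))
               (\<lambda>(u, l). child_vec N \<alpha> l u) {(u, l). u \<in> fin_words N}"
    and ident_children: "\<And>l u. u \<in> fin_words N \<Longrightarrow>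
               distr M (PiM {1..N} (\<lambda>_. borel)) (child_vec N \<alpha> l u)
             = distr M (PiM {1..N} (\<lambda>_. borel)) (child_vec N \<alpha> l [])"
begin

sublocale indep_family M "\<lambda>_. PiM {1..N} (\<lambda>_. borel)" "\<lambda>(u, l). child_vec N \<alpha> l u"
    "{(u, l). u \<in> fin_words N}"
  by unfold_locales (rule indep_children)

sublocale env: environment "\<lambda>u. \<alpha> k u \<omega>" "\<lambda>i. t i $ k" lo hi T for k \<omega>
  by (rule env)

abbreviation A :: "'d \<Rightarrow> nat list \<Rightarrow> nat list \<Rightarrow> 'w \<Rightarrow> real" where
  "A k p u \<omega> \<equiv> cprod (\<lambda>v. \<alpha> k v \<omega>) p u"

abbreviation P :: "'d \<Rightarrow> nat list \<Rightarrow> nat list \<Rightarrow> real \<Rightarrow> 'w \<Rightarrow> real" where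
  "P k p u c \<omega> \<equiv> ppt (\<lambda>v. \<alpha> k v \<omega>) (\<lambda>i. t i $ k) p u c"

text \<open>The contraction at a child is a component of the vector indexed by its parent. Hence in
  \<open>A_gen\<close> and \<open>P_gen\<close> the relevant indices are the words
  \<open>p @ take j u\<close> with \<open>j < length u\<close>, without \<open>p @ u\<close>
  itself.\<close>

lemma \<alpha>_gen:
  assumes "(u, k) \<in> K" "u \<in> fin_words N" "i \<in> {1..N}"
  shows "\<alpha> k (u @ [i]) \<in> borel_measurable (gen K)"
proof -
  have "(\<lambda>(u, l). child_vec N \<alpha> l u) (u, k) \<in> measurable (gen K) (PiM {1..N} (\<lambda>_. borel))"
    using assms by (intro measurable_gen) auto
  then have "(\<lambda>\<omega>. child_vec N \<alpha> k u \<omega> i) \<in> borel_measurable (gen K)"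
    using assms(3) by (auto intro: measurable_component_singleton [THEN measurable_compose_rev])
  then show ?thesis using assms(3) by (simp add: child_vec_def)
qed

lemma A_gen:
  assumes "p @ u \<in> fin_words N" "\<And>j. j < length u \<Longrightarrow> (p @ take j u, k) \<in> K"
  shows "A k p u \<in> borel_measurable (gen K)"
proof (rule cprod_measurable)
  fix j assume j: "j < length u"
  have "\<alpha> k ((p @ take j u) @ [u ! j]) \<in> borel_measurable (gen K)"
    using assms j fin_words_nth [of u N j] by (intro \<alpha>_gen) (auto intro: fin_words_take)
  then show "\<alpha> k (p @ take (Suc j) u) \<in> borel_measurable (gen K)"
    using j by (simp add: take_Suc_conv_app_nth)
qed

lemma P_gen:
  assumes "p @ u \<in> fin_words N" "\<And>j. j < length u \<Longrightarrow> (p @ take j u, k) \<in> K"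
  shows "P k p u c \<in> borel_measurable (gen K)"
proof (rule ppt_measurable)
  fix j assume j: "j < length u"
  have "\<alpha> k ((p @ take j u) @ [u ! j]) \<in> borel_measurable (gen K)"
    using assms j fin_words_nth [of u N j] by (intro \<alpha>_gen) (auto intro: fin_words_take)
  then show "\<alpha> k (p @ take (Suc j) u) \<in> borel_measurable (gen K)"
    using j by (simp add: take_Suc_conv_app_nth)
qed simp

lemma A_measurable: "p @ u \<in> fin_words N \<Longrightarrow> A k p u \<in> borel_measurable M"
  by (rule gen_measurableD [OF subset_refl], rule A_gen) (auto intro: fin_words_take)

lemma P_measurable: "p @ u \<in> fin_words N \<Longrightarrow> P k p u c \<in> borel_measurable M"
  by (rule gen_measurableD [OF subset_refl], rule P_gen) (auto intro: fin_words_take)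

definition moment :: "'d \<Rightarrow> real \<Rightarrow> nat \<Rightarrow> real" where
  "moment k s i = (\<integral>\<omega>. \<bar>\<alpha> k [i] \<omega>\<bar> powr s \<partial>M)"

definition wmoment :: "'d \<Rightarrow> real \<Rightarrow> nat list \<Rightarrow> real" where
  "wmoment k s u = prod_list (map (moment k s) u)"

lemma distr_child:
  assumes "u \<in> fin_words N" "i \<in> {1..N}"
  shows "distr M borel (\<alpha> k (u @ [i])) = distr M borel (\<alpha> k [i])"
proof -
  have *: "distr M borel (\<alpha> k (v @ [i]))
      = distr (distr M (PiM {1..N} (\<lambda>_. borel)) (child_vec N \<alpha> k v)) borel (\<lambda>x. x i)"
    if "v \<in> fin_words N" for v
  proof -
    have "child_vec N \<alpha> k v \<in> measurable M (PiM {1..N} (\<lambda>_. borel))"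
      using X_measurable [of "(v, k)"] that by simp
    then show ?thesis
      using assms(2) by (subst distr_distr) (auto simp: comp_def child_vec_def)
  qed
  show ?thesis using *[OF assms(1)] *[of "[]"] ident_children [OF assms(1)] by simp
qed

lemma \<alpha>_measurable: "u \<in> fin_words N \<Longrightarrow> i \<in> {1..N} \<Longrightarrow> \<alpha> k (u @ [i]) \<in> borel_measurable M"
  using A_measurable [of u "[i]" k] by simp

lemma \<alpha>_measurable1: "i \<in> {1..N} \<Longrightarrow> \<alpha> k [i] \<in> borel_measurable M"
  using \<alpha>_measurable [of "[]" i] by simp

lemma powr_le_1: "\<bar>x\<bar> \<le> 1 \<Longrightarrow> 0 \<le> s \<Longrightarrow> \<bar>x\<bar> powr s \<le> (1 :: real)"
  using powr_mono2 [of s "\<bar>x\<bar>" 1] by simp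

lemma \<alpha>_le_1: "\<bar>\<alpha> k u \<omega>\<bar> \<le> 1"
  using env.a_le [of k u \<omega>] env.hi by simp

lemma moment_integrable:
  "i \<in> {1..N} \<Longrightarrow> 0 \<le> s \<Longrightarrow> integrable M (\<lambda>\<omega>. \<bar>\<alpha> k [i] \<omega>\<bar> powr s)"
  using \<alpha>_measurable1 [of i k]
  by (intro integrable_const_bound [of _ 1]) (auto intro!: AE_I2 powr_le_1 \<alpha>_le_1)

lemma moment_ge:
  assumes "i \<in> {1..N}" "0 \<le> s" shows "lo powr s \<le> moment k s i"
proof -
  have "(\<integral>\<omega>. lo powr s \<partial>M) \<le> moment k s i"
    unfolding moment_def
    using env.a_ge env.lo assms
    by (intro integral_mono moment_integrable) (auto intro!: powr_mono2)
  then show ?thesis by (simp add: prob_space)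
qed

lemma moment_le_1: assumes "i \<in> {1..N}" "0 \<le> s" shows "moment k s i \<le> 1"
proof -
  have "moment k s i \<le> (\<integral>\<omega>. 1 \<partial>M)"
    unfolding moment_def
    using assms by (intro integral_mono moment_integrable) (auto intro!: powr_le_1 \<alpha>_le_1)
  then show ?thesis by (simp add: prob_space)
qed

lemma moment_pos: "i \<in> {1..N} \<Longrightarrow> 0 \<le> s \<Longrightarrow> 0 < moment k s i"
  using moment_ge [of i s k] env.lo by (smt (verit) powr_gt_zero)

lemma nn_moment:
  assumes "u \<in> fin_words N" "i \<in> {1..N}" "0 \<le> s"
  shows "(\<integral>\<^sup>+\<omega>. ennreal (\<bar>\<alpha> k (u @ [i]) \<omega>\<bar> powr s) \<partial>M) = ennreal (moment k s i)"
proof -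
  have "(\<integral>\<^sup>+\<omega>. ennreal (\<bar>\<alpha> k (u @ [i]) \<omega>\<bar> powr s) \<partial>M)
      = (\<integral>\<^sup>+x. ennreal (\<bar>x\<bar> powr s) \<partial>distr M borel (\<alpha> k (u @ [i])))"
    using \<alpha>_measurable assms by (subst nn_integral_distr) auto
  also have "\<dots> = (\<integral>\<^sup>+\<omega>. ennreal (\<bar>\<alpha> k [i] \<omega>\<bar> powr s) \<partial>M)"
    using \<alpha>_measurable1 assms by (subst distr_child, simp, simp, subst nn_integral_distr) auto
  also have "\<dots> = ennreal (moment k s i)"
    unfolding moment_def using assms moment_integrable by (intro nn_integral_eq_integral) auto
  finally show ?thesis .
qed

lemma wmoment_Nil [simp]: "wmoment k s [] = 1"
  and wmoment_Cons [simp]: "wmoment k s (i # u) = moment k s i * wmoment k s u"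
  and wmoment_append: "wmoment k s (u @ v) = wmoment k s u * wmoment k s v"
  by (simp_all add: wmoment_def)

lemma wmoment_nonneg: "u \<in> fin_words N \<Longrightarrow> 0 \<le> s \<Longrightarrow> 0 \<le> wmoment k s u"
  by (induction u) (auto intro!: mult_nonneg_nonneg less_imp_le [OF moment_pos])

text \<open>The factors along a branch belong to vectors at words of increasing length, hence are
  independent, and each one has the law of its counterpart on the first level; so the mean does not
  depend on \<open>p\<close>.\<close>

lemma nn_wmoment:
  assumes "p @ u \<in> fin_words N" "0 \<le> s"
  shows "(\<integral>\<^sup>+\<omega>. ennreal (\<bar>A k p u \<omega>\<bar> powr s) \<partial>M) = ennreal (wmoment k s u)"
  using assms(1)
proof (induction u arbitrary: p)
  case Nil
  then show ?case by (simp add: emeasure_space_1)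
next
  case (Cons i u)
  let ?K = "{(p, k)}" and ?L = "{(v, k) | v. v \<in> fin_words N \<and> length v > length p}"
  have 1: "\<alpha> k (p @ [i]) \<in> borel_measurable (gen ?K)"
    using Cons.prems by (intro \<alpha>_gen) auto
  have 2: "A k (p @ [i]) u \<in> borel_measurable (gen ?L)"
    using Cons.prems by (intro A_gen) (auto intro: fin_words_take)
  have "(\<integral>\<^sup>+\<omega>. ennreal (\<bar>A k p (i # u) \<omega>\<bar> powr s) \<partial>M)
      = (\<integral>\<^sup>+\<omega>. ennreal (\<bar>\<alpha> k (p @ [i]) \<omega>\<bar> powr s) * ennreal (\<bar>A k (p @ [i]) u \<omega>\<bar> powr s) \<partial>M)"
    by (simp add: abs_mult powr_mult ennreal_mult)
  also have "\<dots> = (\<integral>\<^sup>+\<omega>. ennreal (\<bar>\<alpha> k (p @ [i]) \<omega>\<bar> powr s) \<partial>M)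
      * (\<integral>\<^sup>+\<omega>. ennreal (\<bar>A k (p @ [i]) u \<omega>\<bar> powr s) \<partial>M)"
    using Cons.prems 1 2 by (intro nn_integral_gen_mult [of ?K ?L]) auto
  also have "\<dots> = ennreal (moment k s i) * ennreal (wmoment k s u)"
    using Cons.prems Cons.IH [of "p @ [i]"] assms(2) by (subst nn_moment) auto
  also have "\<dots> = ennreal (wmoment k s (i # u))"
    using Cons.prems assms(2) by (simp add: ennreal_mult' less_imp_le moment_pos)
  finally show ?case .
qed

text \<open>Along a run the logarithms of the contractions are independent with a common law. The
  last letter is split off rather than the first, because \<open>conv_power\<close> adds its factor
  on the right.\<close>

lemma distr_ln_replicate:
  assumes p: "p \<in> fin_words N" and i: "i \<in> {1..N}"
  shows "distr M borel (\<lambda>\<omega>. ln \<bar>A k p (replicate n i) \<omega>\<bar>)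
    = conv_power (distr M borel (\<lambda>\<omega>. ln \<bar>\<alpha> k [i] \<omega>\<bar>)) n"
proof (induction n)
  case 0
  then show ?case by (simp add: distr_const)
next
  case (Suc n)
  let ?q = "p @ replicate n i"
  let ?K = "{(p @ replicate j i, k) | j. j < n}" and ?L = "{(?q, k)}"
  have q: "?q \<in> fin_words N" using p i by (simp add: fin_words_replicate)
  have 1: "A k p (replicate n i) \<in> borel_measurable (gen ?K)"
    using p i by (intro A_gen) (auto simp: fin_words_replicate min_def)
  have 2: "\<alpha> k (?q @ [i]) \<in> borel_measurable (gen ?L)"
    using q i by (intro \<alpha>_gen) auto
  have ind: "indep_var borel (\<lambda>\<omega>. ln \<bar>A k p (replicate n i) \<omega>\<bar>) borel (\<lambda>\<omega>. ln \<bar>\<alpha> k (?q @ [i]) \<omega>\<bar>)"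
    using 1 2 p i q by (intro indep_var_gen [of ?K ?L]) (auto simp: fin_words_replicate)
  have m1: "A k p (replicate n i) \<in> borel_measurable M"
    using q by (intro A_measurable) auto
  have m2: "\<alpha> k (?q @ [i]) \<in> borel_measurable M" using q i by (rule \<alpha>_measurable)
  have "A k p (replicate (Suc n) i) \<omega> = A k p (replicate n i) \<omega> * \<alpha> k (?q @ [i]) \<omega>" for \<omega>
  proof -
    have "replicate (Suc n) i = replicate n i @ [i]" by (simp add: replicate_append_same)
    then show ?thesis by (simp only: cprod_append) simp
  qed
  then have "(\<lambda>\<omega>. ln \<bar>A k p (replicate (Suc n) i) \<omega>\<bar>)
      = (\<lambda>\<omega>. ln \<bar>A k p (replicate n i) \<omega>\<bar> + ln \<bar>\<alpha> k (?q @ [i]) \<omega>\<bar>)"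
    by (simp only: abs_mult) (simp add: ln_mult env.cprod_nonzero env.a_nonzero)
  then have "distr M borel (\<lambda>\<omega>. ln \<bar>A k p (replicate (Suc n) i) \<omega>\<bar>)
      = convolution (distr M borel (\<lambda>\<omega>. ln \<bar>A k p (replicate n i) \<omega>\<bar>))
          (distr M borel (\<lambda>\<omega>. ln \<bar>\<alpha> k (?q @ [i]) \<omega>\<bar>))"
    using sum_indep_random_variable [OF ind] m1 m2 by simp
  also have "distr M borel (\<lambda>\<omega>. ln \<bar>\<alpha> k (?q @ [i]) \<omega>\<bar>) = distr M borel (\<lambda>\<omega>. ln \<bar>\<alpha> k [i] \<omega>\<bar>)"
  proof -
    have "distr M borel (\<lambda>\<omega>. ln \<bar>\<alpha> k (?q @ [i]) \<omega>\<bar>) = distr (distr M borel (\<alpha> k (?q @ [i]))) borel (\<lambda>x. ln \<bar>x\<bar>)"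
      using m2 by (subst distr_distr) (auto simp: comp_def)
    also have "\<dots> = distr (distr M borel (\<alpha> k [i])) borel (\<lambda>x. ln \<bar>x\<bar>)"
      using distr_child [OF q i] by simp
    also have "\<dots> = distr M borel (\<lambda>\<omega>. ln \<bar>\<alpha> k [i] \<omega>\<bar>)"
      using \<alpha>_measurable1 [OF i] by (subst distr_distr) (auto simp: comp_def)
    finally show ?thesis .
  qed
  finally show ?case by (simp add: Suc.IH)
qed

text \<open>A linear bound on the concentration function of the product along a run of
  \<open>n\<close> letters \<open>i\<close>, uniform over the starting node. Smoothness of the
  distributions enters the separation argument only through it.\<close>

definition spreads :: "'d \<Rightarrow> nat \<Rightarrow> nat \<Rightarrow> real \<Rightarrow> bool" where
  "spreads k i n C \<longleftrightarrow> (\<forall>p\<in>fin_words N. \<forall>z \<delta>. \<delta> > 0 \<longrightarrow>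
    emeasure M {\<omega>\<in>space M. \<bar>A k p (replicate n i) \<omega> - z\<bar> \<le> \<delta>} \<le> ennreal (C * \<delta>))"

lemma run_window:
  assumes i: "i \<in> {1..N}" and smooth: "eventually_smooth (distr M borel (\<lambda>\<omega>. ln \<bar>\<alpha> k [i] \<omega>\<bar>))"
  obtains n C where "n \<ge> 1" "C \<ge> 0" "spreads k i n C"
proof -
  obtain n f where n: "n \<ge> 1" and f: "continuous_on UNIV f" "\<And>x. 0 \<le> f x"
    and D: "conv_power (distr M borel (\<lambda>\<omega>. ln \<bar>\<alpha> k [i] \<omega>\<bar>)) n = density lborel (\<lambda>x. ennreal (f x))"
    using smooth unfolding eventually_smooth_def by auto
  let ?Q = "\<lambda>p \<omega>. \<bar>A k p (replicate n i) \<omega>\<bar>"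
  have Q [measurable]: "?Q p \<in> borel_measurable M" if "p \<in> fin_words N" for p
    using A_measurable [of p "replicate n i" k] that i by (simp add: fin_words_replicate)
  have Q_ge: "\<And>p \<omega>. lo ^ n \<le> \<bar>A k p (replicate n i) \<omega>\<bar>"
    and Q_le: "\<And>p \<omega>. \<bar>A k p (replicate n i) \<omega>\<bar> \<le> 1"
    using env.cprod_ge [of "replicate n i"] env.cprod_le_1 by simp_all
  let ?D = "conv_power (distr M borel (\<lambda>\<omega>. ln \<bar>\<alpha> k [i] \<omega>\<bar>)) n"
  have D_distr: "?D = distr M borel (\<lambda>\<omega>. ln (?Q p \<omega>))" if "p \<in> fin_words N" for p
    using distr_ln_replicate [OF that i, of k n] by simp
  have pos: "0 < lo ^ n" using env.lo by simp
  have Q_pos: "\<And>p \<omega>. 0 < \<bar>A k p (replicate n i) \<omega>\<bar>"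
    using less_le_trans [OF pos Q_ge] .
  have "AE x in ?D. ln (lo ^ n) \<le> x \<and> x \<le> 0"
    unfolding D_distr [OF fin_words_Nil]
    using Q_ge Q_le pos Q_pos
    by (subst AE_distr_iff) (auto intro!: AE_I2 ln_mono)
  then obtain C where C: "C \<ge> 0" "\<And>x y. x \<le> y \<Longrightarrow> emeasure ?D {x..y} \<le> ennreal (C * (y - x))"
    using conv_power_window [OF f D] by blast
  have "emeasure M {\<omega>\<in>space M. \<bar>A k p (replicate n i) \<omega> - z\<bar> \<le> \<delta>} \<le> ennreal ((2 * C / lo ^ n) * \<delta>)"
    if p: "p \<in> fin_words N" and \<delta>: "\<delta> > 0" for p z \<delta>
  proof -
    \<comment> \<open>Passing to absolute values costs nothing by the reverse triangle inequality.
      The left end is raised to \<open>lo ^ n\<close>, below which the modulus of the product never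
      falls, so that logarithms can be taken.\<close>
    let ?x = "max (lo ^ n) (\<bar>z\<bar> - \<delta>)" and ?y = "\<bar>z\<bar> + \<delta>"
    have sub: "{\<omega>\<in>space M. \<bar>A k p (replicate n i) \<omega> - z\<bar> \<le> \<delta>} \<subseteq> {\<omega>\<in>space M. ?Q p \<omega> \<in> {?x..?y}}"
      using Q_ge by auto
    show ?thesis
    proof (cases "?x \<le> ?y")
      case False
      then have "{\<omega>\<in>space M. \<bar>A k p (replicate n i) \<omega> - z\<bar> \<le> \<delta>} = {}"
        using sub by (smt (verit, best) atLeastAtMost_iff empty_iff mem_Collect_eq subset_iff subsetI subset_antisym)
      then show ?thesis by (simp only: emeasure_empty zero_le)
    next
      case True
      have x: "0 < ?x" "lo ^ n \<le> ?x" using pos by auto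
      have "{\<omega>\<in>space M. ?Q p \<omega> \<in> {?x..?y}} \<subseteq> {\<omega>\<in>space M. ln (?Q p \<omega>) \<in> {ln ?x..ln ?y}}"
      proof (intro Collect_mono impI conjI)
        fix \<omega> assume *: "\<omega> \<in> space M \<and> ?Q p \<omega> \<in> {?x..?y}"
        then have "?x \<le> ?Q p \<omega>" "?Q p \<omega> \<le> ?y" by simp_all
        then show "ln (?Q p \<omega>) \<in> {ln ?x..ln ?y}" using x(1) less_le_trans [OF x(1)]
          by (auto simp del: max_less_iff_conj max.bounded_iff intro!: ln_mono)
      qed auto
      then have "emeasure M {\<omega>\<in>space M. \<bar>A k p (replicate n i) \<omega> - z\<bar> \<le> \<delta>}
          \<le> emeasure M {\<omega>\<in>space M. ln (?Q p \<omega>) \<in> {ln ?x..ln ?y}}"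
        using sub p by (intro emeasure_mono) auto
      also have "\<dots> = emeasure ?D {ln ?x..ln ?y}"
        unfolding D_distr [OF p] using p by (subst emeasure_distr) (auto intro!: arg_cong [where f = "emeasure M"])
      also have "\<dots> \<le> ennreal (C * (ln ?y - ln ?x))"
        using True x(1) by (intro C(2) ln_mono) auto
      \<comment> \<open>The logarithm has slope at most \<open>1 / lo ^ n\<close> from
        \<open>lo ^ n\<close> onwards, and the window has length at most
        \<open>2 * \<delta>\<close>; this is the origin of the constant
        \<open>2 * C / lo ^ n\<close>.\<close>
      also have "\<dots> \<le> ennreal ((2 * C / lo ^ n) * \<delta>)"
      proof (rule ennreal_leI)
        have "ln ?y - ln ?x = ln (?y / ?x)" using x True by (subst ln_div) auto
        also have "\<dots> \<le> ?y / ?x - 1" using x True by (intro ln_le_minus_one divide_pos_pos) auto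
        also have "\<dots> = (?y - ?x) / ?x" using x by (simp add: field_simps)
        also have "\<dots> \<le> 2 * \<delta> / lo ^ n"
          using x pos \<delta> by (intro frac_le) auto
        finally have "C * (ln ?y - ln ?x) \<le> C * (2 * \<delta> / lo ^ n)"
          using C(1) by (rule mult_left_mono)
        then show "C * (ln ?y - ln ?x) \<le> (2 * C / lo ^ n) * \<delta>" by (simp add: mult_ac)
      qed
      finally show ?thesis .
    qed
  qed
  then have "spreads k i n (2 * C / lo ^ n)" unfolding spreads_def by blast
  moreover have "2 * C / lo ^ n \<ge> 0" using C(1) pos by simp
  ultimately show ?thesis using n that by blast
qed

end

subsection \<open>Separation of two words\<close>

text \<open>A power with exponent in [0,1] dominates the identity on [0,1] and is at least 1 beyond.
  This converts the hitting probability of a window into powers of \<open>r\<close> and of the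
  contraction.\<close>

lemma min_1_le_powr:
  fixes e s :: real
  assumes "0 \<le> e" "0 \<le> s" "s \<le> 1"
  shows "min 1 e \<le> e powr s"
proof (cases "e \<le> 1")
  case True
  then have "e powr 1 \<le> e powr s"
    using assms by (cases "e = 0") (use powr_mono' [of s 1 e] in auto)
  then show ?thesis using assms(1) by simp
next
  case False
  then show ?thesis using assms ge_one_powr_ge_zero [of e s] by simp
qed

lemma half_distance_le:
  fixes x y z :: real
  assumes "\<bar>z - y\<bar> \<le> \<bar>x - y\<bar> / 2"
  shows "\<bar>x - y\<bar> / 2 \<le> \<bar>z - x\<bar>"
proof -
  have "\<bar>x - y\<bar> \<le> \<bar>z - x\<bar> + \<bar>z - y\<bar>" by arith
  then show ?thesis using assms by (simp add: field_simps)
qed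

context random_sponge
begin

text \<open>Along \<open>p @ b @ pre @ replicate n i @ replicate m j\<close> the point is an affine function of the
  product \<open>Q\<close> over the run of \<open>i\<close>; the run of \<open>j\<close> keeps its slope away from \<open>0\<close>. Since the second
  word leaves the first one inside \<open>b\<close>, it never meets the vectors that determine \<open>Q\<close>.\<close>

lemma separation_bound:
  fixes k :: 'd
  defines "\<kappa> i j \<equiv> \<bar>t i $ k - t j $ k\<bar> / 2"
  assumes words: "p \<in> fin_words N" "b \<in> fin_words N" "b' \<in> fin_words N" "pre \<in> fin_words N"
      "u \<in> fin_words N" "u' \<in> fin_words N" "i \<in> {1..N}" "j \<in> {1..N}"
    and b: "length b = length b'" "b \<noteq> b'"
    and ij: "t i $ k \<noteq> t j $ k" and m: "hi ^ m * (2 * env.Rb) \<le> \<kappa> i j"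
    and conc: "spreads k i n C"
    and C: "C \<ge> 0" and c: "\<bar>c\<bar> \<le> env.Rb" and r: "r > 0"
    and H: "H \<in> borel_measurable (gen ({(u, l). u \<in> fin_words N} -
              {(p @ b @ pre @ replicate q i, k) | q. q < n}))"
  shows "(\<integral>\<^sup>+\<omega>. H \<omega> * indicator {\<omega>. \<bar>P k [] (p @ b @ pre @ replicate n i @ replicate m j @ u) c \<omega>
            - P k [] (p @ b' @ u') c \<omega>\<bar> \<le> r} \<omega> \<partial>M)
    \<le> (\<integral>\<^sup>+\<omega>. H \<omega> * ennreal (min 1 (C / (lo ^ (length b + length pre) * \<kappa> i j) * (r / \<bar>A k [] p \<omega>\<bar>))) \<partial>M)"
proof -
  define K where "K = {(p @ b @ pre @ replicate q i, k) | q. q < n}"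
  define L where "L = {(u, l :: 'd). u \<in> fin_words N} - K"
  let ?g = "p @ b @ pre" and ?x = "p @ b @ pre @ replicate n i" and ?v = "replicate m j @ u"
  \<comment> \<open>By \<open>ppt_replicate\<close> the run sends \<open>y\<close> to
    \<open>t i + Q * (y - t i)\<close>. Applying the affine map along \<open>?g\<close>, of slope
    \<open>A k [] ?g\<close>, and subtracting the second point gives \<open>cc + Q * R\<close>,
    where only \<open>Q\<close> involves the vectors in \<open>K\<close>.\<close>
  define Q where "Q = A k ?g (replicate n i)"
  define R where "R = (\<lambda>\<omega>. A k [] ?g \<omega> * (P k ?x ?v c \<omega> - t i $ k))"
  define cc where "cc = (\<lambda>\<omega>. P k [] ?g (t i $ k) \<omega> - P k [] (p @ b' @ u') c \<omega>)"
  have reps: "replicate q i \<in> fin_words N" "replicate q j \<in> fin_words N" for q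
    using words fin_words_replicate by auto
  have KL: "K \<inter> L = {}" "K \<subseteq> {(u, l). u \<in> fin_words N}" "L \<subseteq> {(u, l). u \<in> fin_words N}"
    using words reps by (auto simp: K_def L_def)
  have notK: "(take q (p @ b' @ u'), k) \<notin> K" for q
  proof
    assume "(take q (p @ b' @ u'), k) \<in> K"
    then obtain q' where eq: "take q (p @ b' @ u') = p @ b @ pre @ replicate q' i"
      by (auto simp: K_def)
    have "take (length p + length b) (take q (p @ b' @ u')) = p @ b" unfolding eq by simp
    moreover have "length (take q (p @ b' @ u')) \<ge> length p + length b" unfolding eq by simp
    ultimately have "take (length p + length b) (p @ b' @ u') = p @ b"
      by (simp only: take_take length_take min.absorb1 min.bounded_iff)
    with b show False by simp
  qed
  have Q: "Q \<in> borel_measurable (gen K)"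
    unfolding Q_def using words reps
    by (intro A_gen) (auto simp: K_def intro!: exI)
  have "A k [] ?g \<in> borel_measurable (gen L)" "P k [] ?g (t i $ k) \<in> borel_measurable (gen L)"
    using words reps by (intro A_gen P_gen; force simp: L_def K_def fin_words_take dest: arg_cong [of _ _ length])+
  moreover have "P k ?x ?v c \<in> borel_measurable (gen L)"
    using words reps by (intro P_gen) (auto simp: L_def K_def fin_words_take dest: arg_cong [of _ _ length])
  moreover have "P k [] (p @ b' @ u') c \<in> borel_measurable (gen L)"
    using words reps notK by (intro P_gen) (auto simp: L_def fin_words_take)
  ultimately have R: "R \<in> borel_measurable (gen L)" and cc: "cc \<in> borel_measurable (gen L)"
    unfolding R_def cc_def by auto
  have \<kappa>: "\<kappa> i j > 0" using ij by (simp add: \<kappa>_def)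
  \<comment> \<open>The run of \<open>j\<close> has a length \<open>m\<close> that brings any tail
    to within \<open>\<kappa> i j\<close> of \<open>t j\<close>. As \<open>\<kappa> i j\<close> is
    half the distance from \<open>t i\<close> to \<open>t j\<close>, the other half keeps the tail
    away from \<open>t i\<close>.\<close>
  have slope: "\<kappa> i j \<le> \<bar>P k ?x ?v c \<omega> - t i $ k\<bar>" for \<omega>
  proof -
    let ?y = "P k (?x @ replicate m j) u c \<omega>"
    have "P k ?x ?v c \<omega> = t j $ k + A k ?x (replicate m j) \<omega> * (?y - t j $ k)"
      by (simp add: ppt_append ppt_replicate)
    moreover have "\<bar>A k ?x (replicate m j) \<omega> * (?y - t j $ k)\<bar> \<le> hi ^ m * (2 * env.Rb)"
      unfolding abs_mult
    proof (rule mult_mono)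
      show "\<bar>A k ?x (replicate m j) \<omega>\<bar> \<le> hi ^ m"
        using env.cprod_le [where u = "replicate m j"] by simp
      show "\<bar>?y - t j $ k\<bar> \<le> 2 * env.Rb"
        using env.ppt_le [OF c, of k \<omega> "?x @ replicate m j" u] env.t_le [of j k] env.T_le_Rb by linarith
    qed (use env.hi_pos in auto)
    ultimately have "\<bar>P k ?x ?v c \<omega> - t j $ k\<bar> \<le> \<bar>t i $ k - t j $ k\<bar> / 2"
      using m unfolding \<kappa>_def by simp
    then show ?thesis unfolding \<kappa>_def by (rule half_distance_le)
  qed
  \<comment> \<open>Passing through \<open>b\<close> and \<open>pre\<close> shrinks the slope at
    most by the power of \<open>lo\<close> given by their lengths; it stays comparable to the
    contraction at the branching node \<open>p\<close>.\<close>
  have slope_R: "lo ^ (length b + length pre) * \<kappa> i j * \<bar>A k [] p \<omega>\<bar> \<le> \<bar>R \<omega>\<bar>" for \<omega>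
  proof -
    have "A k [] ?g \<omega> = A k [] p \<omega> * A k p (b @ pre) \<omega>"
      using cprod_append [of _ "[]" p "b @ pre"] by simp
    then have "\<bar>R \<omega>\<bar> = \<bar>A k p (b @ pre) \<omega>\<bar> * \<bar>P k ?x ?v c \<omega> - t i $ k\<bar> * \<bar>A k [] p \<omega>\<bar>"
      unfolding R_def by (simp add: abs_mult)
    moreover have "lo ^ (length b + length pre) \<le> \<bar>A k p (b @ pre) \<omega>\<bar>"
      using env.cprod_ge [where u = "b @ pre"] by simp
    ultimately show ?thesis
      using slope [of \<omega>] \<kappa> env.lo by (auto intro!: mult_right_mono mult_mono)
  qed
  have pos: "0 < lo ^ (length b + length pre) * \<kappa> i j * \<bar>A k [] p \<omega>\<bar>" for \<omega>
    using env.lo \<kappa> env.cprod_nonzero by simp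
  have diff: "P k [] (p @ b @ pre @ replicate n i @ replicate m j @ u) c \<omega> - P k [] (p @ b' @ u') c \<omega>
      = cc \<omega> + Q \<omega> * R \<omega>" for \<omega>
  proof -
    have "P k [] (?g @ replicate n i @ ?v) c \<omega>
        = P k [] ?g (t i $ k + Q \<omega> * (P k ?x ?v c \<omega> - t i $ k)) \<omega>"
      by (simp only: ppt_append [of _ _ "[]" ?g] ppt_append [of _ _ _ "replicate n i"] ppt_replicate Q_def)
        simp
    also have "\<dots> = P k [] ?g (t i $ k) \<omega> + A k [] ?g \<omega> * (Q \<omega> * (P k ?x ?v c \<omega> - t i $ k))"
      using ppt_diff [of "\<lambda>v. \<alpha> k v \<omega>" "\<lambda>i. t i $ k" "[]" ?g
          "t i $ k + Q \<omega> * (P k ?x ?v c \<omega> - t i $ k)" "t i $ k"] by simp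
    finally show ?thesis by (simp add: cc_def R_def)
  qed
  have "(\<integral>\<^sup>+\<omega>. H \<omega> * indicator {\<omega>. \<bar>cc \<omega> + Q \<omega> * R \<omega>\<bar> \<le> r} \<omega> \<partial>M)
      \<le> (\<integral>\<^sup>+\<omega>. H \<omega> * ennreal (min 1 (C * (r / \<bar>R \<omega>\<bar>))) \<partial>M)"
  proof (rule nn_integral_gen_window [OF KL Q cc R _ _ r])
    show "H \<in> borel_measurable (gen L)" using H by (simp add: L_def K_def)
    show "R \<omega> \<noteq> 0" for \<omega> using slope_R [of \<omega>] pos [of \<omega>] by auto
    show "emeasure M {\<omega> \<in> space M. \<bar>Q \<omega> - z\<bar> \<le> \<delta>} \<le> ennreal (C * \<delta>)" if "\<delta> > 0" for z \<delta>
      using conc that words unfolding Q_def spreads_def by simp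
  qed
  also have "\<dots> \<le> (\<integral>\<^sup>+\<omega>. H \<omega> * ennreal (min 1 (C / (lo ^ (length b + length pre) * \<kappa> i j) * (r / \<bar>A k [] p \<omega>\<bar>))) \<partial>M)"
  proof (intro nn_integral_mono mult_left_mono ennreal_leI)
    fix \<omega>
    have "C * (r / \<bar>R \<omega>\<bar>) \<le> C * (r / (lo ^ (length b + length pre) * \<kappa> i j * \<bar>A k [] p \<omega>\<bar>))"
      using C r slope_R [of \<omega>] pos [of \<omega>] less_le_trans [OF pos slope_R, of \<omega>]
      by (intro mult_left_mono divide_left_mono mult_pos_pos [of "_ * _" "_ * _"]) (simp_all only: less_imp_le mult_pos_pos)
    also have "\<dots> = C / (lo ^ (length b + length pre) * \<kappa> i j) * (r / \<bar>A k [] p \<omega>\<bar>)"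
      by simp
    finally show "min 1 (C * (r / \<bar>R \<omega>\<bar>))
        \<le> min 1 (C / (lo ^ (length b + length pre) * \<kappa> i j) * (r / \<bar>A k [] p \<omega>\<bar>))"
      by auto
  qed simp
  finally show ?thesis unfolding diff .
qed

text \<open>Three disjoint index sets: words shorter than \<open>q @ p\<close>, and the subtrees
  below \<open>q @ p @ y\<close> and \<open>q @ p @ y'\<close>, which do not meet because
  \<open>y\<close> and \<open>y'\<close> differ within their first \<open>n\<close> letters.\<close>

lemma nn_wmoment3:
  assumes words: "q \<in> fin_words N" "p \<in> fin_words N" "y \<in> fin_words N" "z \<in> fin_words N"
      "y' \<in> fin_words N" "z' \<in> fin_words N"
    and y: "length (take n y) = length (take n y')" "take n y \<noteq> take n y'" and s: "0 \<le> s"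
  shows "(\<integral>\<^sup>+\<omega>. ennreal (\<bar>A k q p \<omega>\<bar> powr s * \<bar>A k (q @ p @ y) z \<omega>\<bar> powr s * \<bar>A k (q @ p @ y') z' \<omega>\<bar> powr s) \<partial>M)
    = ennreal (wmoment k s p * wmoment k s z * wmoment k s z')"
proof -
  let ?K1 = "{(v, k) | v. v \<in> fin_words N \<and> length v < length q + length p}"
  let ?B = "\<lambda>y. {(q @ p @ y @ v, k) | v. v \<in> fin_words N}"
  have 1: "A k q p \<in> borel_measurable (gen ?K1)"
    using words by (intro A_gen) (auto intro: fin_words_take)
  have 2: "A k (q @ p @ y) z \<in> borel_measurable (gen (?B y))" if "y \<in> fin_words N" "z \<in> fin_words N" for y z
    using words that by (intro A_gen) (auto intro: fin_words_take)
  have disj: "?B y \<inter> ?B y' = {}"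
  proof (rule ccontr)
    assume "?B y \<inter> ?B y' \<noteq> {}"
    then obtain v v' where eq: "y @ v = y' @ v'" by auto
    then have "take (length (take n y)) (y @ v) = take (length (take n y)) (y' @ v')" by simp
    moreover have "take (length (take n y)) (y @ v) = take n y" by (simp add: min_def)
    moreover have "take (length (take n y)) (y' @ v') = take n y'" unfolding y(1) by (simp add: min_def)
    ultimately show False using y(2) by simp
  qed
  let ?f = "\<lambda>q p \<omega>. ennreal (\<bar>A k q p \<omega>\<bar> powr s)"
  have sub: "?B y \<subseteq> {(u, l). u \<in> fin_words N}" "?B y' \<subseteq> {(u, l). u \<in> fin_words N}"
      "?K1 \<subseteq> {(u, l). u \<in> fin_words N}"
    using words by auto
  have "(\<integral>\<^sup>+\<omega>. ennreal (\<bar>A k q p \<omega>\<bar> powr s * \<bar>A k (q @ p @ y) z \<omega>\<bar> powr s * \<bar>A k (q @ p @ y') z' \<omega>\<bar> powr s) \<partial>M)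
      = (\<integral>\<^sup>+\<omega>. ?f q p \<omega> * (?f (q @ p @ y) z \<omega> * ?f (q @ p @ y') z' \<omega>) \<partial>M)"
    by (simp add: ennreal_mult mult.assoc)
  also have "\<dots> = (\<integral>\<^sup>+\<omega>. ?f q p \<omega> \<partial>M) * (\<integral>\<^sup>+\<omega>. ?f (q @ p @ y) z \<omega> * ?f (q @ p @ y') z' \<omega> \<partial>M)"
  proof (rule nn_integral_gen_mult [of ?K1 "?B y \<union> ?B y'"])
    show "?f q p \<in> borel_measurable (gen ?K1)" using 1 by measurable
    have "A k (q @ p @ y) z \<in> borel_measurable (gen (?B y \<union> ?B y'))"
      using 2 [of y z] words by (intro measurable_gen_mono [of "?B y" "?B y \<union> ?B y'"]) auto
    moreover have "A k (q @ p @ y') z' \<in> borel_measurable (gen (?B y \<union> ?B y'))"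
      using 2 [of y' z'] words by (intro measurable_gen_mono [of "?B y'" "?B y \<union> ?B y'"]) auto
    ultimately show "(\<lambda>\<omega>. ?f (q @ p @ y) z \<omega> * ?f (q @ p @ y') z' \<omega>) \<in> borel_measurable (gen (?B y \<union> ?B y'))"
      by measurable
  qed (use sub in auto)
  also have "(\<integral>\<^sup>+\<omega>. ?f (q @ p @ y) z \<omega> * ?f (q @ p @ y') z' \<omega> \<partial>M)
      = (\<integral>\<^sup>+\<omega>. ?f (q @ p @ y) z \<omega> \<partial>M) * (\<integral>\<^sup>+\<omega>. ?f (q @ p @ y') z' \<omega> \<partial>M)"
  proof (rule nn_integral_gen_mult [OF disj sub(1,2)])
    show "?f (q @ p @ y) z \<in> borel_measurable (gen (?B y))" using 2 [of y z] words by measurable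
    show "?f (q @ p @ y') z' \<in> borel_measurable (gen (?B y'))" using 2 [of y' z'] words by measurable
  qed
  finally show ?thesis
    using words s by (simp add: nn_wmoment ennreal_mult' wmoment_nonneg mult.assoc)
qed

text \<open>The block \<open>b @ sfx\<close> carries no weight here: it contains the run that is
  integrated out, and the remaining factor must be measurable without it. The prefix
  \<open>q0\<close> is unweighted too and only costs \<open>lo ^ length q0\<close>; it stands for
  blocks of the uniformly weighted part.\<close>

lemma pair_bound:
  fixes k :: 'd
  defines "\<kappa> i j \<equiv> \<bar>t i $ k - t j $ k\<bar> / 2"
  assumes words: "q0 \<in> fin_words N" "p \<in> fin_words N" "b \<in> fin_words N" "b' \<in> fin_words N" "pre \<in> fin_words N"
      "post \<in> fin_words N" "y \<in> fin_words N" "y' \<in> fin_words N" "z \<in> fin_words N" "z' \<in> fin_words N"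
      "i \<in> {1..N}" "j \<in> {1..N}"
    and b: "length b = length b'" "b \<noteq> b'"
    and ij: "t i $ k \<noteq> t j $ k" and m: "hi ^ m * (2 * env.Rb) \<le> \<kappa> i j"
    and conc: "spreads k i n C"
    and C: "C \<ge> 0" and c: "\<bar>c\<bar> \<le> env.Rb" and r: "r > 0" and s: "0 \<le> s" "s \<le> 1"
    and sfx: "sfx = pre @ replicate n i @ replicate m j @ post"
  shows "(\<integral>\<^sup>+\<omega>. ennreal ((\<bar>A k q0 p \<omega>\<bar> powr s)\<^sup>2 * \<bar>A k (q0 @ p @ b @ sfx @ y) z \<omega>\<bar> powr s
              * \<bar>A k (q0 @ p @ b' @ sfx @ y') z' \<omega>\<bar> powr s)
            * indicator {\<omega>. \<bar>P k [] (q0 @ p @ b @ sfx @ y @ z) c \<omega>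
            - P k [] (q0 @ p @ b' @ sfx @ y' @ z') c \<omega>\<bar> \<le> r} \<omega> \<partial>M)
    \<le> ennreal ((C / (lo ^ (length b + length pre) * \<kappa> i j) / lo ^ length q0 * r) powr s
        * (wmoment k s p * wmoment k s z * wmoment k s z'))"
proof -
  let ?C = "C / (lo ^ (length b + length pre) * \<kappa> i j)"
  let ?w = "\<lambda>q p \<omega>. \<bar>A k q p \<omega>\<bar> powr s"
  let ?yz = "\<lambda>\<omega>. ?w (q0 @ p @ b @ sfx @ y) z \<omega> * ?w (q0 @ p @ b' @ sfx @ y') z' \<omega>"
  have \<kappa>: "\<kappa> i j > 0" using ij by (simp add: \<kappa>_def)
  have C0: "0 \<le> ?C" using C \<kappa> env.lo by simp
  define L where "L = {(u, l :: 'd). u \<in> fin_words N} -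
              {((q0 @ p) @ b @ pre @ replicate q i, k) | q. q < n}"
  have sfxw: "sfx \<in> fin_words N" using words sfx by (simp add: fin_words_replicate)
  have H: "(\<lambda>\<omega>. ennreal ((?w q0 p \<omega>)\<^sup>2 * ?yz \<omega>)) \<in> borel_measurable (gen L)"
  proof -
    have "A k q0 p \<in> borel_measurable (gen L)"
      using words by (intro A_gen)
        (auto simp: L_def fin_words_take dest: arg_cong [of _ _ length])
    moreover have "A k (q0 @ p @ b @ sfx @ y) z \<in> borel_measurable (gen L)"
      using words sfxw by (intro A_gen)
        (auto simp: L_def fin_words_take sfx dest: arg_cong [of _ _ length])
    moreover have "A k (q0 @ p @ b' @ sfx @ y') z' \<in> borel_measurable (gen L)"
      using words sfxw b by (intro A_gen)
        (auto simp: L_def fin_words_take)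
    ultimately show ?thesis by measurable
  qed
  have "(\<integral>\<^sup>+\<omega>. ennreal ((?w q0 p \<omega>)\<^sup>2 * ?yz \<omega>)
            * indicator {\<omega>. \<bar>P k [] (q0 @ p @ b @ sfx @ y @ z) c \<omega>
            - P k [] (q0 @ p @ b' @ sfx @ y' @ z') c \<omega>\<bar> \<le> r} \<omega> \<partial>M)
      \<le> (\<integral>\<^sup>+\<omega>. ennreal ((?w q0 p \<omega>)\<^sup>2 * ?yz \<omega>) * ennreal (min 1 (?C * (r / \<bar>A k [] (q0 @ p) \<omega>\<bar>))) \<partial>M)"
    using separation_bound [of "q0 @ p" b b' pre "post @ y @ z" "sfx @ y' @ z'" i j k m n C c r,
        OF _ _ _ _ _ _ _ _ b ij m [unfolded \<kappa>_def] conc C c r H [unfolded L_def]] words sfxw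
    by (simp add: sfx \<kappa>_def)
  also have "\<dots> \<le> (\<integral>\<^sup>+\<omega>. ennreal ((?C / lo ^ length q0 * r) powr s) * ennreal (?w q0 p \<omega> * ?w (q0 @ p @ b @ sfx @ y) z \<omega>
      * ?w (q0 @ p @ b' @ sfx @ y') z' \<omega>) \<partial>M)"
  proof (rule nn_integral_mono)
    fix \<omega>
    have a: "0 < \<bar>A k q0 p \<omega>\<bar>" using env.cprod_nonzero by simp
    have q0: "lo ^ length q0 \<le> \<bar>A k [] q0 \<omega>\<bar>" "0 < lo ^ length q0"
      using env.cprod_ge env.lo by auto
    have "?C * (r / \<bar>A k [] (q0 @ p) \<omega>\<bar>) \<le> (?C / lo ^ length q0 * r) / \<bar>A k q0 p \<omega>\<bar>"
    proof -
      have "r / \<bar>A k [] (q0 @ p) \<omega>\<bar> \<le> r / (lo ^ length q0 * \<bar>A k q0 p \<omega>\<bar>)"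
        using a q0 r by (intro divide_left_mono) (auto simp: cprod_append abs_mult intro!: mult_right_mono mult_pos_pos)
      then have "?C * (r / \<bar>A k [] (q0 @ p) \<omega>\<bar>) \<le> ?C * (r / (lo ^ length q0 * \<bar>A k q0 p \<omega>\<bar>))"
        using C0 by (rule mult_left_mono)
      then show ?thesis by simp
    qed
    also have "min 1 \<dots> \<le> ((?C / lo ^ length q0 * r) / \<bar>A k q0 p \<omega>\<bar>) powr s" (is "min 1 ?e \<le> _")
    proof (rule min_1_le_powr [OF _ s])
      show "0 \<le> ?e"
        using q0 r by (intro divide_nonneg_nonneg mult_nonneg_nonneg) (use C \<kappa> env.lo in auto)
    qed
    finally have "min 1 (?C * (r / \<bar>A k [] (q0 @ p) \<omega>\<bar>))
        \<le> (?C / lo ^ length q0 * r) powr s / ?w q0 p \<omega>"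
      by (simp only: powr_divide)
    then have "(?w q0 p \<omega>)\<^sup>2 * ?yz \<omega> * min 1 (?C * (r / \<bar>A k [] (q0 @ p) \<omega>\<bar>))
        \<le> (?w q0 p \<omega>)\<^sup>2 * ?yz \<omega> * ((?C / lo ^ length q0 * r) powr s / ?w q0 p \<omega>)"
      by (intro mult_left_mono) auto
    also have "\<dots> = (?C / lo ^ length q0 * r) powr s * (?w q0 p \<omega> * ?w (q0 @ p @ b @ sfx @ y) z \<omega>
      * ?w (q0 @ p @ b' @ sfx @ y') z' \<omega>)"
      using a by (simp add: power2_eq_square)
    finally show "ennreal ((?w q0 p \<omega>)\<^sup>2 * ?yz \<omega>) * ennreal (min 1 (?C * (r / \<bar>A k [] (q0 @ p) \<omega>\<bar>)))
        \<le> ennreal ((?C / lo ^ length q0 * r) powr s) * ennreal (?w q0 p \<omega> * ?w (q0 @ p @ b @ sfx @ y) z \<omega>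
      * ?w (q0 @ p @ b' @ sfx @ y') z' \<omega>)"
      by (subst (1 2) ennreal_mult' [symmetric]) (auto intro!: ennreal_leI)
  qed
  also have "\<dots> = ennreal ((?C / lo ^ length q0 * r) powr s)
      * (\<integral>\<^sup>+\<omega>. ennreal (?w q0 p \<omega> * ?w (q0 @ p @ b @ sfx @ y) z \<omega> * ?w (q0 @ p @ b' @ sfx @ y') z' \<omega>) \<partial>M)"
    using A_measurable words sfxw by (intro nn_integral_cmult) auto
  also have "(\<integral>\<^sup>+\<omega>. ennreal (?w q0 p \<omega> * ?w (q0 @ p @ b @ sfx @ y) z \<omega> * ?w (q0 @ p @ b' @ sfx @ y') z' \<omega>) \<partial>M)
      = ennreal (wmoment k s p * wmoment k s z * wmoment k s z')"
    using words sfxw b s by (intro nn_wmoment3 [where n = "length b"]) auto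
  finally show ?thesis
    by (simp add: ennreal_mult' mult.assoc)
qed

end

subsection \<open>Block words and second moments\<close>

context random_sponge
begin

text \<open>Different coordinates use disjoint sets of indices, so a product over coordinates
  integrates factor by factor; estimates then need a proof for a single coordinate only.\<close>

lemma nn_integral_prod_coordinates:
  fixes F :: "'d \<Rightarrow> 'w \<Rightarrow> ennreal"
  assumes F: "\<And>k. F k \<in> borel_measurable (gen (fin_words N \<times> {k}))"
  shows "(\<integral>\<^sup>+\<omega>. (\<Prod>k\<in>K. F k \<omega>) \<partial>M) = (\<Prod>k\<in>K. \<integral>\<^sup>+\<omega>. F k \<omega> \<partial>M)"
proof -
  have "finite K" by simp
  then show ?thesis
  proof (induction K)
    case empty
    then show ?case by (simp add: emeasure_space_1)
  next
    case (insert k K)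
    have "(\<integral>\<^sup>+\<omega>. F k \<omega> * (\<Prod>k\<in>K. F k \<omega>) \<partial>M) = (\<integral>\<^sup>+\<omega>. F k \<omega> \<partial>M) * (\<integral>\<^sup>+\<omega>. (\<Prod>k\<in>K. F k \<omega>) \<partial>M)"
    proof (rule nn_integral_gen_mult [of "fin_words N \<times> {k}" "fin_words N \<times> K"])
      show "(\<lambda>\<omega>. \<Prod>k\<in>K. F k \<omega>) \<in> borel_measurable (gen (fin_words N \<times> K))"
        by (intro borel_measurable_prod_ennreal measurable_gen_mono [OF _ F]) auto
    qed (use insert.hyps F in auto)
    then show ?case using insert by simp
  qed
qed

text \<open>For \<open>e = texp s \<tau>\<close> with \<open>s\<close> at most the dimension this is
  \<open>phi_tau s \<tau>\<close> of the diagonal matrix along \<open>u\<close> (see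
  \<open>phi_tau_texp\<close>). Arbitrary exponents are allowed because the lower bound uses
  rescaled ones.\<close>

definition weight :: "('d \<Rightarrow> real) \<Rightarrow> nat list \<Rightarrow> nat list \<Rightarrow> 'w \<Rightarrow> real" where
  "weight e p u \<omega> = (\<Prod>k\<in>UNIV. \<bar>A k p u \<omega>\<bar> powr e k)"

definition mean_weight :: "('d \<Rightarrow> real) \<Rightarrow> nat list \<Rightarrow> real" where
  "mean_weight e u = (\<Prod>k\<in>UNIV. wmoment k (e k) u)"

lemma weight_nonneg: "0 \<le> weight e p u \<omega>"
  unfolding weight_def by (intro prod_nonneg) auto

lemma weight_append: "weight e p (u @ v) \<omega> = weight e p u \<omega> * weight e (p @ u) v \<omega>"
  by (simp add: weight_def cprod_append abs_mult powr_mult prod.distrib)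

lemma weight_le_1: "(\<And>k. 0 \<le> e k) \<Longrightarrow> weight e p u \<omega> \<le> 1"
  unfolding weight_def by (intro prod_le_1) (auto intro: powr_le_1 env.cprod_le_1)

lemma weight_measurable: "p @ u \<in> fin_words N \<Longrightarrow> weight e p u \<in> borel_measurable M"
  unfolding weight_def using A_measurable by (intro borel_measurable_prod) auto

lemma mean_weight_append: "mean_weight e (u @ v) = mean_weight e u * mean_weight e v"
  by (simp add: mean_weight_def wmoment_append prod.distrib)

lemma mean_weight_Nil [simp]: "mean_weight e [] = 1"
  by (simp add: mean_weight_def)

lemma mean_weight_nonneg: "u \<in> fin_words N \<Longrightarrow> (\<And>k. 0 \<le> e k) \<Longrightarrow> 0 \<le> mean_weight e u"
  unfolding mean_weight_def by (intro prod_nonneg) (auto intro: wmoment_nonneg)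

lemma mean_weight_le_1: "u \<in> fin_words N \<Longrightarrow> (\<And>k. 0 \<le> e k) \<Longrightarrow> mean_weight e u \<le> 1"
proof -
  assume u: "u \<in> fin_words N" and e: "\<And>k. 0 \<le> e k"
  have "wmoment k (e k) u \<le> 1" for k
    using u by (induction u) (auto intro!: mult_le_one moment_le_1 wmoment_nonneg e)
  then show ?thesis
    unfolding mean_weight_def using u e by (intro prod_le_1) (auto intro: wmoment_nonneg)
qed

lemma nn_weight:
  assumes "p @ u \<in> fin_words N" "\<And>k. 0 \<le> e k"
  shows "(\<integral>\<^sup>+\<omega>. ennreal (weight e p u \<omega>) \<partial>M) = ennreal (mean_weight e u)"
proof -
  have "(\<integral>\<^sup>+\<omega>. ennreal (weight e p u \<omega>) \<partial>M)
      = (\<integral>\<^sup>+\<omega>. (\<Prod>k\<in>UNIV. ennreal (\<bar>A k p u \<omega>\<bar> powr e k)) \<partial>M)"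
    by (simp add: weight_def prod_ennreal)
  also have "\<dots> = (\<Prod>k\<in>UNIV. \<integral>\<^sup>+\<omega>. ennreal (\<bar>A k p u \<omega>\<bar> powr e k) \<partial>M)"
  proof (rule nn_integral_prod_coordinates)
    fix k
    have "A k p u \<in> borel_measurable (gen (fin_words N \<times> {k}))"
      using assms by (intro A_gen) (auto intro: fin_words_take)
    then show "(\<lambda>\<omega>. ennreal (\<bar>A k p u \<omega>\<bar> powr e k)) \<in> borel_measurable (gen (fin_words N \<times> {k}))"
      by measurable
  qed
  also have "\<dots> = ennreal (mean_weight e u)"
    using assms unfolding mean_weight_def
    by (simp add: nn_wmoment prod_ennreal wmoment_nonneg)
  finally show ?thesis .
qed

lemma nn_weight3:
  assumes words: "q \<in> fin_words N" "p \<in> fin_words N" "y \<in> fin_words N" "z \<in> fin_words N"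
      "y' \<in> fin_words N" "z' \<in> fin_words N"
    and y: "length (take n y) = length (take n y')" "take n y \<noteq> take n y'" and e: "\<And>k. 0 \<le> e k"
  shows "(\<integral>\<^sup>+\<omega>. ennreal (weight e q p \<omega> * weight e (q @ p @ y) z \<omega> * weight e (q @ p @ y') z' \<omega>) \<partial>M)
    = ennreal (mean_weight e p * mean_weight e z * mean_weight e z')"
proof -
  let ?F = "\<lambda>k \<omega>. \<bar>A k q p \<omega>\<bar> powr e k * \<bar>A k (q @ p @ y) z \<omega>\<bar> powr e k * \<bar>A k (q @ p @ y') z' \<omega>\<bar> powr e k"
  have "(\<integral>\<^sup>+\<omega>. ennreal (weight e q p \<omega> * weight e (q @ p @ y) z \<omega> * weight e (q @ p @ y') z' \<omega>) \<partial>M)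
      = (\<integral>\<^sup>+\<omega>. (\<Prod>k\<in>UNIV. ennreal (?F k \<omega>)) \<partial>M)"
    by (simp add: weight_def prod_ennreal prod.distrib)
  also have "\<dots> = (\<Prod>k\<in>UNIV. \<integral>\<^sup>+\<omega>. ennreal (?F k \<omega>) \<partial>M)"
  proof (rule nn_integral_prod_coordinates)
    fix k
    have "A k p u \<in> borel_measurable (gen (fin_words N \<times> {k}))" if "p @ u \<in> fin_words N" for p u
      using that by (intro A_gen) (auto intro: fin_words_take)
    from this [of q p] this [of "q @ p @ y" z] this [of "q @ p @ y'" z'] words
    show "(\<lambda>\<omega>. ennreal (?F k \<omega>)) \<in> borel_measurable (gen (fin_words N \<times> {k}))"
      by simp
  qed
  also have "\<dots> = (\<Prod>k\<in>UNIV. ennreal (wmoment k (e k) p * wmoment k (e k) z * wmoment k (e k) z'))"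
    using words y e by (intro prod.cong nn_wmoment3) auto
  also have "\<dots> = ennreal (mean_weight e p * mean_weight e z * mean_weight e z')"
    using words e unfolding mean_weight_def
    by (simp add: prod_ennreal wmoment_nonneg prod.distrib)
  finally show ?thesis .
qed

text \<open>The conclusion of \<open>pair_bound\<close> as a property of the suffix \<open>sfx\<close>.\<close>

definition separating :: "'d \<Rightarrow> real \<Rightarrow> nat \<Rightarrow> nat list \<Rightarrow> real \<Rightarrow> bool" where
  "separating k s n0 sfx D \<longleftrightarrow> (\<forall>q0\<in>fin_words N. \<forall>p\<in>fin_words N. \<forall>b\<in>fin_words N. \<forall>b'\<in>fin_words N.
     \<forall>y\<in>fin_words N. \<forall>y'\<in>fin_words N. \<forall>z\<in>fin_words N. \<forall>z'\<in>fin_words N. \<forall>c r.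
     length b = n0 \<longrightarrow> length b' = n0 \<longrightarrow> b \<noteq> b' \<longrightarrow> \<bar>c\<bar> \<le> env.Rb \<longrightarrow> r > 0 \<longrightarrow>
     (\<integral>\<^sup>+\<omega>. ennreal ((\<bar>A k q0 p \<omega>\<bar> powr s)\<^sup>2 * \<bar>A k (q0 @ p @ b @ sfx @ y) z \<omega>\<bar> powr s
              * \<bar>A k (q0 @ p @ b' @ sfx @ y') z' \<omega>\<bar> powr s)
            * indicator {\<omega>. \<bar>P k [] (q0 @ p @ b @ sfx @ y @ z) c \<omega>
            - P k [] (q0 @ p @ b' @ sfx @ y' @ z') c \<omega>\<bar> \<le> r} \<omega> \<partial>M)
    \<le> ennreal ((D / lo ^ length q0 * r) powr s * (wmoment k s p * wmoment k s z * wmoment k s z')))"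

text \<open>The pieces made for the single coordinates are concatenated; each one separates its own
  coordinate whatever surrounds it. The order of the quantifiers matters: \<open>sfx\<close> is
  fixed before \<open>s\<close> and \<open>n0\<close>, since later \<open>n0\<close> is chosen in
  terms of \<open>sfx\<close>; only \<open>D\<close> depends on all of them.\<close>

lemma ex_separating:
  assumes N: "N \<ge> 1"
    and trans: "\<And>k. \<exists>i\<in>{1..N}. \<exists>j\<in>{1..N}. t i $ k \<noteq> t j $ k"
    and smooth: "\<And>k. \<exists>l\<in>{1..N}. eventually_smooth (distr M borel (\<lambda>\<omega>. ln \<bar>\<alpha> k [l] \<omega>\<bar>))"
  obtains sfx where "sfx \<in> fin_words N" "sfx \<noteq> []"
    "\<And>k s n0. 0 \<le> s \<Longrightarrow> s \<le> 1 \<Longrightarrow> \<exists>D\<ge>0. separating k s n0 sfx D"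
proof -
  have "\<exists>v\<in>fin_words N. v \<noteq> [] \<and> (\<forall>pre\<in>fin_words N. \<forall>post\<in>fin_words N. \<forall>s n0. 0 \<le> s \<longrightarrow> s \<le> 1 \<longrightarrow>
      (\<exists>D\<ge>0. separating k s n0 (pre @ v @ post) D))" for k
  proof -
    obtain i where i: "i \<in> {1..N}" "eventually_smooth (distr M borel (\<lambda>\<omega>. ln \<bar>\<alpha> k [i] \<omega>\<bar>))"
      using smooth by blast
    obtain j where j: "j \<in> {1..N}" "t i $ k \<noteq> t j $ k" using trans [of k] by metis
    let ?\<kappa> = "\<bar>t i $ k - t j $ k\<bar> / 2"
    have "(\<lambda>m. hi ^ m * (2 * env.Rb)) \<longlonglongrightarrow> 0 * (2 * env.Rb)"
      using env.hi env.hi_pos by (intro tendsto_intros LIMSEQ_realpow_zero) auto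
    moreover have "0 * (2 * env.Rb) < ?\<kappa>" using j(2) by simp
    ultimately have "\<forall>\<^sub>F m in sequentially. hi ^ m * (2 * env.Rb) < ?\<kappa>"
      by (rule order_tendstoD(2))
    then obtain m where m: "hi ^ m * (2 * env.Rb) < ?\<kappa>"
      by (auto simp: eventually_sequentially)
    obtain n C where n: "n \<ge> 1" and C: "C \<ge> 0" and conc: "spreads k i n C"
      using run_window [OF i] by blast
    let ?v = "replicate n i @ replicate m j"
    have "\<exists>D\<ge>0. separating k s n0 (pre @ ?v @ post) D"
      if pre: "pre \<in> fin_words N" "post \<in> fin_words N" and s: "0 \<le> s" "s \<le> 1" for pre post s n0
    proof (intro exI conjI)
      show "0 \<le> C / (lo ^ (n0 + length pre) * ?\<kappa>)" using C env.lo by simp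
      show "separating k s n0 (pre @ ?v @ post) (C / (lo ^ (n0 + length pre) * ?\<kappa>))"
        unfolding separating_def
      proof (intro ballI allI impI)
        fix q0 p b b' y y' z z' c r
        assume w: "q0 \<in> fin_words N" "p \<in> fin_words N" "b \<in> fin_words N" "b' \<in> fin_words N"
          "y \<in> fin_words N" "y' \<in> fin_words N" "z \<in> fin_words N" "z' \<in> fin_words N"
          and *: "length b = n0" "length b' = n0" "b \<noteq> b'" "\<bar>c\<bar> \<le> env.Rb" "(r :: real) > 0"
        show "(\<integral>\<^sup>+\<omega>. ennreal ((\<bar>A k q0 p \<omega>\<bar> powr s)\<^sup>2 * \<bar>A k (q0 @ p @ b @ (pre @ ?v @ post) @ y) z \<omega>\<bar> powr s
              * \<bar>A k (q0 @ p @ b' @ (pre @ ?v @ post) @ y') z' \<omega>\<bar> powr s)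
            * indicator {\<omega>. \<bar>P k [] (q0 @ p @ b @ (pre @ ?v @ post) @ y @ z) c \<omega>
            - P k [] (q0 @ p @ b' @ (pre @ ?v @ post) @ y' @ z') c \<omega>\<bar> \<le> r} \<omega> \<partial>M)
          \<le> ennreal ((C / (lo ^ (n0 + length pre) * ?\<kappa>) / lo ^ length q0 * r) powr s
              * (wmoment k s p * wmoment k s z * wmoment k s z'))"
          unfolding *(1) [symmetric]
          by (rule pair_bound [OF w(1-4) pre w(5-8) i(1) j(1) _ *(3) j(2) less_imp_le [OF m] conc C *(4,5) s])
            (use * in simp_all)
      qed
    qed
    moreover have "?v \<in> fin_words N" "?v \<noteq> []" using i(1) j(1) n by (auto simp: fin_words_replicate)
    ultimately show ?thesis by blast
  qed
  then obtain v where v: "\<And>k. v k \<in> fin_words N" "\<And>k. v k \<noteq> []"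
    "\<And>k pre post s n0. pre \<in> fin_words N \<Longrightarrow> post \<in> fin_words N \<Longrightarrow> 0 \<le> s \<Longrightarrow> s \<le> 1 \<Longrightarrow>
      \<exists>D\<ge>0. separating k s n0 (pre @ v k @ post) D"
    by metis
  obtain ks :: "'d list" where ks: "set ks = UNIV" using finite_list [of "UNIV :: 'd set"] by auto
  define sfx where "sfx = concat (map v ks)"
  have conc: "concat (map v l) \<in> fin_words N" for l
    using v(1) by (induction l) auto
  show ?thesis
  proof (rule that)
    show "sfx \<in> fin_words N" unfolding sfx_def by (rule conc)
    show "sfx \<noteq> []" using ks v(2) by (auto simp: sfx_def)
    show "\<exists>D\<ge>0. separating k s n0 sfx D" if "0 \<le> s" "s \<le> 1" for k s n0
    proof -
      obtain l l' where "ks = l @ k # l'" using ks split_list [of k ks] by auto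
      then show ?thesis using v(3) [OF conc [of l] conc [of l'] that, of k n0] by (simp add: sfx_def)
    qed
  qed
qed

end

locale sponge_blocks = random_sponge M N \<alpha> t lo hi T
  for M :: "'w measure" and N :: nat and \<alpha> :: "'d::finite \<Rightarrow> nat list \<Rightarrow> 'w \<Rightarrow> real"
    and t :: "nat \<Rightarrow> real^'d" and lo hi T :: real +
  fixes e :: "'d \<Rightarrow> real" and n0 :: nat and sfx :: "nat list" and D :: "'d \<Rightarrow> real"
  assumes e: "\<And>k. 0 \<le> e k" "\<And>k. e k \<le> 1"
    and sfx: "sfx \<in> fin_words N" "sfx \<noteq> []"
    and D: "\<And>k. 0 \<le> D k" "\<And>k. separating k (e k) n0 sfx (D k)"
    and supercritical: "(\<Sum>b\<in>{b\<in>fin_words N. length b = n0}. mean_weight e (b @ sfx)) > 1"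
    and n0: "n0 \<ge> 1" and N2: "N \<ge> 2"
begin

definition L :: "nat list set" where "L = {b\<in>fin_words N. length b = n0}"

definition \<Lambda> :: real where "\<Lambda> = (\<Sum>b\<in>L. mean_weight e (b @ sfx))"

text \<open>A block is a list of \<open>n0\<close> free letters followed by \<open>sfx\<close>.
  Since all blocks have the same length, two different block lists of equal length part within the
  free letters of one block.\<close>

definition wd :: "nat list list \<Rightarrow> nat list" where "wd bs = concat (map (\<lambda>b. b @ sfx) bs)"

definition BL :: "nat \<Rightarrow> nat list list set" where "BL n = {bs. set bs \<subseteq> L \<and> length bs = n}"

lemma \<Lambda>: "\<Lambda> > 1" using supercritical by (simp add: \<Lambda>_def L_def)

lemma L_eq: "L = {u. set u \<subseteq> {1..N} \<and> length u = n0}"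
  by (auto simp: L_def fin_words_def)

lemma finite_L: "finite L" unfolding L_eq by (rule finite_lists_length_eq) simp

lemma card_L: "card L \<ge> 2"
proof -
  have "card L = N ^ n0" unfolding L_eq by (subst card_lists_length_eq) auto
  moreover have "N ^ 1 \<le> N ^ n0" using n0 N2 by (intro power_increasing) auto
  ultimately show ?thesis using N2 by simp
qed

lemma finite_BL: "finite (BL n)" unfolding BL_def by (rule finite_lists_length_eq [OF finite_L])

lemma card_BL: "card (BL n) = card L ^ n" unfolding BL_def by (rule card_lists_length_eq [OF finite_L])

lemma L_words: "b \<in> L \<Longrightarrow> b \<in> fin_words N" by (simp add: L_def)

lemma wd_simps [simp]: "wd [] = []" "wd (b # bs) = b @ sfx @ wd bs" "wd (bs @ cs) = wd bs @ wd cs"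
  by (simp_all add: wd_def)

lemma wd_words: "set bs \<subseteq> L \<Longrightarrow> wd bs \<in> fin_words N"
  using sfx(1) L_words by (induction bs) auto

lemma BL_words: "bs \<in> BL n \<Longrightarrow> wd bs \<in> fin_words N"
  using wd_words by (auto simp: BL_def)

lemma length_wd: "set bs \<subseteq> L \<Longrightarrow> length (wd bs) = length bs * (n0 + length sfx)"
  by (induction bs) (auto simp: L_def)

lemma BL_0: "BL 0 = {[]}" by (auto simp: BL_def)

lemma sum_BL_Suc: "(\<Sum>bs\<in>BL (Suc n). f bs) = (\<Sum>b\<in>L. \<Sum>bs\<in>BL n. f (b # bs))"
proof -
  have "BL (Suc n) = (\<lambda>(b, bs). b # bs) ` (L \<times> BL n)"
    by (auto simp: BL_def length_Suc_conv image_iff)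
  then have "(\<Sum>bs\<in>BL (Suc n). f bs) = (\<Sum>(b, bs)\<in>L \<times> BL n. f (b # bs))"
    by (simp add: sum.reindex inj_on_def case_prod_unfold)
  then show ?thesis by (simp add: sum.cartesian_product)
qed

lemma mw_nonneg: "set bs \<subseteq> L \<Longrightarrow> 0 \<le> mean_weight e (wd bs)"
  by (intro mean_weight_nonneg wd_words e)

lemma mw_le_1: "set bs \<subseteq> L \<Longrightarrow> mean_weight e (wd bs) \<le> 1"
  by (intro mean_weight_le_1 wd_words e)

lemma mw_block: "b \<in> L \<Longrightarrow> 0 \<le> mean_weight e (b @ sfx)" "b \<in> L \<Longrightarrow> mean_weight e (b @ sfx) \<le> 1"
  using mw_nonneg [of "[b]"] mw_le_1 [of "[b]"] by simp_all

lemma sum_mean_weight: "(\<Sum>bs\<in>BL n. mean_weight e (wd bs)) = \<Lambda> ^ n"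
proof (induction n)
  case 0
  then show ?case by (simp add: BL_0)
next
  case (Suc n)
  have "(\<Sum>bs\<in>BL (Suc n). mean_weight e (wd bs)) = (\<Sum>b\<in>L. mean_weight e (b @ sfx) * (\<Sum>bs\<in>BL n. mean_weight e (wd bs)))"
    by (simp add: sum_BL_Suc mean_weight_append sum_distrib_left mult.assoc)
  then show ?case by (simp add: Suc.IH \<Lambda>_def sum_distrib_right)
qed

text \<open>Bounds the mean joint weight of two block lists: up to the first disagreement the common
  weight counts once, because one copy is absorbed by the separation estimate, and the disagreeing
  blocks are dropped.\<close>

fun split_weight :: "nat list list \<Rightarrow> nat list list \<Rightarrow> real" where
  "split_weight (b # bs) (b' # bs') =
     (if b = b' then mean_weight e (b @ sfx) * split_weight bs bs'
      else mean_weight e (wd bs) * mean_weight e (wd bs'))"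
| "split_weight _ _ = 0"

lemma split_weight_eq:
  "b \<noteq> b' \<Longrightarrow> split_weight (ps @ b # xs) (ps @ b' # ys)
     = mean_weight e (wd ps) * mean_weight e (wd xs) * mean_weight e (wd ys)"
  by (induction ps) (auto simp: mean_weight_append)

lemma split_weight_nonneg: "set bs \<subseteq> L \<Longrightarrow> set bs' \<subseteq> L \<Longrightarrow> 0 \<le> split_weight bs bs'"
  by (induction bs bs' rule: split_weight.induct) (auto simp: mw_nonneg mw_block)

text \<open>Chosen to solve \<open>\<Lambda> * Ksep + (real (card L))\<^sup>2 = Ksep *
  \<Lambda>\<^sup>2\<close>, which closes the induction in \<open>sum_split_weight\<close>.\<close>

definition Ksep :: real where "Ksep = (real (card L))\<^sup>2 / (\<Lambda>\<^sup>2 - \<Lambda>)"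

lemma Ksep_nonneg: "0 \<le> Ksep"
  using \<Lambda> by (simp add: Ksep_def power2_eq_square)

text \<open>Split off the first block: pairs that agree there reproduce the sum with the factor
  \<open>\<Lambda>\<close>, and every pair of first blocks adds at most
  \<open>(\<Lambda> ^ n)\<^sup>2\<close>. Because \<open>\<Lambda> < \<Lambda>\<^sup>2\<close>, late
  branching is negligible and the order \<open>(\<Lambda> ^ n)\<^sup>2\<close> persists.\<close>

lemma sum_split_weight: "(\<Sum>bs\<in>BL n. \<Sum>bs'\<in>BL n. split_weight bs bs') \<le> Ksep * (\<Lambda> ^ n)\<^sup>2"
proof (induction n)
  case 0
  then show ?case using Ksep_nonneg by (simp add: BL_0)
next
  case (Suc n)
  let ?G = "\<Sum>bs\<in>BL n. \<Sum>bs'\<in>BL n. split_weight bs bs'"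
  let ?c = "real (card L)"
  have BL: "set bs \<subseteq> L" if "bs \<in> BL n" for bs using that by (simp add: BL_def)
  have "(\<Sum>bs\<in>BL (Suc n). \<Sum>bs'\<in>BL (Suc n). split_weight bs bs')
      = (\<Sum>b\<in>L. \<Sum>b'\<in>L. \<Sum>bs\<in>BL n. \<Sum>bs'\<in>BL n. split_weight (b # bs) (b' # bs'))"
    by (simp only: sum_BL_Suc) (intro sum.cong refl sum.swap)
  also have "\<dots> \<le> (\<Sum>b\<in>L. \<Sum>b'\<in>L. (if b = b' then mean_weight e (b @ sfx) * ?G else 0) + (\<Lambda> ^ n)\<^sup>2)"
  proof (intro sum_mono)
    fix b b' assume b: "b \<in> L" "b' \<in> L"
    have "(\<Sum>bs\<in>BL n. \<Sum>bs'\<in>BL n. split_weight (b # bs) (b' # bs'))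
      \<le> (\<Sum>bs\<in>BL n. \<Sum>bs'\<in>BL n. (if b = b' then mean_weight e (b @ sfx) * split_weight bs bs' else 0)
          + mean_weight e (wd bs) * mean_weight e (wd bs'))"
      using BL b by (intro sum_mono) (auto simp: mw_nonneg)
    also have "\<dots> = (if b = b' then mean_weight e (b @ sfx) * ?G else 0) + (\<Lambda> ^ n)\<^sup>2"
      by (simp add: sum.distrib sum_distrib_left [symmetric] sum_distrib_right [symmetric]
          sum_mean_weight power2_eq_square)
    finally show "(\<Sum>bs\<in>BL n. \<Sum>bs'\<in>BL n. split_weight (b # bs) (b' # bs'))
      \<le> (if b = b' then mean_weight e (b @ sfx) * ?G else 0) + (\<Lambda> ^ n)\<^sup>2" .
  qed
  also have "\<dots> = \<Lambda> * ?G + ?c\<^sup>2 * (\<Lambda> ^ n)\<^sup>2"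
    by (simp add: sum.distrib sum_distrib_right [symmetric] finite_L \<Lambda>_def power2_eq_square)
  also have "\<dots> \<le> \<Lambda> * (Ksep * (\<Lambda> ^ n)\<^sup>2) + ?c\<^sup>2 * (\<Lambda> ^ n)\<^sup>2"
    using Suc.IH \<Lambda> by (intro add_right_mono mult_left_mono) auto
  also have "\<dots> = (\<Lambda> * Ksep + ?c\<^sup>2) * (\<Lambda> ^ n)\<^sup>2" by (simp add: algebra_simps)
  also have "\<Lambda> * Ksep + ?c\<^sup>2 = Ksep * \<Lambda>\<^sup>2"
  proof -
    have "\<Lambda>\<^sup>2 - \<Lambda> \<noteq> 0" using \<Lambda> by (simp add: power2_eq_square)
    then have "Ksep * (\<Lambda>\<^sup>2 - \<Lambda>) = ?c\<^sup>2" by (simp add: Ksep_def)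
    then show ?thesis by (simp add: algebra_simps)
  qed
  finally show ?case by (simp add: power_mult_distrib mult_ac)
qed

text \<open>Pairs fall into three kinds: \<open>cs\<close> and \<open>cs'\<close> differ, only the
  weighted lists differ, or the codes are equal. The last two kinds need \<open>cs = cs'\<close>,
  which holds for a fraction \<open>1 / card L ^ m\<close> of the pairs of first lists; the diagonal
  contributes \<open>\<Lambda> ^ n\<close> against \<open>(\<Lambda> ^ n)\<^sup>2\<close>, hence
  \<open>(1 / \<Lambda>) ^ n\<close>.\<close>

lemma pair_sum_bound:
  fixes f :: "nat list list \<times> nat list list \<Rightarrow> nat list list \<times> nat list list \<Rightarrow> ennreal"
  assumes G: "0 \<le> G"
    and f1: "\<And>cs cs' bs bs'. cs \<in> BL m \<Longrightarrow> cs' \<in> BL m \<Longrightarrow> bs \<in> BL n \<Longrightarrow> bs' \<in> BL n \<Longrightarrow> cs \<noteq> cs' \<Longrightarrow>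
      f (cs, bs) (cs', bs') \<le> ennreal (G * (mean_weight e (wd bs) * mean_weight e (wd bs')))"
    and f2: "\<And>cs bs bs'. cs \<in> BL m \<Longrightarrow> bs \<in> BL n \<Longrightarrow> bs' \<in> BL n \<Longrightarrow> bs \<noteq> bs' \<Longrightarrow>
      f (cs, bs) (cs, bs') \<le> ennreal (G * split_weight bs bs')"
    and f3: "\<And>cs bs. cs \<in> BL m \<Longrightarrow> bs \<in> BL n \<Longrightarrow> f (cs, bs) (cs, bs) \<le> ennreal (mean_weight e (wd bs))"
  shows "(\<Sum>i\<in>BL m \<times> BL n. \<Sum>j\<in>BL m \<times> BL n. f i j)
    \<le> ennreal ((G + (G * Ksep + (1 / \<Lambda>) ^ n) / real (card L) ^ m) * (real (card L) ^ m * \<Lambda> ^ n)\<^sup>2)"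
proof -
  let ?l = "real (card L) ^ m"
  let ?h = "\<lambda>cs bs cs' bs'. G * (mean_weight e (wd bs) * mean_weight e (wd bs'))
      + (if cs = cs' then G * split_weight bs bs' + (if bs = bs' then mean_weight e (wd bs) else 0) else 0)"
  have BL: "set bs \<subseteq> L" if "bs \<in> BL n" for bs n using that by (simp add: BL_def)
  have "(\<Sum>i\<in>BL m \<times> BL n. \<Sum>j\<in>BL m \<times> BL n. f i j)
      \<le> (\<Sum>(cs, bs)\<in>BL m \<times> BL n. \<Sum>(cs', bs')\<in>BL m \<times> BL n. ennreal (?h cs bs cs' bs'))"
  proof (intro sum_mono, clarify, intro sum_mono, clarify)
    fix cs bs cs' bs' assume *: "cs \<in> BL m" "bs \<in> BL n" "cs' \<in> BL m" "bs' \<in> BL n"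
    have 1: "0 \<le> G * (mean_weight e (wd bs) * mean_weight e (wd bs'))"
      and 2: "0 \<le> G * split_weight bs bs'" and 3: "0 \<le> mean_weight e (wd bs)"
      using G * by (auto intro!: mult_nonneg_nonneg mw_nonneg split_weight_nonneg BL)
    show "f (cs, bs) (cs', bs') \<le> ennreal (?h cs bs cs' bs')"
    proof (cases "cs = cs'")
      case False
      then show ?thesis using f1 [of cs cs' bs bs'] * by simp
    next
      case True
      show ?thesis
      proof (cases "bs = bs'")
        case False
        then show ?thesis using True f2 [of cs bs bs'] * 1 2
          by (auto intro: order_trans intro!: ennreal_leI)
      next
        case b: True
        then show ?thesis using True f3 [of cs bs] * 1 2 3
          by (auto intro: order_trans intro!: ennreal_leI)
      qed
    qed
  qed
  also have "\<dots> = ennreal (\<Sum>(cs, bs)\<in>BL m \<times> BL n. \<Sum>(cs', bs')\<in>BL m \<times> BL n. ?h cs bs cs' bs')"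
  proof -
    have h0: "0 \<le> ?h cs bs cs' bs'" if "bs \<in> BL n" "bs' \<in> BL n" for cs bs cs' bs'
      using G that BL by (auto intro!: add_nonneg_nonneg mult_nonneg_nonneg mw_nonneg split_weight_nonneg)
    have sum_h: "(\<Sum>i\<in>J. \<Sum>j\<in>J. ennreal (h i j)) = ennreal (\<Sum>i\<in>J. \<Sum>j\<in>J. h i j)"
      if "\<And>i j. i \<in> J \<Longrightarrow> j \<in> J \<Longrightarrow> 0 \<le> h i j"
      for J :: "(nat list list \<times> nat list list) set" and h
      using that by (simp add: sum_nonneg cong: sum.cong)
    show ?thesis
      unfolding case_prod_unfold by (rule sum_h, rule h0) auto
  qed
  also have "(\<Sum>(cs, bs)\<in>BL m \<times> BL n. \<Sum>(cs', bs')\<in>BL m \<times> BL n. ?h cs bs cs' bs')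
      = (\<Sum>cs\<in>BL m. \<Sum>bs\<in>BL n. \<Sum>cs'\<in>BL m. \<Sum>bs'\<in>BL n. ?h cs bs cs' bs')"
    by (simp only: sum.cartesian_product [symmetric])
  also have "\<dots> = (\<Sum>cs\<in>BL m. \<Sum>cs'\<in>BL m. \<Sum>bs\<in>BL n. \<Sum>bs'\<in>BL n. ?h cs bs cs' bs')"
    by (intro sum.cong refl sum.swap)
  also have "\<dots> = (\<Sum>cs\<in>BL m. \<Sum>cs'\<in>BL m. G * (\<Lambda> ^ n)\<^sup>2
      + (if cs = cs' then G * (\<Sum>bs\<in>BL n. \<Sum>bs'\<in>BL n. split_weight bs bs') + \<Lambda> ^ n else 0))"
    by (intro sum.cong refl)
      (simp add: sum.distrib sum_distrib_left [symmetric] sum_distrib_right [symmetric]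
          sum_mean_weight power2_eq_square finite_BL)
  also have "\<dots> = ?l\<^sup>2 * (G * (\<Lambda> ^ n)\<^sup>2) + ?l * (G * (\<Sum>bs\<in>BL n. \<Sum>bs'\<in>BL n. split_weight bs bs') + \<Lambda> ^ n)"
    by (simp add: sum.distrib finite_BL card_BL power2_eq_square distrib_left)
  also have "\<dots> \<le> ?l\<^sup>2 * (G * (\<Lambda> ^ n)\<^sup>2) + ?l * (G * (Ksep * (\<Lambda> ^ n)\<^sup>2) + \<Lambda> ^ n)"
    using G by (intro add_left_mono add_right_mono mult_left_mono sum_split_weight) auto
  also have "\<dots> = (G + (G * Ksep + (1 / \<Lambda>) ^ n) / ?l) * (?l * \<Lambda> ^ n)\<^sup>2"
  proof -
    have "?l \<noteq> 0" "\<Lambda> ^ n \<noteq> 0" using card_L \<Lambda> by auto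
    then show ?thesis by (simp add: field_simps power2_eq_square)
  qed
  finally show ?thesis by (simp add: ennreal_leI)
qed

text \<open>A point is coded by two block lists. Only the second one is weighted: the first spreads the
  mass uniformly over independent subtrees, which makes its variance small.\<close>

definition pt :: "nat list list \<times> nat list list \<Rightarrow> 'w \<Rightarrow> real^'d" where
  "pt i \<omega> = (\<chi> k. P k [] (wd (fst i) @ wd (snd i)) (t (last sfx) $ k) \<omega>)"

definition wt :: "nat list list \<times> nat list list \<Rightarrow> 'w \<Rightarrow> real" where
  "wt i \<omega> = weight e (wd (fst i)) (wd (snd i)) \<omega>"

definition near :: "real \<Rightarrow> real^'d \<Rightarrow> real^'d \<Rightarrow> real" where
  "near r x y = (if \<forall>k. \<bar>x $ k - y $ k\<bar> \<le> r then 1 else 0)"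

text \<open>The mean of the sum of all weights, so that \<open>mass\<close> has mean 1
  (\<open>nn_mass\<close>).\<close>

definition total :: "nat \<Rightarrow> nat \<Rightarrow> real" where
  "total m n = real (card L) ^ m * \<Lambda> ^ n"

definition mass :: "nat \<Rightarrow> nat \<Rightarrow> 'w \<Rightarrow> real" where
  "mass m n \<omega> = (\<Sum>i\<in>BL m \<times> BL n. wt i \<omega>) / total m n"

text \<open>The correlation integral at scale \<open>r\<close>, in the sup metric, of the finite
  measure that gives the point \<open>pt i\<close> the mass \<open>wt i / total m n\<close>.\<close>

definition pairs :: "nat \<Rightarrow> nat \<Rightarrow> real \<Rightarrow> 'w \<Rightarrow> real" where
  "pairs m n r \<omega> = (\<Sum>i\<in>BL m \<times> BL n. \<Sum>j\<in>BL m \<times> BL n. wt i \<omega> * wt j \<omega> * near r (pt i \<omega>) (pt j \<omega>))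
     / (total m n)\<^sup>2"

lemma weight_Nil [simp]: "weight e p [] \<omega> = 1"
  by (simp add: weight_def)

lemma length_L: "b \<in> L \<Longrightarrow> length b = n0"
  by (simp add: L_def)

lemma total_pos: "0 < total m n"
  using card_L \<Lambda> by (simp add: total_def)

lemma last_sfx: "\<bar>t (last sfx) $ k\<bar> \<le> env.Rb"
  using env.t_le env.T_le_Rb order_trans by blast

text \<open>Nearness in the sup metric is a product of indicators over the coordinates, just as the
  weights are products; by independence of the coordinates the bound is the product of the bounds in
  \<open>separating\<close>.\<close>

lemma near_bound:
  assumes words: "q0 \<in> fin_words N" "p \<in> fin_words N" "b \<in> L" "b' \<in> L"
     "y \<in> fin_words N" "y' \<in> fin_words N" "z \<in> fin_words N" "z' \<in> fin_words N"
    and b: "b \<noteq> b'" and r: "r > 0"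
  shows "(\<integral>\<^sup>+\<omega>. ennreal ((weight e q0 p \<omega>)\<^sup>2 * weight e (q0 @ p @ b @ sfx @ y) z \<omega>
              * weight e (q0 @ p @ b' @ sfx @ y') z' \<omega>
            * near r (\<chi> k. P k [] (q0 @ p @ b @ sfx @ y @ z) (t (last sfx) $ k) \<omega>)
                (\<chi> k. P k [] (q0 @ p @ b' @ sfx @ y' @ z') (t (last sfx) $ k) \<omega>)) \<partial>M)
    \<le> ennreal ((\<Prod>k\<in>UNIV. (D k / lo ^ length q0 * r) powr e k)
        * (mean_weight e p * mean_weight e z * mean_weight e z'))"
proof -
  let ?u = "q0 @ p @ b @ sfx @ y" and ?u' = "q0 @ p @ b' @ sfx @ y'"
  let ?W = "\<lambda>k \<omega>. (\<bar>A k q0 p \<omega>\<bar> powr e k)\<^sup>2 * \<bar>A k ?u z \<omega>\<bar> powr e k * \<bar>A k ?u' z' \<omega>\<bar> powr e k"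
  let ?I = "\<lambda>k. {\<omega>. \<bar>P k [] (q0 @ p @ b @ sfx @ y @ z) (t (last sfx) $ k) \<omega>
      - P k [] (q0 @ p @ b' @ sfx @ y' @ z') (t (last sfx) $ k) \<omega>\<bar> \<le> r}"
  have w: "b \<in> fin_words N" "b' \<in> fin_words N" "length b = n0" "length b' = n0"
    using words by (auto simp: L_def)
  have "(\<integral>\<^sup>+\<omega>. ennreal ((weight e q0 p \<omega>)\<^sup>2 * weight e ?u z \<omega> * weight e ?u' z' \<omega>
            * near r (\<chi> k. P k [] (q0 @ p @ b @ sfx @ y @ z) (t (last sfx) $ k) \<omega>)
                (\<chi> k. P k [] (q0 @ p @ b' @ sfx @ y' @ z') (t (last sfx) $ k) \<omega>)) \<partial>M)
      = (\<integral>\<^sup>+\<omega>. (\<Prod>k\<in>UNIV. ennreal (?W k \<omega>) * indicator (?I k) \<omega>) \<partial>M)"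
  proof (rule nn_integral_cong)
    fix \<omega>
    have ind: "(\<Prod>k\<in>UNIV. indicator (?I k) \<omega>) = ennreal (near r (\<chi> k. P k [] (q0 @ p @ b @ sfx @ y @ z) (t (last sfx) $ k) \<omega>)
                (\<chi> k. P k [] (q0 @ p @ b' @ sfx @ y' @ z') (t (last sfx) $ k) \<omega>))"
      by (auto simp: near_def prod_zero_iff indicator_def intro!: prod.neutral)
    have W: "(\<Prod>k\<in>UNIV. ennreal (?W k \<omega>)) = ennreal ((weight e q0 p \<omega>)\<^sup>2 * weight e ?u z \<omega> * weight e ?u' z' \<omega>)"
      by (simp add: weight_def prod_ennreal prod.distrib prod_power_distrib)
    show "ennreal ((weight e q0 p \<omega>)\<^sup>2 * weight e ?u z \<omega> * weight e ?u' z' \<omega>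
            * near r (\<chi> k. P k [] (q0 @ p @ b @ sfx @ y @ z) (t (last sfx) $ k) \<omega>)
                (\<chi> k. P k [] (q0 @ p @ b' @ sfx @ y' @ z') (t (last sfx) $ k) \<omega>))
        = (\<Prod>k\<in>UNIV. ennreal (?W k \<omega>) * indicator (?I k) \<omega>)"
      unfolding prod.distrib [of "\<lambda>k. ennreal (?W k \<omega>)"] ind W
      by (rule ennreal_mult') (auto intro!: mult_nonneg_nonneg weight_nonneg)
  qed
  also have "\<dots> = (\<Prod>k\<in>UNIV. \<integral>\<^sup>+\<omega>. ennreal (?W k \<omega>) * indicator (?I k) \<omega> \<partial>M)"
  proof (rule nn_integral_prod_coordinates)
    fix k
    let ?F = "gen (fin_words N \<times> {k})"
    have A: "A k p u \<in> borel_measurable ?F" if "p @ u \<in> fin_words N" for p u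
      using that by (intro A_gen) (auto intro: fin_words_take)
    have P: "P k [] u c \<in> borel_measurable ?F" if "u \<in> fin_words N" for u c
      using that by (intro P_gen) (auto intro: fin_words_take)
    have [measurable]: "A k q0 p \<in> borel_measurable ?F" "A k ?u z \<in> borel_measurable ?F"
        "A k ?u' z' \<in> borel_measurable ?F"
        "P k [] (q0 @ p @ b @ sfx @ y @ z) (t (last sfx) $ k) \<in> borel_measurable ?F"
        "P k [] (q0 @ p @ b' @ sfx @ y' @ z') (t (last sfx) $ k) \<in> borel_measurable ?F"
      by (intro A P; use words(1,2,5-8) w(1,2) sfx in simp)+
    have "(\<lambda>\<omega>. ennreal (?W k \<omega>) * (if \<bar>P k [] (q0 @ p @ b @ sfx @ y @ z) (t (last sfx) $ k) \<omega>
      - P k [] (q0 @ p @ b' @ sfx @ y' @ z') (t (last sfx) $ k) \<omega>\<bar> \<le> r then 1 else 0)) \<in> borel_measurable ?F"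
      by measurable
    moreover have "indicator {x. Q x} y = (if Q y then 1 else 0 :: ennreal)" for Q and y :: 'w
      by (simp add: indicator_def)
    ultimately show "(\<lambda>\<omega>. ennreal (?W k \<omega>) * indicator (?I k) \<omega>) \<in> borel_measurable ?F"
      by (simp only:)
  qed
  also have "\<dots> \<le> (\<Prod>k\<in>UNIV. ennreal ((D k / lo ^ length q0 * r) powr e k
      * (wmoment k (e k) p * wmoment k (e k) z * wmoment k (e k) z')))"
    using D(2) words w b r last_sfx unfolding separating_def
    by (intro prod_mono_ennreal) simp
  also have "\<dots> = ennreal ((\<Prod>k\<in>UNIV. (D k / lo ^ length q0 * r) powr e k)
        * (mean_weight e p * mean_weight e z * mean_weight e z'))"
    using words e by (simp add: prod_ennreal wmoment_nonneg mean_weight_def prod.distrib)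
  finally show ?thesis .
qed

lemma wt_nonneg: "0 \<le> wt i \<omega>" by (simp add: wt_def weight_nonneg)

lemma wt_le_1: "wt i \<omega> \<le> 1" by (simp add: wt_def weight_le_1 e)

lemma near_le_1: "near r x y \<le> 1" and near_nonneg: "0 \<le> near r x y"
  by (simp_all add: near_def)

lemma wt_measurable: "i \<in> BL m \<times> BL n \<Longrightarrow> wt i \<in> borel_measurable M"
  unfolding wt_def using BL_words by (intro weight_measurable) auto

lemma near_measurable:
  assumes "i \<in> BL m \<times> BL n" "j \<in> BL m \<times> BL n"
  shows "(\<lambda>\<omega>. near r (pt i \<omega>) (pt j \<omega>)) \<in> borel_measurable M"
proof -
  have [measurable]: "(\<lambda>\<omega>. pt i \<omega> $ k) \<in> borel_measurable M" "(\<lambda>\<omega>. pt j \<omega> $ k) \<in> borel_measurable M" for k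
    using assms BL_words by (auto simp: pt_def intro!: P_measurable)
  have "near r (pt i \<omega>) (pt j \<omega>) = (\<Prod>k\<in>UNIV. if \<bar>pt i \<omega> $ k - pt j \<omega> $ k\<bar> \<le> r then 1 else 0)" for \<omega>
    by (auto simp: near_def prod_zero_iff)
  then show ?thesis by simp
qed

lemma BL_D: "bs \<in> BL n \<Longrightarrow> set bs \<subseteq> L" by (simp add: BL_def)

lemma BL_split:
  assumes "bs \<in> BL n" "bs' \<in> BL n" "bs \<noteq> bs'"
  obtains ps b xs b' ys where "bs = ps @ b # xs" "bs' = ps @ b' # ys" "b \<noteq> b'" "b \<in> L" "b' \<in> L"
    "set ps \<subseteq> L" "set xs \<subseteq> L" "set ys \<subseteq> L" "length ps \<le> n"
proof -
  obtain ps b xs b' ys where *: "b \<noteq> b'" "bs = ps @ [b] @ xs" "bs' = ps @ [b'] @ ys"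
    using same_length_different [OF assms(3)] assms(1,2) by (auto simp: BL_def)
  show ?thesis by (rule that [of ps b xs b' ys]) (use * assms in \<open>auto simp: BL_def\<close>)
qed

text \<open>The constant in the worst case of \<open>m\<close> unweighted blocks before the
  branching. It deteriorates with \<open>m\<close>, which is harmless since \<open>m\<close> stays
  fixed while the scale tends to 0.\<close>

definition Cn :: "nat \<Rightarrow> real" where
  "Cn m = (\<Prod>k\<in>UNIV. (D k / lo ^ (m * (n0 + length sfx))) powr e k)"

lemma Cn_nonneg: "0 \<le> Cn m" unfolding Cn_def by (intro prod_nonneg) auto

lemma window_le_Cn:
  assumes "length q0 \<le> m * (n0 + length sfx)" "r > 0"
  shows "(\<Prod>k\<in>UNIV. (D k / lo ^ length q0 * r) powr e k) \<le> Cn m * r powr (\<Sum>k\<in>UNIV. e k)"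
proof -
  have "(\<Prod>k\<in>UNIV. (D k / lo ^ length q0 * r) powr e k)
      \<le> (\<Prod>k\<in>UNIV. (D k / lo ^ (m * (n0 + length sfx)) * r) powr e k)"
  proof (intro prod_mono conjI powr_mono2 e mult_right_mono divide_left_mono)
    show "lo ^ (m * (n0 + length sfx)) \<le> lo ^ length q0"
      using assms(1) env.lo env.lo_le_hi env.hi by (intro power_decreasing) auto
  qed (use assms D env.lo in auto)
  also have "\<dots> = Cn m * (\<Prod>k\<in>UNIV. r powr e k)"
    unfolding Cn_def prod.distrib [symmetric]
    using assms(2) D(1) env.lo by (intro prod.cong refl powr_mult divide_nonneg_nonneg)
  also have "(\<Prod>k\<in>UNIV. r powr e k) = r powr (\<Sum>k\<in>UNIV. e k)"
    using assms(2) by (simp add: powr_sum)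
  finally show ?thesis .
qed

text \<open>The weight of the block where two words part is at most 1 and is discarded; this
  produces the integrands that \<open>near_bound\<close> can handle.\<close>

lemma Wpair:
  assumes "set ps \<subseteq> L" "set xs \<subseteq> L" "b \<in> L"
  shows "weight e q (wd (ps @ b # xs)) \<omega> \<le> weight e q (wd ps) \<omega> * weight e (q @ wd ps @ b @ sfx) (wd xs) \<omega>"
proof -
  have "weight e q (wd (ps @ b # xs)) \<omega>
      = weight e q (wd ps) \<omega> * weight e (q @ wd ps @ b @ sfx) (wd xs) \<omega> * weight e (q @ wd ps) (b @ sfx) \<omega>"
    using weight_append [of e "q @ wd ps" "b @ sfx" "wd xs" \<omega>] by (simp add: weight_append)
  then show ?thesis
    using weight_le_1 [where e = e and p = "q @ wd ps" and u = "b @ sfx", OF e(1)]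
    by (simp add: mult_left_le weight_nonneg)
qed

text \<open>One estimate for two kernels: \<open>near r\<close> yields the correlation integral, the
  constant 1 the second moment of the mass. \<open>f1\<close> concerns words that part in the
  uniform blocks, \<open>f2\<close> words that part in the weighted ones.\<close>

lemma kernel_sum_bound:
  fixes \<kappa> :: "nat list list \<times> nat list list \<Rightarrow> nat list list \<times> nat list list \<Rightarrow> 'w \<Rightarrow> real"
  assumes \<kappa>: "\<And>i j \<omega>. 0 \<le> \<kappa> i j \<omega>" "\<And>i j \<omega>. \<kappa> i j \<omega> \<le> 1"
    and \<kappa>_meas: "\<And>i j. i \<in> BL m \<times> BL n \<Longrightarrow> j \<in> BL m \<times> BL n \<Longrightarrow> \<kappa> i j \<in> borel_measurable M"
    and G: "0 \<le> G"
    and f1: "\<And>ps b xs b' ys bs bs'. b \<noteq> b' \<Longrightarrow> b \<in> L \<Longrightarrow> b' \<in> L \<Longrightarrow> set ps \<subseteq> L \<Longrightarrow> set xs \<subseteq> L \<Longrightarrow>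
      set ys \<subseteq> L \<Longrightarrow> length ps \<le> m \<Longrightarrow> bs \<in> BL n \<Longrightarrow> bs' \<in> BL n \<Longrightarrow>
      (\<integral>\<^sup>+\<omega>. ennreal (wt (ps @ b # xs, bs) \<omega> * wt (ps @ b' # ys, bs') \<omega>
          * \<kappa> (ps @ b # xs, bs) (ps @ b' # ys, bs') \<omega>) \<partial>M)
      \<le> ennreal (G * (mean_weight e (wd bs) * mean_weight e (wd bs')))"
    and f2: "\<And>cs ps b xs b' ys. cs \<in> BL m \<Longrightarrow> b \<noteq> b' \<Longrightarrow> b \<in> L \<Longrightarrow> b' \<in> L \<Longrightarrow> set ps \<subseteq> L \<Longrightarrow>
      set xs \<subseteq> L \<Longrightarrow> set ys \<subseteq> L \<Longrightarrow>
      (\<integral>\<^sup>+\<omega>. ennreal ((weight e (wd cs) (wd ps) \<omega>)\<^sup>2 * weight e (wd cs @ wd ps @ b @ sfx) (wd xs) \<omega>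
          * weight e (wd cs @ wd ps @ b' @ sfx) (wd ys) \<omega> * \<kappa> (cs, ps @ b # xs) (cs, ps @ b' # ys) \<omega>) \<partial>M)
      \<le> ennreal (G * (mean_weight e (wd ps) * mean_weight e (wd xs) * mean_weight e (wd ys)))"
  shows "(\<integral>\<^sup>+\<omega>. ennreal ((\<Sum>i\<in>BL m \<times> BL n. \<Sum>j\<in>BL m \<times> BL n. wt i \<omega> * wt j \<omega> * \<kappa> i j \<omega>) / (total m n)\<^sup>2) \<partial>M)
    \<le> ennreal (G + (G * Ksep + (1 / \<Lambda>) ^ n) / real (card L) ^ m)"
proof -
  let ?J = "BL m \<times> BL n"
  let ?f = "\<lambda>i j. \<integral>\<^sup>+\<omega>. ennreal (wt i \<omega> * wt j \<omega> * \<kappa> i j \<omega>) \<partial>M"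
  have main: "(\<Sum>i\<in>?J. \<Sum>j\<in>?J. ?f i j)
    \<le> ennreal ((G + (G * Ksep + (1 / \<Lambda>) ^ n) / real (card L) ^ m) * (real (card L) ^ m * \<Lambda> ^ n)\<^sup>2)"
  proof (rule pair_sum_bound [OF G])
    fix cs cs' bs bs' assume *: "cs \<in> BL m" "cs' \<in> BL m" "bs \<in> BL n" "bs' \<in> BL n" "cs \<noteq> cs'"
    from *(1,2,5) show "?f (cs, bs) (cs', bs') \<le> ennreal (G * (mean_weight e (wd bs) * mean_weight e (wd bs')))"
    proof (rule BL_split)
      fix ps b xs b' ys
      assume eq: "cs = ps @ b # xs" "cs' = ps @ b' # ys" and s: "b \<noteq> b'" "b \<in> L" "b' \<in> L"
        "set ps \<subseteq> L" "set xs \<subseteq> L" "set ys \<subseteq> L" "length ps \<le> m"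
      show ?thesis unfolding eq by (rule f1 [OF s *(3,4)])
    qed
  next
    fix cs bs bs' assume *: "cs \<in> BL m" "bs \<in> BL n" "bs' \<in> BL n" "bs \<noteq> bs'"
    from *(2,3,4) obtain ps b xs b' ys where eq: "bs = ps @ b # xs" "bs' = ps @ b' # ys"
      and s: "b \<noteq> b'" "b \<in> L" "b' \<in> L" "set ps \<subseteq> L" "set xs \<subseteq> L" "set ys \<subseteq> L"
      by (rule BL_split)
    let ?W = "\<lambda>b xs \<omega>. weight e (wd cs) (wd ps) \<omega> * weight e (wd cs @ wd ps @ b @ sfx) (wd xs) \<omega>"
    have "wt (cs, bs) \<omega> * wt (cs, bs') \<omega> * \<kappa> (cs, bs) (cs, bs') \<omega>
        \<le> ?W b xs \<omega> * ?W b' ys \<omega> * \<kappa> (cs, bs) (cs, bs') \<omega>" for \<omega>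
      unfolding wt_def fst_conv snd_conv eq
      by (intro mult_right_mono mult_mono Wpair s mult_nonneg_nonneg weight_nonneg \<kappa>)
    then have "?f (cs, bs) (cs, bs') \<le> (\<integral>\<^sup>+\<omega>. ennreal ((weight e (wd cs) (wd ps) \<omega>)\<^sup>2
          * weight e (wd cs @ wd ps @ b @ sfx) (wd xs) \<omega>
          * weight e (wd cs @ wd ps @ b' @ sfx) (wd ys) \<omega> * \<kappa> (cs, bs) (cs, bs') \<omega>) \<partial>M)"
      by (intro nn_integral_mono ennreal_leI) (simp add: power2_eq_square mult_ac)
    also have "\<dots> \<le> ennreal (G * split_weight bs bs')"
      unfolding eq split_weight_eq [OF s(1)] by (rule f2 [OF *(1) s])
    finally show "?f (cs, bs) (cs, bs') \<le> ennreal (G * split_weight bs bs')" .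
  next
    fix cs bs assume *: "cs \<in> BL m" "bs \<in> BL n"
    have "wt (cs, bs) \<omega> * (wt (cs, bs) \<omega> * \<kappa> (cs, bs) (cs, bs) \<omega>) \<le> wt (cs, bs) \<omega>" for \<omega>
      by (intro mult_left_le mult_le_one wt_nonneg wt_le_1 \<kappa>)
    then have "?f (cs, bs) (cs, bs) \<le> (\<integral>\<^sup>+\<omega>. ennreal (weight e (wd cs) (wd bs) \<omega>) \<partial>M)"
      by (intro nn_integral_mono ennreal_leI) (simp add: wt_def mult.assoc)
    also have "\<dots> = ennreal (mean_weight e (wd bs))"
      using * BL_words e by (intro nn_weight) auto
    finally show "?f (cs, bs) (cs, bs) \<le> ennreal (mean_weight e (wd bs))" .
  qed
  have meas: "(\<lambda>\<omega>. ennreal (wt i \<omega> * wt j \<omega> * \<kappa> i j \<omega>)) \<in> borel_measurable M" if "i \<in> ?J" "j \<in> ?J" for i j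
    using wt_measurable [OF that(1)] wt_measurable [OF that(2)] \<kappa>_meas [OF that] by measurable
  have "(\<integral>\<^sup>+\<omega>. ennreal ((\<Sum>i\<in>?J. \<Sum>j\<in>?J. wt i \<omega> * wt j \<omega> * \<kappa> i j \<omega>) / (total m n)\<^sup>2) \<partial>M)
      = (\<integral>\<^sup>+\<omega>. ennreal (1 / (total m n)\<^sup>2) * (\<Sum>i\<in>?J. \<Sum>j\<in>?J. ennreal (wt i \<omega> * wt j \<omega> * \<kappa> i j \<omega>)) \<partial>M)"
  proof (rule nn_integral_cong)
    fix \<omega>
    have "0 \<le> wt i \<omega> * wt j \<omega> * \<kappa> i j \<omega>" for i j
      by (intro mult_nonneg_nonneg wt_nonneg \<kappa>)
    then have "(\<Sum>i\<in>?J. \<Sum>j\<in>?J. ennreal (wt i \<omega> * wt j \<omega> * \<kappa> i j \<omega>))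
        = ennreal (\<Sum>i\<in>?J. \<Sum>j\<in>?J. wt i \<omega> * wt j \<omega> * \<kappa> i j \<omega>)"
      by (simp add: sum_nonneg)
    then show "ennreal ((\<Sum>i\<in>?J. \<Sum>j\<in>?J. wt i \<omega> * wt j \<omega> * \<kappa> i j \<omega>) / (total m n)\<^sup>2)
        = ennreal (1 / (total m n)\<^sup>2) * (\<Sum>i\<in>?J. \<Sum>j\<in>?J. ennreal (wt i \<omega> * wt j \<omega> * \<kappa> i j \<omega>))"
      by (simp add: ennreal_mult' [symmetric])
  qed
  also have "\<dots> = ennreal (1 / (total m n)\<^sup>2) * (\<Sum>i\<in>?J. \<Sum>j\<in>?J. ?f i j)"
    by (subst nn_integral_cmult)
      (auto simp only: nn_integral_sum meas borel_measurable_sum cong: sum.cong intro!: borel_measurable_sum meas)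
  also have "\<dots> \<le> ennreal (1 / (total m n)\<^sup>2)
      * ennreal ((G + (G * Ksep + (1 / \<Lambda>) ^ n) / real (card L) ^ m) * (real (card L) ^ m * \<Lambda> ^ n)\<^sup>2)"
    by (intro mult_left_mono main) auto
  also have "\<dots> = ennreal (G + (G * Ksep + (1 / \<Lambda>) ^ n) / real (card L) ^ m)"
    unfolding total_def [symmetric] using total_pos [of m n] by (simp add: ennreal_mult' [symmetric])
  finally show ?thesis .
qed

text \<open>The term \<open>(1 / \<Lambda>) ^ n\<close> is the self-interaction of the point masses.
  It does not decrease with \<open>r\<close>, so a finer scale demands more weighted blocks; see
  \<open>level\<close>.\<close>

lemma nn_pairs:
  assumes r: "r > 0"
  shows "(\<integral>\<^sup>+\<omega>. ennreal (pairs m n r \<omega>) \<partial>M)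
    \<le> ennreal (Cn m * (1 + Ksep) * r powr (\<Sum>k\<in>UNIV. e k) + (1 / \<Lambda>) ^ n)"
proof -
  let ?G = "Cn m * r powr (\<Sum>k\<in>UNIV. e k)"
  let ?D = "\<lambda>q. \<Prod>k\<in>UNIV. (D k / lo ^ length q * r) powr e k"
  have G: "0 \<le> ?G" using Cn_nonneg by simp
  have DG: "?D (wd bs) * x \<le> ?G * x" if "set bs \<subseteq> L" "length bs \<le> m" "0 \<le> x" for bs x
    using that r by (intro mult_right_mono window_le_Cn) (auto simp: length_wd)
  have "(\<integral>\<^sup>+\<omega>. ennreal (pairs m n r \<omega>) \<partial>M) \<le> ennreal (?G + (?G * Ksep + (1 / \<Lambda>) ^ n) / real (card L) ^ m)"
    unfolding pairs_def
  proof (rule kernel_sum_bound [OF near_nonneg near_le_1 near_measurable G])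
    fix ps b xs b' ys bs bs'
    assume s: "b \<noteq> b'" "b \<in> L" "b' \<in> L" "set ps \<subseteq> L" "set xs \<subseteq> L" "set ys \<subseteq> L" "length ps \<le> m"
      and bs: "bs \<in> BL n" "bs' \<in> BL n"
    \<comment> \<open>Branching in the uniform blocks: the common part is \<open>q0 = wd ps\<close>,
      the weighted common part \<open>p\<close> is empty, and the uniform blocks after the branching
      play the roles of \<open>y\<close> and \<open>y'\<close>.\<close>
    have "(\<integral>\<^sup>+\<omega>. ennreal (wt (ps @ b # xs, bs) \<omega> * wt (ps @ b' # ys, bs') \<omega>
          * near r (pt (ps @ b # xs, bs) \<omega>) (pt (ps @ b' # ys, bs') \<omega>)) \<partial>M)
        = (\<integral>\<^sup>+\<omega>. ennreal ((weight e (wd ps) [] \<omega>)\<^sup>2 * weight e (wd ps @ [] @ b @ sfx @ wd xs) (wd bs) \<omega>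
            * weight e (wd ps @ [] @ b' @ sfx @ wd ys) (wd bs') \<omega>
            * near r (\<chi> k. P k [] (wd ps @ [] @ b @ sfx @ wd xs @ wd bs) (t (last sfx) $ k) \<omega>)
                (\<chi> k. P k [] (wd ps @ [] @ b' @ sfx @ wd ys @ wd bs') (t (last sfx) $ k) \<omega>)) \<partial>M)"
      by (simp add: wt_def pt_def)
    also have "\<dots> \<le> ennreal (?D (wd ps) * (mean_weight e [] * mean_weight e (wd bs) * mean_weight e (wd bs')))"
      by (rule near_bound) (use s bs r BL_words wd_words in auto)
    also have "\<dots> \<le> ennreal (?G * (mean_weight e (wd bs) * mean_weight e (wd bs')))"
      unfolding mean_weight_Nil mult_1_left
      using bs s by (intro ennreal_leI DG mult_nonneg_nonneg mw_nonneg) (auto dest: BL_D)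
    finally show "(\<integral>\<^sup>+\<omega>. ennreal (wt (ps @ b # xs, bs) \<omega> * wt (ps @ b' # ys, bs') \<omega>
          * near r (pt (ps @ b # xs, bs) \<omega>) (pt (ps @ b' # ys, bs') \<omega>)) \<partial>M)
        \<le> ennreal (?G * (mean_weight e (wd bs) * mean_weight e (wd bs')))" .
  next
    fix cs ps b xs b' ys
    assume cs: "cs \<in> BL m"
      and s: "b \<noteq> b'" "b \<in> L" "b' \<in> L" "set ps \<subseteq> L" "set xs \<subseteq> L" "set ys \<subseteq> L"
    let ?I = "\<integral>\<^sup>+\<omega>. ennreal ((weight e (wd cs) (wd ps) \<omega>)\<^sup>2 * weight e (wd cs @ wd ps @ b @ sfx) (wd xs) \<omega>
          * weight e (wd cs @ wd ps @ b' @ sfx) (wd ys) \<omega>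
          * near r (pt (cs, ps @ b # xs) \<omega>) (pt (cs, ps @ b' # ys) \<omega>)) \<partial>M"
    have "?I \<le> ennreal (?D (wd cs) * (mean_weight e (wd ps) * mean_weight e (wd xs) * mean_weight e (wd ys)))"
      using near_bound [of "wd cs" "wd ps" b b' "[]" "[]" "wd xs" "wd ys" r] s cs r BL_words wd_words
      by (simp add: pt_def)
    also have "\<dots> \<le> ennreal (?G * (mean_weight e (wd ps) * mean_weight e (wd xs) * mean_weight e (wd ys)))"
      using cs s by (intro ennreal_leI DG mult_nonneg_nonneg mw_nonneg) (auto simp: BL_def)
    finally show "?I \<le> ennreal (?G * (mean_weight e (wd ps) * mean_weight e (wd xs) * mean_weight e (wd ys)))" .
  qed
  also have "\<dots> \<le> ennreal (Cn m * (1 + Ksep) * r powr (\<Sum>k\<in>UNIV. e k) + (1 / \<Lambda>) ^ n)"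
  proof (rule ennreal_leI)
    have "1 \<le> real (card L) ^ m" using card_L by (intro one_le_power) auto
    moreover have "0 \<le> ?G * Ksep + (1 / \<Lambda>) ^ n" using G Ksep_nonneg \<Lambda> by auto
    ultimately have "(?G * Ksep + (1 / \<Lambda>) ^ n) / real (card L) ^ m \<le> ?G * Ksep + (1 / \<Lambda>) ^ n"
      by (simp add: divide_le_eq mult_le_cancel_left1)
    then show "?G + (?G * Ksep + (1 / \<Lambda>) ^ n) / real (card L) ^ m
        \<le> Cn m * (1 + Ksep) * r powr (\<Sum>k\<in>UNIV. e k) + (1 / \<Lambda>) ^ n"
      by (simp add: algebra_simps)
  qed
  finally show ?thesis .
qed

lemma mass_measurable: "mass m n \<in> borel_measurable M"
  unfolding mass_def using wt_measurable [of _ m n] by (intro borel_measurable_divide borel_measurable_sum) auto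

lemma pairs_measurable: "pairs m n r \<in> borel_measurable M"
  unfolding pairs_def using wt_measurable [of _ m n] near_measurable [of _ m n _ r]
  by (intro borel_measurable_divide borel_measurable_sum borel_measurable_times) auto

lemma pairs_nonneg: "0 \<le> pairs m n r \<omega>"
  unfolding pairs_def
  by (intro divide_nonneg_nonneg sum_nonneg mult_nonneg_nonneg wt_nonneg near_nonneg) auto

lemma mass_nonneg: "0 \<le> mass m n \<omega>"
  unfolding mass_def using total_pos [of m n] by (intro divide_nonneg_nonneg sum_nonneg wt_nonneg) auto

lemma nn_mass: "(\<integral>\<^sup>+\<omega>. ennreal (mass m n \<omega>) \<partial>M) = 1"
proof -
  have "(\<integral>\<^sup>+\<omega>. ennreal (mass m n \<omega>) \<partial>M)
      = (\<integral>\<^sup>+\<omega>. ennreal (1 / total m n) * (\<Sum>i\<in>BL m \<times> BL n. ennreal (wt i \<omega>)) \<partial>M)"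
    using total_pos [of m n] by (simp add: mass_def wt_nonneg ennreal_mult' [symmetric])
  also have "\<dots> = ennreal (1 / total m n) * (\<Sum>i\<in>BL m \<times> BL n. \<integral>\<^sup>+\<omega>. ennreal (wt i \<omega>) \<partial>M)"
    using wt_measurable [of _ m n] by (subst nn_integral_cmult) (auto simp: nn_integral_sum)
  also have "(\<Sum>i\<in>BL m \<times> BL n. \<integral>\<^sup>+\<omega>. ennreal (wt i \<omega>) \<partial>M)
      = (\<Sum>i\<in>BL m \<times> BL n. ennreal (mean_weight e (wd (snd i))))"
    unfolding wt_def using BL_words e by (intro sum.cong refl nn_weight) auto
  also have "\<dots> = ennreal (\<Sum>i\<in>BL m \<times> BL n. mean_weight e (wd (snd i)))"
    by (intro sum_ennreal mw_nonneg BL_D [of _ n]) auto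
  also have "(\<Sum>i\<in>BL m \<times> BL n. mean_weight e (wd (snd i))) = (\<Sum>cs\<in>BL m. \<Sum>bs\<in>BL n. mean_weight e (wd bs))"
    by (simp only: sum.cartesian_product case_prod_unfold)
  also have "\<dots> = total m n" by (simp add: sum_mean_weight card_BL total_def)
  finally show ?thesis using total_pos [of m n] by (simp add: ennreal_mult' [symmetric])
qed

text \<open>Weights of words that part in the uniform blocks are independent, so these pairs
  contribute at most 1, with no constant lost. The excess comes only from pairs with the same
  uniform part, which makes the variance of order \<open>1 / card L ^ m\<close>.\<close>

lemma nn_mass_sq:
  "(\<integral>\<^sup>+\<omega>. ennreal ((mass m n \<omega>)\<^sup>2) \<partial>M) \<le> ennreal (1 + (Ksep + 1) / real (card L) ^ m)"
proof -
  have "(mass m n \<omega>)\<^sup>2 = (\<Sum>i\<in>BL m \<times> BL n. \<Sum>j\<in>BL m \<times> BL n. wt i \<omega> * wt j \<omega> * 1) / (total m n)\<^sup>2" for \<omega>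
    by (simp add: mass_def power_divide power2_eq_square sum_product)
  then have "(\<integral>\<^sup>+\<omega>. ennreal ((mass m n \<omega>)\<^sup>2) \<partial>M)
      = (\<integral>\<^sup>+\<omega>. ennreal ((\<Sum>i\<in>BL m \<times> BL n. \<Sum>j\<in>BL m \<times> BL n. wt i \<omega> * wt j \<omega> * 1) / (total m n)\<^sup>2) \<partial>M)"
    by (simp only:)
  also have "\<dots> \<le> ennreal (1 + (1 * Ksep + (1 / \<Lambda>) ^ n) / real (card L) ^ m)"
  proof (rule kernel_sum_bound)
    fix ps b xs b' ys bs bs'
    assume s: "b \<noteq> b'" "b \<in> L" "b' \<in> L" "set ps \<subseteq> L" "set xs \<subseteq> L" "set ys \<subseteq> L"
      and bs: "bs \<in> BL n" "bs' \<in> BL n"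
    have "(\<integral>\<^sup>+\<omega>. ennreal (weight e (wd ps) [] \<omega> * weight e (wd ps @ [] @ b @ sfx @ wd xs) (wd bs) \<omega>
        * weight e (wd ps @ [] @ b' @ sfx @ wd ys) (wd bs') \<omega>) \<partial>M)
        = ennreal (mean_weight e [] * mean_weight e (wd bs) * mean_weight e (wd bs'))"
      by (rule nn_weight3 [where n = n0])
        (simp_all add: wd_words BL_words [OF bs(1)] BL_words [OF bs(2)] s L_words sfx length_L e)
    then show "(\<integral>\<^sup>+\<omega>. ennreal (wt (ps @ b # xs, bs) \<omega> * wt (ps @ b' # ys, bs') \<omega> * 1) \<partial>M)
        \<le> ennreal (1 * (mean_weight e (wd bs) * mean_weight e (wd bs')))"
      by (simp add: wt_def)
  next
    fix cs ps b xs b' ys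
    assume cs: "cs \<in> BL m"
      and s: "b \<noteq> b'" "b \<in> L" "b' \<in> L" "set ps \<subseteq> L" "set xs \<subseteq> L" "set ys \<subseteq> L"
    let ?w = "weight e (wd cs) (wd ps)" and ?x = "weight e (wd cs @ wd ps @ b @ sfx) (wd xs)"
      and ?y = "weight e (wd cs @ wd ps @ b' @ sfx) (wd ys)"
    \<comment> \<open>Here no window estimate is at hand; one copy of the common weight is absorbed
      simply because it is at most 1.\<close>
    have "(?w \<omega>)\<^sup>2 * ?x \<omega> * ?y \<omega> * 1 \<le> ?w \<omega> * ?x \<omega> * ?y \<omega>" for \<omega>
      unfolding power2_eq_square mult_1_right
      by (intro mult_right_mono mult_left_le weight_le_1 weight_nonneg e)
    then have "(\<integral>\<^sup>+\<omega>. ennreal ((?w \<omega>)\<^sup>2 * ?x \<omega> * ?y \<omega> * 1) \<partial>M) \<le> (\<integral>\<^sup>+\<omega>. ennreal (?w \<omega> * ?x \<omega> * ?y \<omega>) \<partial>M)"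
      by (intro nn_integral_mono ennreal_leI)
    also have "\<dots> = ennreal (mean_weight e (wd ps) * mean_weight e (wd xs) * mean_weight e (wd ys))"
      by (rule nn_weight3 [where n = n0])
        (simp_all add: wd_words BL_words [OF cs] s L_words sfx length_L e)
    finally show "(\<integral>\<^sup>+\<omega>. ennreal ((?w \<omega>)\<^sup>2 * ?x \<omega> * ?y \<omega> * 1) \<partial>M)
        \<le> ennreal (1 * (mean_weight e (wd ps) * mean_weight e (wd xs) * mean_weight e (wd ys)))"
      by simp
  qed auto
  also have "\<dots> \<le> ennreal (1 + (Ksep + 1) / real (card L) ^ m)"
    using \<Lambda> by (intro ennreal_leI add_left_mono divide_right_mono) (auto intro: power_le_one)
  finally show ?thesis .
qed

end

subsection \<open>Recurrence of good levels\<close>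

text \<open>Second-moment method: the mass concentrates near \<open>1\<close>, so for infinitely many \<open>n\<close> it is at
  least \<open>1/2\<close> while the energy stays bounded.\<close>

lemma (in prob_space) recurrent_event:
  fixes Y Z :: "nat \<Rightarrow> 'a \<Rightarrow> real"
  assumes [measurable]: "\<And>n. Y n \<in> borel_measurable M" "\<And>n. Z n \<in> borel_measurable M"
    and nn: "\<And>n \<omega>. 0 \<le> Y n \<omega>" "\<And>n \<omega>. 0 \<le> Z n \<omega>"
    and Y1: "\<And>n. (\<integral>\<^sup>+\<omega>. ennreal (Y n \<omega>) \<partial>M) = 1"
    and Y2: "\<And>n. (\<integral>\<^sup>+\<omega>. ennreal ((Y n \<omega>)\<^sup>2) \<partial>M) \<le> ennreal (1 + v)"
    and Z: "\<And>n. (\<integral>\<^sup>+\<omega>. ennreal (Z n \<omega>) \<partial>M) \<le> ennreal C"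
    and v: "0 \<le> v" and C: "0 \<le> C"
  shows "\<exists>B\<in>sets M. emeasure M B \<le> ennreal (4 * v) \<and>
    (\<forall>\<omega>\<in>space M - B. \<exists>K>0. \<exists>\<^sub>\<infinity>n. Y n \<omega> \<ge> 1 / 2 \<and> Z n \<omega> \<le> K)"
proof -
  define bad where "bad = (\<lambda>K n. {\<omega>\<in>space M. Y n \<omega> < 1 / 2 \<or> Z n \<omega> > real (Suc K)})"
  have [measurable]: "bad K n \<in> sets M" for K n unfolding bad_def by measurable
  have bad: "emeasure M (bad K n) \<le> ennreal (4 * v + C / real (Suc K))" for K n
  proof -
    have intY2: "integrable M (\<lambda>\<omega>. (Y n \<omega>)\<^sup>2)"
      by (rule integrableI_nonneg) (auto intro: le_less_trans [OF Y2])
    have intY: "integrable M (Y n)"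
      by (rule integrableI_nonneg) (auto simp: nn Y1)
    have EY: "expectation (Y n) = 1"
      using Y1 [of n] nn(1) by (simp add: integral_eq_nn_integral)
    have "expectation (\<lambda>\<omega>. (Y n \<omega>)\<^sup>2) \<le> 1 + v"
      using Y2 [of n] v by (subst integral_eq_nn_integral) (auto intro: enn2real_leI)
    then have "variance (Y n) \<le> v"
      using variance_eq [OF intY intY2] EY by simp
    \<comment> \<open>Deviation \<open>1 / 2\<close> from the mean 1 turns the variance bound
      \<open>v\<close> into \<open>4 * v\<close>.\<close>
    moreover have "prob {\<omega>\<in>space M. 1 / 2 \<le> \<bar>Y n \<omega> - expectation (Y n)\<bar>} \<le> variance (Y n) / (1 / 2)\<^sup>2"
      by (rule Chebyshev_inequality) (auto simp: intY2)
    ultimately have "prob {\<omega>\<in>space M. 1 / 2 \<le> \<bar>Y n \<omega> - 1\<bar>} \<le> 4 * v"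
      by (simp add: EY power2_eq_square)
    then have 1: "emeasure M {\<omega>\<in>space M. 1 / 2 \<le> \<bar>Y n \<omega> - 1\<bar>} \<le> ennreal (4 * v)"
      unfolding emeasure_eq_measure by (rule ennreal_leI)
    have "emeasure M {\<omega>\<in>space M. 1 \<le> ennreal (1 / real (Suc K)) * ennreal (Z n \<omega>)}
        \<le> ennreal (1 / real (Suc K)) * (\<integral>\<^sup>+\<omega>. ennreal (Z n \<omega>) \<partial>M)"
    proof -
      have "(\<integral>\<^sup>+\<omega>. ennreal (Z n \<omega>) * indicator (space M) \<omega> \<partial>M) = (\<integral>\<^sup>+\<omega>. ennreal (Z n \<omega>) \<partial>M)"
        by (rule nn_integral_cong) simp
      then show ?thesis
        using nn_integral_Markov_inequality
            [where A = "space M" and M = M and u = "\<lambda>\<omega>. ennreal (Z n \<omega>)" and c = "ennreal (1 / real (Suc K))"]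
        by simp
    qed
    also have "\<dots> \<le> ennreal (1 / real (Suc K)) * ennreal C"
      by (intro mult_left_mono Z) auto
    also have "\<dots> = ennreal (C / real (Suc K))"
      by (simp add: ennreal_mult' [symmetric])
    finally have 2: "emeasure M {\<omega>\<in>space M. 1 \<le> ennreal (1 / real (Suc K)) * ennreal (Z n \<omega>)} \<le> ennreal (C / real (Suc K))" .
    have "bad K n \<subseteq> {\<omega>\<in>space M. 1 / 2 \<le> \<bar>Y n \<omega> - 1\<bar>}
        \<union> {\<omega>\<in>space M. 1 \<le> ennreal (1 / real (Suc K)) * ennreal (Z n \<omega>)}"
    proof
      fix \<omega> assume "\<omega> \<in> bad K n"
      then have \<omega>: "\<omega> \<in> space M" and "Y n \<omega> < 1 / 2 \<or> Z n \<omega> > real (Suc K)" by (auto simp: bad_def)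
      then show "\<omega> \<in> {\<omega>\<in>space M. 1 / 2 \<le> \<bar>Y n \<omega> - 1\<bar>}
        \<union> {\<omega>\<in>space M. 1 \<le> ennreal (1 / real (Suc K)) * ennreal (Z n \<omega>)}"
      proof (elim disjE)
        assume "Z n \<omega> > real (Suc K)"
        then have "1 \<le> 1 / real (Suc K) * Z n \<omega>" by (simp add: field_simps)
        then have "1 \<le> ennreal (1 / real (Suc K) * Z n \<omega>)" by simp
        also have "\<dots> = ennreal (1 / real (Suc K)) * ennreal (Z n \<omega>)" by (rule ennreal_mult') simp
        finally show ?thesis using \<omega> by blast
      qed auto
    qed
    then have "emeasure M (bad K n) \<le> emeasure M ({\<omega>\<in>space M. 1 / 2 \<le> \<bar>Y n \<omega> - 1\<bar>}
        \<union> {\<omega>\<in>space M. 1 \<le> ennreal (1 / real (Suc K)) * ennreal (Z n \<omega>)})"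
      by (intro emeasure_mono) auto
    also have "\<dots> \<le> ennreal (4 * v) + ennreal (C / real (Suc K))"
      by (intro order_trans [OF emeasure_subadditive] add_mono 1 2) auto
    finally show ?thesis using v C by (simp add: ennreal_plus)
  qed
  \<comment> \<open>\<open>B\<close> collects the points for which, at every threshold, all levels
    from some level on are bad. For one threshold, continuity from below keeps the bound on a single
    \<open>bad\<close> set; letting the threshold grow removes
    \<open>C / real (Suc K)\<close>.\<close>
  define B where "B = (\<Inter>K. \<Union>n. \<Inter>n'\<in>{n..}. bad K n')"
  have [measurable]: "(\<Inter>n'\<in>{n..}. bad K n') \<in> sets M" for K n by (intro sets.countable_INT) auto
  have B: "B \<in> sets M" unfolding B_def by measurable
  have tail: "emeasure M (\<Union>n. \<Inter>n'\<in>{n..}. bad K n') \<le> ennreal (4 * v + C / real (Suc K))" for K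
  proof -
    have "(SUP n. emeasure M (\<Inter>n'\<in>{n..}. bad K n')) = emeasure M (\<Union>n. \<Inter>n'\<in>{n..}. bad K n')"
      by (rule SUP_emeasure_incseq) (auto simp: incseq_def)
    moreover have "emeasure M (\<Inter>n'\<in>{n..}. bad K n') \<le> ennreal (4 * v + C / real (Suc K))" for n
      by (rule order_trans [OF emeasure_mono bad [of K n]]) auto
    ultimately show ?thesis by (metis SUP_least)
  qed
  have B_le: "emeasure M B \<le> ennreal (4 * v + C / real (Suc K))" for K
  proof (rule order_trans [OF emeasure_mono tail])
    show "B \<subseteq> (\<Union>n. \<Inter>n'\<in>{n..}. bad K n')" unfolding B_def by (rule INT_lower) simp
    show "(\<Union>n. \<Inter>n'\<in>{n..}. bad K n') \<in> sets M" by measurable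
  qed
  have "emeasure M B \<le> ennreal (4 * v)"
  proof (rule LIMSEQ_le_const)
    have "(\<lambda>K. 4 * v + C / real (Suc K)) \<longlonglongrightarrow> 4 * v + 0"
      by (intro tendsto_add tendsto_const) (rule LIMSEQ_Suc [OF lim_const_over_n])
    then show "(\<lambda>K. ennreal (4 * v + C / real (Suc K))) \<longlonglongrightarrow> ennreal (4 * v)"
      by (intro tendsto_ennrealI) simp
    show "\<exists>n0. \<forall>K\<ge>n0. emeasure M B \<le> ennreal (4 * v + C / real (Suc K))"
      using B_le by blast
  qed
  moreover have "\<exists>K>0. \<exists>\<^sub>\<infinity>n. Y n \<omega> \<ge> 1 / 2 \<and> Z n \<omega> \<le> K" if \<omega>: "\<omega> \<in> space M - B" for \<omega>
  proof -
    have "\<exists>K. \<forall>n. \<exists>n'\<in>{n..}. \<omega> \<notin> bad K n'" using \<omega> by (simp add: B_def)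
    then obtain K where "\<forall>n. \<exists>n'\<ge>n. \<omega> \<notin> bad K n'" unfolding Bex_def atLeast_iff by blast
    then have "\<forall>n. \<exists>n'\<ge>n. Y n' \<omega> \<ge> 1 / 2 \<and> Z n' \<omega> \<le> real (Suc K)"
      using \<omega> by (fastforce simp: bad_def not_less)
    then show ?thesis by (intro exI [of _ "real (Suc K)"]) (auto simp: INFM_nat_le)
  qed
  ultimately show ?thesis using B by blast
qed

text \<open>A finite energy argument. Each point mass is assigned to one piece; Cauchy-Schwarz
  bounds the squared total mass by the total cost times the sum of
  \<open>(\<mu> i)\<^sup>2 / c i\<close>, and each of these terms is at most the interaction energy
  of the masses assigned to that piece. The cost \<open>c i\<close> will be a power of the size of
  the piece, or 1.\<close>

lemma weighted_cover_bound:
  fixes w :: "'j \<Rightarrow> real" and x :: "'j \<Rightarrow> 'a"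
  assumes J: "finite J" and w: "\<And>j. j \<in> J \<Longrightarrow> 0 \<le> w j"
    and I: "finite I" and cover: "\<And>j. j \<in> J \<Longrightarrow> \<exists>i\<in>I. x j \<in> V i" and c: "\<And>i. i \<in> I \<Longrightarrow> 0 < c i"
    and \<kappa>0: "\<And>x y. 0 \<le> \<kappa> x y" and \<kappa>: "\<And>i x y. i \<in> I \<Longrightarrow> x \<in> V i \<Longrightarrow> y \<in> V i \<Longrightarrow> 1 / c i \<le> \<kappa> x y"
  shows "(\<Sum>j\<in>J. w j)\<^sup>2 \<le> (\<Sum>i\<in>I. c i) * (\<Sum>j\<in>J. \<Sum>j'\<in>J. w j * w j' * \<kappa> (x j) (x j'))"
proof -
  obtain g where g: "\<And>j. j \<in> J \<Longrightarrow> g j \<in> I" "\<And>j. j \<in> J \<Longrightarrow> x j \<in> V (g j)"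
    using cover by metis
  define \<mu> where "\<mu> = (\<lambda>i. \<Sum>j\<in>{j\<in>J. g j = i}. w j)"
  have "(\<Sum>j\<in>J. w j) = (\<Sum>i\<in>I. \<mu> i)"
    unfolding \<mu>_def using g by (intro sum.group [symmetric] J I) auto
  also have "\<dots> = (\<Sum>i\<in>I. sqrt (c i) * (\<mu> i / sqrt (c i)))"
    using c by (intro sum.cong refl) (auto simp: less_imp_neq [symmetric])
  also have "\<dots>\<^sup>2 \<le> (\<Sum>i\<in>I. (sqrt (c i))\<^sup>2) * (\<Sum>i\<in>I. (\<mu> i / sqrt (c i))\<^sup>2)"
    by (rule Cauchy_Schwarz_ineq_sum)
  also have "(\<Sum>i\<in>I. (sqrt (c i))\<^sup>2) = (\<Sum>i\<in>I. c i)"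
    using c by (intro sum.cong refl) (simp add: less_imp_le)
  also have "(\<Sum>i\<in>I. (\<mu> i / sqrt (c i))\<^sup>2) \<le> (\<Sum>j\<in>J. \<Sum>j'\<in>J. w j * w j' * \<kappa> (x j) (x j'))"
  proof -
    have "(\<mu> i / sqrt (c i))\<^sup>2 \<le> (\<Sum>j\<in>{j\<in>J. g j = i}. \<Sum>j'\<in>J. w j * w j' * \<kappa> (x j) (x j'))" if "i \<in> I" for i
    proof -
      have "(\<mu> i / sqrt (c i))\<^sup>2 = (\<Sum>j\<in>{j\<in>J. g j = i}. \<Sum>j'\<in>{j\<in>J. g j = i}. w j * w j' * (1 / c i))"
        using c [OF that] unfolding \<mu>_def
        by (simp add: power_divide power2_eq_square sum_product sum_divide_distrib)
      also have "\<dots> \<le> (\<Sum>j\<in>{j\<in>J. g j = i}. \<Sum>j'\<in>{j\<in>J. g j = i}. w j * w j' * \<kappa> (x j) (x j'))"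
      proof (intro sum_mono mult_left_mono)
        fix j j' assume *: "j \<in> {j\<in>J. g j = i}" "j' \<in> {j\<in>J. g j = i}"
        then have "x j \<in> V i" "x j' \<in> V i" using g(2) [of j] g(2) [of j'] by auto
        with * show "1 / c i \<le> \<kappa> (x j) (x j')" "0 \<le> w j * w j'"
          using w that by (auto intro!: \<kappa>)
      qed
      also have "\<dots> \<le> (\<Sum>j\<in>{j\<in>J. g j = i}. \<Sum>j'\<in>J. w j * w j' * \<kappa> (x j) (x j'))"
        using J w \<kappa>0 by (intro sum_mono sum_mono2) auto
      finally show ?thesis .
    qed
    then have "(\<Sum>i\<in>I. (\<mu> i / sqrt (c i))\<^sup>2)
        \<le> (\<Sum>i\<in>I. \<Sum>j\<in>{j\<in>J. g j = i}. \<Sum>j'\<in>J. w j * w j' * \<kappa> (x j) (x j'))"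
      by (rule sum_mono)
    also have "\<dots> = (\<Sum>j\<in>J. \<Sum>j'\<in>J. w j * w j' * \<kappa> (x j) (x j'))"
      using g by (intro sum.group J I) auto
    finally show ?thesis .
  qed
  finally show ?thesis using c by (simp add: sum_nonneg mult_left_mono less_imp_le)
qed

lemma powr_power_commute:
  fixes x s :: real
  assumes "0 < x"
  shows "(x ^ q) powr s = (x powr s) ^ q"
  using assms by (simp add: powr_realpow [symmetric] powr_powr mult.commute)

lemma dyadic_scale:
  fixes \<delta> :: real
  assumes "(1 / 2) ^ Q \<le> \<delta>" "\<delta> \<le> 1"
  obtains q where "q \<le> Q" "\<delta> \<le> (1 / 2) ^ q" "(1 / 2) ^ Suc q < \<delta>"
proof -
  let ?S = "{q. q \<le> Q \<and> \<delta> \<le> (1 / 2) ^ q}"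
  have fin: "finite ?S" by simp
  define m where "m = Max ?S"
  have "0 \<in> ?S" using assms by simp
  then have m: "m \<in> ?S" unfolding m_def using fin by (intro Max_in) auto
  have "Suc m \<notin> ?S" unfolding m_def using Max_ge [OF fin, of "Suc (Max ?S)"] by linarith
  moreover have "(1 / 2 :: real) ^ Suc Q < (1 / 2) ^ Q" by simp
  ultimately have "(1 / 2) ^ Suc m < \<delta>"
    using m assms(1) by (cases "m = Q") (auto simp del: power_Suc)
  with m show ?thesis by (intro that [of m]) auto
qed

text \<open>Positive Hausdorff content, tested on finite covers only, which suffices for compact
  sets. Free sizes \<open>\<delta> i > 0\<close> replace diameters, so that one-point pieces also
  have a positive size; sizes at most 1 give monotonicity in \<open>s\<close>.\<close>

definition has_content :: "real \<Rightarrow> 'a::metric_space set \<Rightarrow> bool" where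
  "has_content s X \<longleftrightarrow> (\<exists>c>0. \<forall>n (V :: nat \<Rightarrow> 'a set) \<delta>. X \<subseteq> (\<Union>i<n. V i) \<longrightarrow>
    (\<forall>i<n. 0 < \<delta> i \<and> \<delta> i \<le> 1 \<and> (\<forall>x\<in>V i. \<forall>y\<in>V i. dist x y \<le> \<delta> i)) \<longrightarrow> c \<le> (\<Sum>i<n. \<delta> i powr s))"

text \<open>The same lower bound at the single scale \<open>(1 / 2) ^ Q\<close> and in the sup
  metric. The index type \<open>int^'d\<close> is that of the grid cells to which it is
  applied.\<close>

definition dyadic_content :: "real \<Rightarrow> (real^'d::finite) set \<Rightarrow> real \<Rightarrow> nat \<Rightarrow> bool" where
  "dyadic_content s X c Q \<longleftrightarrow> (\<forall>I (V :: (int^'d) \<Rightarrow> (real^'d) set). finite I \<longrightarrow> X \<subseteq> (\<Union>i\<in>I. V i) \<longrightarrow>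
    (\<forall>i\<in>I. \<forall>x\<in>V i. \<forall>y\<in>V i. \<forall>k. \<bar>x $ k - y $ k\<bar> \<le> (1 / 2) ^ Q)
      \<longrightarrow> c \<le> real (card I) * ((1 / 2) ^ Q) powr s)"

context sponge_blocks
begin

text \<open>A number of weighted blocks that pushes the self-interaction term of
  \<open>nn_pairs\<close> below the window term for all dyadic scales down to
  \<open>(1 / 2) ^ Q\<close>.\<close>

definition level :: "nat \<Rightarrow> nat" where
  "level Q = (SOME n. (1 / \<Lambda>) ^ n \<le> ((1 / 2) ^ Q) powr (\<Sum>k\<in>UNIV. e k))"

lemma level: "(1 / \<Lambda>) ^ level Q \<le> ((1 / 2) ^ Q) powr (\<Sum>k\<in>UNIV. e k)"
proof -
  have "(\<lambda>n. (1 / \<Lambda>) ^ n) \<longlonglongrightarrow> 0" using \<Lambda> by (intro LIMSEQ_realpow_zero) auto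
  moreover have "0 < ((1 / 2 :: real) ^ Q) powr (\<Sum>k\<in>UNIV. e k)" by simp
  ultimately have "\<forall>\<^sub>F n in sequentially. (1 / \<Lambda>) ^ n < ((1 / 2) ^ Q) powr (\<Sum>k\<in>UNIV. e k)"
    by (rule order_tendstoD(2))
  then have "\<exists>n. (1 / \<Lambda>) ^ n \<le> ((1 / 2) ^ Q) powr (\<Sum>k\<in>UNIV. e k)"
    by (auto simp: eventually_sequentially intro: less_imp_le)
  then show ?thesis unfolding level_def by (rule someI_ex)
qed

text \<open>A dyadic form of the \<open>s\<close>-energy with its kernel cut off at scale
  \<open>(1 / 2) ^ Q\<close>. The exponent is \<open>Suc q\<close> because
  \<open>1 / \<delta>\<close> has to be dominated for all \<open>\<delta>\<close> between
  \<open>(1 / 2) ^ Suc q\<close> and \<open>(1 / 2) ^ q\<close>.\<close>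

definition energy :: "real \<Rightarrow> nat \<Rightarrow> nat \<Rightarrow> 'w \<Rightarrow> real" where
  "energy s m Q \<omega> = (\<Sum>q\<le>Q. (2 ^ Suc q) powr s * pairs m (level Q) ((1 / 2) ^ q) \<omega>)"

lemma nn_pairs_level:
  assumes "q \<le> Q"
  shows "(\<integral>\<^sup>+\<omega>. ennreal (pairs m (level Q) ((1 / 2) ^ q) \<omega>) \<partial>M)
    \<le> ennreal ((Cn m * (1 + Ksep) + 1) * ((1 / 2) ^ q) powr (\<Sum>k\<in>UNIV. e k))"
proof (rule order_trans [OF nn_pairs])
  have "(1 / \<Lambda>) ^ level Q \<le> ((1 / 2) ^ q) powr (\<Sum>k\<in>UNIV. e k)"
  proof (rule order_trans [OF level])
    show "((1 / 2 :: real) ^ Q) powr (\<Sum>k\<in>UNIV. e k) \<le> ((1 / 2) ^ q) powr (\<Sum>k\<in>UNIV. e k)"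
      using assms e(1) by (intro powr_mono2 power_decreasing sum_nonneg) auto
  qed
  then show "ennreal (Cn m * (1 + Ksep) * ((1 / 2) ^ q) powr (\<Sum>k\<in>UNIV. e k) + (1 / \<Lambda>) ^ level Q)
      \<le> ennreal ((Cn m * (1 + Ksep) + 1) * ((1 / 2) ^ q) powr (\<Sum>k\<in>UNIV. e k))"
    by (intro ennreal_leI) (simp add: algebra_simps)
qed simp

text \<open>Scale \<open>q\<close> contributes a constant times the \<open>q\<close>-th power of
  \<open>?\<rho>\<close>, which is below 1 since \<open>s\<close> is less than the sum of the
  exponents; the geometric series bounds all cut-offs \<open>Q\<close> at once.\<close>

lemma nn_energy:
  assumes s: "s < (\<Sum>k\<in>UNIV. e k)"
  obtains C where "0 \<le> C" "\<And>Q. (\<integral>\<^sup>+\<omega>. ennreal (energy s m Q \<omega>) \<partial>M) \<le> ennreal C"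
proof -
  let ?E = "\<Sum>k\<in>UNIV. e k" and ?c = "Cn m * (1 + Ksep) + 1"
  let ?\<rho> = "(1 / 2) powr (?E - s) :: real"
  have c: "0 \<le> ?c" using Cn_nonneg [of m] Ksep_nonneg by simp
  have \<rho>: "0 < ?\<rho>" "?\<rho> < 1" using s powr01_less_one [of "1 / 2" "?E - s"] by auto
  have "(\<integral>\<^sup>+\<omega>. ennreal (energy s m Q \<omega>) \<partial>M) \<le> ennreal (2 powr s * ?c * (1 / (1 - ?\<rho>)))" for Q
  proof -
    have "(\<integral>\<^sup>+\<omega>. ennreal (energy s m Q \<omega>) \<partial>M)
        = (\<integral>\<^sup>+\<omega>. (\<Sum>q\<le>Q. ennreal ((2 ^ Suc q) powr s) * ennreal (pairs m (level Q) ((1 / 2) ^ q) \<omega>)) \<partial>M)"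
    proof (rule nn_integral_cong)
      fix \<omega>
      have "(\<Sum>q\<le>Q. ennreal ((2 ^ Suc q) powr s) * ennreal (pairs m (level Q) ((1 / 2) ^ q) \<omega>))
          = (\<Sum>q\<le>Q. ennreal ((2 ^ Suc q) powr s * pairs m (level Q) ((1 / 2) ^ q) \<omega>))"
        by (intro sum.cong refl ennreal_mult' [symmetric] powr_ge_zero)
      also have "\<dots> = ennreal (energy s m Q \<omega>)"
        unfolding energy_def by (intro sum_ennreal mult_nonneg_nonneg pairs_nonneg powr_ge_zero)
      finally show "ennreal (energy s m Q \<omega>)
          = (\<Sum>q\<le>Q. ennreal ((2 ^ Suc q) powr s) * ennreal (pairs m (level Q) ((1 / 2) ^ q) \<omega>))" ..
    qed
    also have "\<dots> = (\<Sum>q\<le>Q. ennreal ((2 ^ Suc q) powr s) * (\<integral>\<^sup>+\<omega>. ennreal (pairs m (level Q) ((1 / 2) ^ q) \<omega>) \<partial>M))"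
      using pairs_measurable by (subst nn_integral_sum) (auto intro!: sum.cong nn_integral_cmult)
    also have "\<dots> \<le> (\<Sum>q\<le>Q. ennreal ((2 ^ Suc q) powr s) * ennreal (?c * ((1 / 2) ^ q) powr ?E))"
      by (intro sum_mono mult_left_mono nn_pairs_level) auto
    also have "\<dots> = (\<Sum>q\<le>Q. ennreal (2 powr s * ?c * ?\<rho> ^ q))"
    proof (intro sum.cong refl)
      fix q
      have "(2 ^ Suc q :: real) powr s = 2 powr s * (2 powr s) ^ q"
        using powr_power_commute [of 2 q s] by (simp add: powr_mult)
      moreover have "((1 / 2 :: real) ^ q) powr ?E = ((1 / 2) powr ?E) ^ q"
        by (rule powr_power_commute) simp
      moreover have "?\<rho> = (2 powr s) * (1 / 2) powr ?E"
        by (simp add: powr_diff powr_divide)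
      moreover have "x * x ^ q * (?c * y ^ q) = x * ?c * (x * y) ^ q" for x y
        by (simp add: power_mult_distrib mult_ac)
      ultimately have "(2 ^ Suc q) powr s * (?c * ((1 / 2) ^ q) powr ?E) = 2 powr s * ?c * ?\<rho> ^ q"
        by (simp only:)
      then show "ennreal ((2 ^ Suc q) powr s) * ennreal (?c * ((1 / 2) ^ q) powr ?E)
          = ennreal (2 powr s * ?c * ?\<rho> ^ q)"
        by (simp only: ennreal_mult' [symmetric] powr_ge_zero)
    qed
    also have "\<dots> = ennreal (\<Sum>q\<le>Q. 2 powr s * ?c * ?\<rho> ^ q)"
      using c by (intro sum_ennreal) auto
    also have "\<dots> \<le> ennreal (2 powr s * ?c * (1 / (1 - ?\<rho>)))"
    proof (rule ennreal_leI)
      have "(\<Sum>q\<le>Q. ?\<rho> ^ q) \<le> (\<Sum>q. ?\<rho> ^ q)"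
        using \<rho> by (intro sum_le_suminf summable_geometric) auto
      also have "\<dots> = 1 / (1 - ?\<rho>)" using \<rho> by (intro suminf_geometric) auto
      finally show "(\<Sum>q\<le>Q. 2 powr s * ?c * ?\<rho> ^ q) \<le> 2 powr s * ?c * (1 / (1 - ?\<rho>))"
        unfolding sum_distrib_left [symmetric] by (rule mult_left_mono) (use c in auto)
    qed
    finally show ?thesis .
  qed
  moreover have "0 \<le> 2 powr s * ?c * (1 / (1 - ?\<rho>))" using c \<rho> by simp
  ultimately show ?thesis by (rule that [rotated])
qed

text \<open>For each \<open>m\<close> the exceptional set has probability at most a constant times
  \<open>1 / card L ^ m\<close>, while the bound on \<open>Z\<close> may depend on \<open>m\<close>.
  The exceptional event lies in all of these sets, hence is null.\<close>

lemma AE_recurrent: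
  fixes Z :: "nat \<Rightarrow> nat \<Rightarrow> 'w \<Rightarrow> real"
  assumes meas: "\<And>m Q. Z m Q \<in> borel_measurable M" and Z0: "\<And>m Q \<omega>. 0 \<le> Z m Q \<omega>"
    and Z: "\<And>m. \<exists>C\<ge>0. \<forall>Q. (\<integral>\<^sup>+\<omega>. ennreal (Z m Q \<omega>) \<partial>M) \<le> ennreal C"
  shows "AE \<omega> in M. \<exists>m. \<exists>K>0. \<exists>\<^sub>\<infinity>Q. mass m (level Q) \<omega> \<ge> 1 / 2 \<and> Z m Q \<omega> \<le> K"
proof -
  let ?v = "\<lambda>m. (Ksep + 1) / real (card L) ^ m"
  have "\<exists>B\<in>sets M. emeasure M B \<le> ennreal (4 * ?v m) \<and>
    (\<forall>\<omega>\<in>space M - B. \<exists>K>0. \<exists>\<^sub>\<infinity>Q. mass m (level Q) \<omega> \<ge> 1 / 2 \<and> Z m Q \<omega> \<le> K)" for m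
  proof -
    obtain C where "C \<ge> 0" "\<And>Q. (\<integral>\<^sup>+\<omega>. ennreal (Z m Q \<omega>) \<partial>M) \<le> ennreal C" using Z by blast
    then show ?thesis
      using Ksep_nonneg by (intro recurrent_event mass_measurable meas mass_nonneg Z0 nn_mass nn_mass_sq) auto
  qed
  then have "\<forall>m. \<exists>B. B \<in> sets M \<and> emeasure M B \<le> ennreal (4 * ?v m) \<and>
    (\<forall>\<omega>\<in>space M - B. \<exists>K>0. \<exists>\<^sub>\<infinity>Q. mass m (level Q) \<omega> \<ge> 1 / 2 \<and> Z m Q \<omega> \<le> K)"
    unfolding Bex_def by (rule allI)
  from choice [OF this] obtain B where B': "\<forall>m. B m \<in> sets M \<and> emeasure M (B m) \<le> ennreal (4 * ?v m) \<and>
    (\<forall>\<omega>\<in>space M - B m. \<exists>K>0. \<exists>\<^sub>\<infinity>Q. mass m (level Q) \<omega> \<ge> 1 / 2 \<and> Z m Q \<omega> \<le> K)" ..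
  have B: "B m \<in> sets M" "emeasure M (B m) \<le> ennreal (4 * ?v m)"
    "\<omega> \<in> space M - B m \<Longrightarrow> \<exists>K>0. \<exists>\<^sub>\<infinity>Q. mass m (level Q) \<omega> \<ge> 1 / 2 \<and> Z m Q \<omega> \<le> K" for m \<omega>
    using B' by simp_all
  have B_INT: "emeasure M (\<Inter>m. B m) \<le> ennreal (4 * ?v m)" for m
    by (rule order_trans [OF emeasure_mono B(2)]) (use B(1) in auto)
  have "emeasure M (\<Inter>m. B m) \<le> ennreal 0"
  proof (rule LIMSEQ_le_const)
    have "(\<lambda>m. 4 * ((Ksep + 1) * (1 / real (card L)) ^ m)) \<longlonglongrightarrow> 4 * ((Ksep + 1) * 0)"
      using card_L by (intro tendsto_intros LIMSEQ_realpow_zero) auto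
    then show "(\<lambda>m. ennreal (4 * ?v m)) \<longlonglongrightarrow> ennreal 0"
      by (intro tendsto_ennrealI) (simp add: power_one_over field_simps)
    show "\<exists>n0. \<forall>m\<ge>n0. emeasure M (\<Inter>m. B m) \<le> ennreal (4 * ?v m)"
      using B_INT by blast
  qed
  then have "(\<Inter>m. B m) \<in> null_sets M" using B(1) by (auto intro!: null_setsI sets.countable_INT)
  then show ?thesis
  proof (rule AE_I')
    show "{\<omega>\<in>space M. \<not> (\<exists>m. \<exists>K>0. \<exists>\<^sub>\<infinity>Q. mass m (level Q) \<omega> \<ge> 1 / 2 \<and> Z m Q \<omega> \<le> K)} \<subseteq> (\<Inter>m. B m)"
    proof (intro subsetI INT_I)
      fix \<omega> m assume "\<omega> \<in> {\<omega>\<in>space M. \<not> (\<exists>m. \<exists>K>0. \<exists>\<^sub>\<infinity>Q. mass m (level Q) \<omega> \<ge> 1 / 2 \<and> Z m Q \<omega> \<le> K)}"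
      then show "\<omega> \<in> B m" using B(3) [of \<omega> m] by blast
    qed
  qed
qed

lemma pt_in_sponge:
  assumes "i \<in> BL m \<times> BL n"
  shows "pt i \<omega> \<in> sponge N \<alpha> t \<omega>"
proof -
  let ?u = "wd (fst i) @ wd (snd i)"
  \<comment> \<open>After the finite code the last letter of \<open>sfx\<close> is repeated for
    ever; this constant tail projects to the base point used in \<open>pt\<close>.\<close>
  let ?w = "\<lambda>j. if j < length ?u then ?u ! j else last sfx"
  have u: "?u \<in> fin_words N" using assms BL_words by auto
  have "last sfx \<in> {1..N}" using sfx last_in_set [of sfx] unfolding fin_words_def by blast
  then have "?w \<in> inf_words N" using fin_words_nth [OF u] by (auto simp: inf_words_def)
  moreover have "pt i \<omega> = sponge_proj \<alpha> t \<omega> ?w"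
    by (simp only: vec_eq_iff sponge_proj_nth pt_def env.ppt_eq_proj vec_lambda_beta) simp
  ultimately show ?thesis unfolding sponge_def by blast
qed

lemma mass_cover_bound:
  fixes V :: "'i \<Rightarrow> (real^'d) set"
  assumes cover: "sponge N \<alpha> t \<omega> \<subseteq> (\<Union>i\<in>I. V i)" and I: "finite I" and c: "\<And>i. i \<in> I \<Longrightarrow> 0 < c i"
    and \<kappa>0: "\<And>x y. 0 \<le> \<kappa> x y" and \<kappa>: "\<And>i x y. i \<in> I \<Longrightarrow> x \<in> V i \<Longrightarrow> y \<in> V i \<Longrightarrow> 1 / c i \<le> \<kappa> x y"
  shows "(mass m n \<omega>)\<^sup>2 \<le> (\<Sum>i\<in>I. c i) *
    ((\<Sum>i\<in>BL m \<times> BL n. \<Sum>j\<in>BL m \<times> BL n. wt i \<omega> * wt j \<omega> * \<kappa> (pt i \<omega>) (pt j \<omega>)) / (total m n)\<^sup>2)"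
proof -
  have "(\<Sum>i\<in>BL m \<times> BL n. wt i \<omega>)\<^sup>2 \<le> (\<Sum>i\<in>I. c i) *
      (\<Sum>i\<in>BL m \<times> BL n. \<Sum>j\<in>BL m \<times> BL n. wt i \<omega> * wt j \<omega> * \<kappa> (pt i \<omega>) (pt j \<omega>))"
    using pt_in_sponge cover
    by (intro weighted_cover_bound [where V = V] I c \<kappa>0 \<kappa> wt_nonneg finite_cartesian_product finite_BL) blast+
  then show ?thesis
    unfolding mass_def power_divide times_divide_eq_right by (intro divide_right_mono) auto
qed

lemma AE_content:
  assumes s: "0 < s" "s < (\<Sum>k\<in>UNIV. e k)"
  shows "AE \<omega> in M. has_content s (sponge N \<alpha> t \<omega>)"
proof -
  have "AE \<omega> in M. \<exists>m. \<exists>K>0. \<exists>\<^sub>\<infinity>Q. mass m (level Q) \<omega> \<ge> 1 / 2 \<and> energy s m Q \<omega> \<le> K"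
  proof (rule AE_recurrent)
    show "energy s m Q \<in> borel_measurable M" for m Q
      unfolding energy_def using pairs_measurable by (intro borel_measurable_sum) auto
    show "0 \<le> energy s m Q \<omega>" for m Q \<omega>
      unfolding energy_def by (intro sum_nonneg mult_nonneg_nonneg pairs_nonneg) auto
    show "\<exists>C\<ge>0. \<forall>Q. (\<integral>\<^sup>+\<omega>. ennreal (energy s m Q \<omega>) \<partial>M) \<le> ennreal C" for m
      using nn_energy [OF s(2), of m] by metis
  qed
  then show ?thesis
  proof (rule AE_mp, intro AE_I2 impI, elim exE conjE)
    fix \<omega> m K assume K: "K > 0" and inf: "\<exists>\<^sub>\<infinity>Q. mass m (level Q) \<omega> \<ge> 1 / 2 \<and> energy s m Q \<omega> \<le> K"
    show "has_content s (sponge N \<alpha> t \<omega>)"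
      unfolding has_content_def
    proof (intro exI [of _ "1 / (4 * K)"] conjI allI impI)
      fix n and V :: "nat \<Rightarrow> (real^'d) set" and \<delta> :: "nat \<Rightarrow> real"
      assume cover: "sponge N \<alpha> t \<omega> \<subseteq> (\<Union>i<n. V i)"
        and \<delta>: "\<forall>i<n. 0 < \<delta> i \<and> \<delta> i \<le> 1 \<and> (\<forall>x\<in>V i. \<forall>y\<in>V i. dist x y \<le> \<delta> i)"
      \<comment> \<open>A finite cover has a smallest size, so among the infinitely many good levels
        there is a \<open>Q\<close> finer than all the pieces.\<close>
      let ?\<delta>0 = "Min (insert 1 (\<delta> ` {..<n}))"
      have "?\<delta>0 > 0" using \<delta> by (subst Min_gr_iff) auto
      then obtain Q0 where Q0: "(1 / 2 :: real) ^ Q0 < ?\<delta>0"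
        using real_arch_pow_inv [of ?\<delta>0 "1 / 2"] by auto
      obtain Q where Q: "Q \<ge> Q0" "mass m (level Q) \<omega> \<ge> 1 / 2" "energy s m Q \<omega> \<le> K"
        using inf by (auto simp: INFM_nat_le)
      have Q\<delta>: "(1 / 2) ^ Q \<le> \<delta> i" if "i < n" for i
      proof -
        have "(1 / 2 :: real) ^ Q \<le> (1 / 2) ^ Q0" using Q(1) by (intro power_decreasing) auto
        also have "\<dots> \<le> ?\<delta>0" by (rule less_imp_le [OF Q0])
        also have "\<dots> \<le> \<delta> i" using that by (intro Min_le) auto
        finally show ?thesis .
      qed
      \<comment> \<open>The kernel whose normalized double sum is \<open>energy\<close>. For two
        points of a piece of size between \<open>(1 / 2) ^ Suc q\<close> and
        \<open>(1 / 2) ^ q\<close>, the term for this \<open>q\<close> alone is at least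
        \<open>1 / (\<delta> i powr s)\<close>.\<close>
      define \<kappa> where "\<kappa> = (\<lambda>x y :: real^'d. \<Sum>q\<le>Q. (2 ^ Suc q) powr s * near ((1 / 2) ^ q) x y)"
      have \<kappa>: "1 / (\<delta> i powr s) \<le> \<kappa> x y" if i: "i \<in> {..<n}" and xy: "x \<in> V i" "y \<in> V i" for i x y
      proof -
        have i': "i < n" using i by simp
        obtain q where q: "q \<le> Q" "\<delta> i \<le> (1 / 2) ^ q" "(1 / 2) ^ Suc q < \<delta> i"
          using dyadic_scale [OF Q\<delta> [OF i']] \<delta> i' by metis
        have "\<bar>x $ k - y $ k\<bar> \<le> (1 / 2) ^ q" for k
        proof -
          have "\<bar>x $ k - y $ k\<bar> \<le> dist x y"
            using component_le_norm_cart [of "x - y" k] by (simp add: dist_norm)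
          also have "\<dots> \<le> \<delta> i" using \<delta> xy i' by auto
          finally show ?thesis using q by simp
        qed
        then have near: "near ((1 / 2) ^ q) x y = 1" by (simp add: near_def)
        have "1 / (\<delta> i powr s) = (1 / \<delta> i) powr s"
          using \<delta> i' by (simp add: powr_divide)
        also have "\<dots> \<le> (2 ^ Suc q) powr s"
        proof (rule powr_mono2)
          have "\<delta> i > 0" using \<delta> i' by simp
          then show "1 / \<delta> i \<le> 2 ^ Suc q"
            using q(3) by (simp add: field_simps power_one_over)
        qed (use s \<delta> i' in auto)
        also have "\<dots> = (2 ^ Suc q) powr s * near ((1 / 2) ^ q) x y" using near by simp
        also have "\<dots> \<le> \<kappa> x y"
          unfolding \<kappa>_def using q(1)
          by (intro member_le_sum [where f = "\<lambda>q. (2 ^ Suc q) powr s * near ((1 / 2) ^ q) x y"])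
            (auto intro: mult_nonneg_nonneg near_nonneg)
        finally show ?thesis .
      qed
      have "(1 / 2)\<^sup>2 \<le> (mass m (level Q) \<omega>)\<^sup>2" using Q(2) by (intro power_mono) auto
      also have "\<dots> \<le> (\<Sum>i<n. \<delta> i powr s) * ((\<Sum>i\<in>BL m \<times> BL (level Q). \<Sum>j\<in>BL m \<times> BL (level Q).
          wt i \<omega> * wt j \<omega> * \<kappa> (pt i \<omega>) (pt j \<omega>)) / (total m (level Q))\<^sup>2)"
      proof (rule mass_cover_bound [OF cover _ _ _ \<kappa>])
        show "0 < \<delta> i powr s" if "i \<in> {..<n}" for i using that \<delta> by auto
        show "0 \<le> \<kappa> x y" for x y
          unfolding \<kappa>_def by (intro sum_nonneg mult_nonneg_nonneg near_nonneg) auto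
      qed auto
      also have "(\<Sum>i\<in>BL m \<times> BL (level Q). \<Sum>j\<in>BL m \<times> BL (level Q).
          wt i \<omega> * wt j \<omega> * \<kappa> (pt i \<omega>) (pt j \<omega>)) / (total m (level Q))\<^sup>2 = energy s m Q \<omega>"
      proof -
        let ?J = "BL m \<times> BL (level Q)"
        have "(\<Sum>i\<in>?J. \<Sum>j\<in>?J. wt i \<omega> * wt j \<omega> * \<kappa> (pt i \<omega>) (pt j \<omega>))
            = (\<Sum>i\<in>?J. \<Sum>j\<in>?J. \<Sum>q\<le>Q. (2 ^ Suc q) powr s * (wt i \<omega> * wt j \<omega> * near ((1 / 2) ^ q) (pt i \<omega>) (pt j \<omega>)))"
          unfolding \<kappa>_def sum_distrib_left by (intro sum.cong refl) (simp only: mult_ac)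
        also have "\<dots> = (\<Sum>i\<in>?J. \<Sum>q\<le>Q. \<Sum>j\<in>?J. (2 ^ Suc q) powr s * (wt i \<omega> * wt j \<omega> * near ((1 / 2) ^ q) (pt i \<omega>) (pt j \<omega>)))"
          by (intro sum.cong refl sum.swap)
        also have "\<dots> = (\<Sum>q\<le>Q. \<Sum>i\<in>?J. \<Sum>j\<in>?J. (2 ^ Suc q) powr s * (wt i \<omega> * wt j \<omega> * near ((1 / 2) ^ q) (pt i \<omega>) (pt j \<omega>)))"
          by (rule sum.swap)
        finally show ?thesis
          unfolding energy_def pairs_def sum_distrib_left [symmetric]
          by (simp only: sum_divide_distrib [symmetric] times_divide_eq_right)
      qed
      also have "(\<Sum>i<n. \<delta> i powr s) * energy s m Q \<omega> \<le> (\<Sum>i<n. \<delta> i powr s) * K"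
        using Q(3) by (intro mult_left_mono sum_nonneg) auto
      finally show "1 / (4 * K) \<le> (\<Sum>i<n. \<delta> i powr s)"
        using K by (simp add: field_simps power2_eq_square)
    qed (use K in auto)
  qed
qed

text \<open>At full dimension the energy diverges, but a single scale suffices for Lebesgue measure.\<close>

lemma AE_dyadic_count:
  "AE \<omega> in M. \<exists>c>0. \<exists>\<^sub>\<infinity>Q. dyadic_content (\<Sum>k\<in>UNIV. e k) (sponge N \<alpha> t \<omega>) c Q"
proof -
  let ?E = "\<Sum>k\<in>UNIV. e k"
  let ?Z = "\<lambda>m Q \<omega>. (2 ^ Q) powr ?E * pairs m (level Q) ((1 / 2) ^ Q) \<omega>"
  have inv: "(2 ^ Q) powr ?E * ((1 / 2) ^ Q) powr ?E = 1" for Q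
    by (simp add: powr_mult [symmetric] power_mult_distrib [symmetric])
  have "AE \<omega> in M. \<exists>m. \<exists>K>0. \<exists>\<^sub>\<infinity>Q. mass m (level Q) \<omega> \<ge> 1 / 2 \<and> ?Z m Q \<omega> \<le> K"
  proof (rule AE_recurrent)
    show "?Z m Q \<in> borel_measurable M" for m Q
      using pairs_measurable by (intro borel_measurable_times) auto
    show "0 \<le> ?Z m Q \<omega>" for m Q \<omega>
      by (intro mult_nonneg_nonneg pairs_nonneg) auto
    show "\<exists>C\<ge>0. \<forall>Q. (\<integral>\<^sup>+\<omega>. ennreal (?Z m Q \<omega>) \<partial>M) \<le> ennreal C" for m
    proof (intro exI conjI allI)
      show "0 \<le> Cn m * (1 + Ksep) + 1" using Cn_nonneg [of m] Ksep_nonneg by simp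
      fix Q
      have "(\<integral>\<^sup>+\<omega>. ennreal (?Z m Q \<omega>) \<partial>M)
          = ennreal ((2 ^ Q) powr ?E) * (\<integral>\<^sup>+\<omega>. ennreal (pairs m (level Q) ((1 / 2) ^ Q) \<omega>) \<partial>M)"
        using pairs_measurable by (subst nn_integral_cmult [symmetric]) (auto simp: ennreal_mult')
      also have "\<dots> \<le> ennreal ((2 ^ Q) powr ?E) * ennreal ((Cn m * (1 + Ksep) + 1) * ((1 / 2) ^ Q) powr ?E)"
        by (intro mult_left_mono nn_pairs_level) auto
      also have "\<dots> = ennreal ((Cn m * (1 + Ksep) + 1) * ((2 ^ Q) powr ?E * ((1 / 2) ^ Q) powr ?E))"
        by (subst ennreal_mult' [symmetric]) (simp_all only: powr_ge_zero mult_ac)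
      finally show "(\<integral>\<^sup>+\<omega>. ennreal (?Z m Q \<omega>) \<partial>M) \<le> ennreal (Cn m * (1 + Ksep) + 1)"
        by (simp only: inv mult_1_right)
    qed
  qed
  then show ?thesis
  proof (rule AE_mp, intro AE_I2 impI, elim exE conjE)
    fix \<omega> m K assume K: "K > 0" and inf: "\<exists>\<^sub>\<infinity>Q. mass m (level Q) \<omega> \<ge> 1 / 2 \<and> ?Z m Q \<omega> \<le> K"
    have "\<exists>\<^sub>\<infinity>Q. dyadic_content ?E (sponge N \<alpha> t \<omega>) (1 / (4 * K)) Q"
    proof (rule INFM_mono [OF inf], unfold dyadic_content_def, intro allI impI, elim conjE)
      fix Q I and V :: "int^'d \<Rightarrow> (real^'d) set"
      assume Q: "mass m (level Q) \<omega> \<ge> 1 / 2" "?Z m Q \<omega> \<le> K" and I: "finite I"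
        and cover: "sponge N \<alpha> t \<omega> \<subseteq> (\<Union>i\<in>I. V i)"
        and V: "\<forall>i\<in>I. \<forall>x\<in>V i. \<forall>y\<in>V i. \<forall>k. \<bar>x $ k - y $ k\<bar> \<le> (1 / 2) ^ Q"
      have "(1 / 2)\<^sup>2 \<le> (mass m (level Q) \<omega>)\<^sup>2" using Q(1) by (intro power_mono) auto
      also have "\<dots> \<le> (\<Sum>i\<in>I. 1) * ((\<Sum>i\<in>BL m \<times> BL (level Q). \<Sum>j\<in>BL m \<times> BL (level Q).
          wt i \<omega> * wt j \<omega> * near ((1 / 2) ^ Q) (pt i \<omega>) (pt j \<omega>)) / (total m (level Q))\<^sup>2)"
        using V by (intro mass_cover_bound [OF cover I]) (auto simp: near_def)
      also have "\<dots> = real (card I) * pairs m (level Q) ((1 / 2) ^ Q) \<omega>"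
        by (simp add: pairs_def)
      also have "\<dots> = real (card I) * (((2 ^ Q) powr ?E * ((1 / 2) ^ Q) powr ?E) * pairs m (level Q) ((1 / 2) ^ Q) \<omega>)"
        by (simp only: inv mult_1_left)
      also have "\<dots> = real (card I) * ((1 / 2) ^ Q) powr ?E * ?Z m Q \<omega>"
        by (simp only: mult_ac)
      also have "\<dots> \<le> real (card I) * ((1 / 2) ^ Q) powr ?E * K"
        using Q(2) by (intro mult_left_mono) auto
      finally show "1 / (4 * K) \<le> real (card I) * ((1 / 2) ^ Q) powr ?E"
        using K by (simp add: field_simps power2_eq_square)
    qed
    moreover have "0 < 1 / (4 * K)" using K by simp
    ultimately show "\<exists>c>0. \<exists>\<^sub>\<infinity>Q. dyadic_content ?E (sponge N \<alpha> t \<omega>) c Q" by blast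
  qed
qed

end

subsection \<open>Contents, coverings and dimensions\<close>

lemma has_content_mono:
  assumes "has_content s' X" "s \<le> s'"
  shows "has_content s X"
proof -
  obtain c where c: "c > 0" "\<And>n V \<delta>. X \<subseteq> (\<Union>i<n. V i) \<Longrightarrow>
    (\<forall>i<n. 0 < \<delta> i \<and> \<delta> i \<le> 1 \<and> (\<forall>x\<in>V i. \<forall>y\<in>V i. dist x y \<le> \<delta> i)) \<Longrightarrow> c \<le> (\<Sum>i<n::nat. \<delta> i powr s')"
    using assms(1) unfolding has_content_def by auto
  show ?thesis unfolding has_content_def
  proof (intro exI conjI allI impI)
    show "c > 0" by fact
    fix n and V :: "nat \<Rightarrow> 'a set" and \<delta> :: "nat \<Rightarrow> real" assume *: "X \<subseteq> (\<Union>i<n. V i)"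
      "\<forall>i<n. 0 < \<delta> i \<and> \<delta> i \<le> 1 \<and> (\<forall>x\<in>V i. \<forall>y\<in>V i. dist x y \<le> \<delta> i)"
    have "c \<le> (\<Sum>i<n. \<delta> i powr s')" using * by (rule c(2))
    also have "\<dots> \<le> (\<Sum>i<n. \<delta> i powr s)"
      using *(2) assms(2) by (intro sum_mono powr_mono') auto
    finally show "c \<le> (\<Sum>i<n. \<delta> i powr s)" .
  qed
qed

text \<open>The pieces of a countable cover are fattened to open sets, so that compactness leaves
  finitely many; the sum of powers grows by at most \<open>\<eta>\<close>, so a small countable sum
  would contradict the content bound.\<close>

lemma hausdorff_measure_nonzero:
  fixes X :: "'a::metric_space set"
  assumes X: "compact X" and s: "0 < s" and content: "has_content s X"
  shows "hausdorff_measure s X \<noteq> 0"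
proof
  assume zero: "hausdorff_measure s X = 0"
  obtain c where c: "c > 0" "\<And>n V \<delta>. X \<subseteq> (\<Union>i<n. V i) \<Longrightarrow>
    (\<forall>i<n. 0 < \<delta> i \<and> \<delta> i \<le> 1 \<and> (\<forall>x\<in>V i. \<forall>y\<in>V i. dist x y \<le> \<delta> i)) \<Longrightarrow> c \<le> (\<Sum>i<n::nat. \<delta> i powr s)"
    using content unfolding has_content_def by auto
  \<comment> \<open>\<open>c / 4\<close> bounds both the sum and the growth by fattening, in total
    \<open>c / 2\<close>; the second entry keeps the fattened sizes at most 1, as the diameters are
    at most \<open>1 / 2\<close>.\<close>
  define \<eta> where "\<eta> = min (c / 4) (1 - (1 / 2) powr s)"
  have \<eta>: "\<eta> > 0" "\<eta> \<le> c / 4" "(1 / 2) powr s + \<eta> \<le> 1"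
    using c(1) s powr01_less_one [of "1 / 2" s] by (auto simp: \<eta>_def min_def)
  have "hausdorff_pre s (1 / 2) X = 0"
    using zero unfolding hausdorff_measure_def by (simp add: SUP_eq_iff [where c = 0] bot_ennreal [symmetric])
  then have "hausdorff_pre s (1 / 2) X < ennreal \<eta>" using \<eta> by simp
  then obtain U :: "nat \<Rightarrow> 'a set" where U: "X \<subseteq> (\<Union>n. U n)" "\<And>n. bounded (U n)" "\<And>n. diameter (U n) \<le> 1 / 2"
    and sumU: "(\<Sum>n. ennreal (diameter (U n) powr s)) < ennreal \<eta>"
    unfolding hausdorff_pre_def INF_less_iff by auto
  define \<epsilon> where "\<epsilon> = (\<lambda>n. \<eta> * (1 / 2) ^ Suc n)"
  \<comment> \<open>Defined so that \<open>\<delta> n powr s\<close> is exactly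
    \<open>diameter (U n) powr s + \<epsilon> n\<close>; half of the gap between
    \<open>\<delta> n\<close> and the diameter is the radius of the fattening.\<close>
  define \<delta> where "\<delta> = (\<lambda>n. (diameter (U n) powr s + \<epsilon> n) powr (1 / s))"
  define V where "V = (\<lambda>n. \<Union>x\<in>U n. ball x ((\<delta> n - diameter (U n)) / 2))"
  have \<epsilon>: "0 < \<epsilon> n" "\<epsilon> n \<le> \<eta>" for n
    using \<eta>(1) power_le_one [of "1 / 2 :: real" "Suc n"] by (auto simp: \<epsilon>_def)
  have d0: "0 \<le> diameter (U n)" for n by (rule diameter_ge_0 [OF U(2)])
  have \<delta>s: "\<delta> n powr s = diameter (U n) powr s + \<epsilon> n" for n
    using s \<epsilon>(1) [of n] powr_ge_zero [of "diameter (U n)" s] by (simp add: \<delta>_def powr_powr add_nonneg_pos less_imp_le)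
  have \<delta>_gt: "diameter (U n) < \<delta> n" for n
  proof (rule ccontr)
    assume "\<not> diameter (U n) < \<delta> n"
    then have "\<delta> n powr s \<le> diameter (U n) powr s" using s by (intro powr_mono2) (auto simp: \<delta>_def)
    then show False using \<delta>s [of n] \<epsilon>(1) [of n] by simp
  qed
  have \<delta>_le: "\<delta> n \<le> 1" for n
  proof -
    have "diameter (U n) powr s \<le> (1 / 2) powr s" using d0 U(3) s by (intro powr_mono2) auto
    then have "diameter (U n) powr s + \<epsilon> n \<le> 1" using \<eta>(3) \<epsilon>(2) [of n] by linarith
    moreover have "0 \<le> diameter (U n) powr s + \<epsilon> n" using \<epsilon>(1) [of n] by (simp add: less_imp_le)
    ultimately have "\<delta> n \<le> 1 powr (1 / s)" unfolding \<delta>_def using s by (intro powr_mono2) auto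
    then show ?thesis by simp
  qed
  have cov: "X \<subseteq> (\<Union>n\<in>UNIV. V n)"
  proof
    fix x assume "x \<in> X"
    then obtain n where "x \<in> U n" using U(1) by blast
    then have "x \<in> V n" using \<delta>_gt [of n] by (auto simp: V_def intro!: bexI [of _ x])
    then show "x \<in> (\<Union>n\<in>UNIV. V n)" by blast
  qed
  have op: "open (V n)" for n unfolding V_def by (intro open_UN ballI open_ball)
  obtain F where "F \<subseteq> UNIV" and F: "finite F" "X \<subseteq> (\<Union>n\<in>F. V n)"
    by (rule compactE_image [OF X op cov])
  obtain n0 where n0: "F \<subseteq> {..<n0}" using F(1) finite_nat_iff_bounded by blast
  have "c \<le> (\<Sum>i<n0. \<delta> i powr s)"
  proof (rule c(2))
    show "X \<subseteq> (\<Union>i<n0. V i)" using F(2) n0 by blast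
    show "\<forall>i<n0. 0 < \<delta> i \<and> \<delta> i \<le> 1 \<and> (\<forall>x\<in>V i. \<forall>y\<in>V i. dist x y \<le> \<delta> i)"
    proof (intro allI impI conjI ballI)
      fix i x y assume "x \<in> V i" "y \<in> V i"
      then obtain x' y' where *: "x' \<in> U i" "dist x' x < (\<delta> i - diameter (U i)) / 2"
        "y' \<in> U i" "dist y' y < (\<delta> i - diameter (U i)) / 2" by (auto simp: V_def)
      have "dist x y \<le> dist x' x + dist x' y' + dist y' y"
        using dist_triangle [of x y x'] dist_triangle [of x' y y'] by (simp add: dist_commute)
      moreover have "dist x' y' \<le> diameter (U i)" using U(2) * by (intro diameter_bounded_bound) auto
      ultimately show "dist x y \<le> \<delta> i" using *(2,4) by (simp add: field_simps)
    next
      fix i show "0 < \<delta> i" using \<delta>_gt [of i] d0 [of i] by simp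
    qed (rule \<delta>_le)
  qed
  also have "\<dots> = (\<Sum>i<n0. diameter (U i) powr s) + (\<Sum>i<n0. \<epsilon> i)" by (simp add: \<delta>s sum.distrib)
  also have "(\<Sum>i<n0. diameter (U i) powr s) \<le> \<eta>"
  proof -
    have "ennreal (\<Sum>i<n0. diameter (U i) powr s) = (\<Sum>i<n0. ennreal (diameter (U i) powr s))"
      by (simp add: sum_ennreal)
    also have "\<dots> \<le> (\<Sum>n. ennreal (diameter (U n) powr s))" by (intro sum_le_suminf) auto
    also have "\<dots> \<le> ennreal \<eta>" using sumU by simp
    finally show ?thesis using \<eta>(1) by (simp add: ennreal_le_iff)
  qed
  also have "(\<Sum>i<n0. \<epsilon> i) \<le> \<eta>"
  proof -
    have "(\<Sum>i<n0. (1 / 2 :: real) ^ Suc i) = 1 - (1 / 2) ^ n0"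
      by (induction n0) (auto simp: field_simps)
    then have "(\<Sum>i<n0. \<epsilon> i) = \<eta> * (1 - (1 / 2) ^ n0)"
      by (simp only: \<epsilon>_def sum_distrib_left [symmetric])
    also have "\<dots> \<le> \<eta> * 1" using \<eta>(1) by (intro mult_left_mono) auto
    finally show ?thesis by simp
  qed
  finally show False using \<eta>(2) c(1) by linarith
qed

definition small_covers :: "real \<Rightarrow> 'a::metric_space set \<Rightarrow> bool" where
  "small_covers s X \<longleftrightarrow> (\<exists>C>0. \<forall>\<delta>. 0 < \<delta> \<longrightarrow> \<delta> \<le> 1 / 2 \<longrightarrow> real (covering_number X \<delta>) \<le> C * \<delta> powr - s)"

lemma small_covers_mono:
  assumes "small_covers s X" "s \<le> s'"
  shows "small_covers s' X"
proof -
  obtain C where C: "C > 0" "\<And>\<delta>. 0 < \<delta> \<Longrightarrow> \<delta> \<le> 1 / 2 \<Longrightarrow> real (covering_number X \<delta>) \<le> C * \<delta> powr - s"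
    using assms(1) unfolding small_covers_def by blast
  have "real (covering_number X \<delta>) \<le> C * \<delta> powr - s'" if \<delta>: "0 < \<delta>" "\<delta> \<le> 1 / 2" for \<delta>
  proof (rule order_trans [OF C(2) [OF \<delta>]])
    show "C * \<delta> powr - s \<le> C * \<delta> powr - s'"
      using C(1) assms(2) \<delta> by (intro mult_left_mono powr_mono') auto
  qed
  with C(1) show ?thesis unfolding small_covers_def by blast
qed

lemma diameter_le_dist:
  fixes S :: "'a::metric_space set"
  assumes "\<And>x y. x \<in> S \<Longrightarrow> y \<in> S \<Longrightarrow> dist x y \<le> d" "0 \<le> d"
  shows "diameter S \<le> d"
  using assms by (auto simp: diameter_def intro!: cSUP_least)

lemma ex_finite_cover:
  fixes X :: "'a::metric_space set"
  assumes "compact X" "\<delta> > 0"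
  shows "\<exists>n. \<exists>U :: nat \<Rightarrow> 'a set. X \<subseteq> (\<Union>i<n. U i) \<and> (\<forall>i<n. bounded (U i) \<and> diameter (U i) \<le> \<delta>)"
proof -
  have "X \<subseteq> (\<Union>x\<in>X. ball x (\<delta> / 2))" using assms(2) by auto
  then obtain F where F: "F \<subseteq> X" "finite F" "X \<subseteq> (\<Union>x\<in>F. ball x (\<delta> / 2))"
    using compactE_image [OF assms(1), of X "\<lambda>x. ball x (\<delta> / 2)"] by auto
  obtain f and n :: nat where f: "F = f ` {i. i < n}" using F(2) finite_imp_nat_seg_image_inj_on by metis
  have "diameter (ball x (\<delta> / 2)) \<le> \<delta>" for x :: 'a
  proof (rule diameter_le_dist)
    show "0 \<le> \<delta>" using assms(2) by simp
    show "dist y z \<le> \<delta>" if "y \<in> ball x (\<delta> / 2)" "z \<in> ball x (\<delta> / 2)" for y z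
      using that dist_triangle [of y z x] by (simp add: dist_commute)
  qed
  then show ?thesis using F(3) f
    by (intro exI [of _ n] exI [of _ "\<lambda>i. ball (f i) (\<delta> / 2)"]) (auto simp: lessThan_def)
qed

lemma covering_number_cover:
  fixes X :: "'a::metric_space set"
  assumes "compact X" "\<delta> > 0"
  obtains U :: "nat \<Rightarrow> 'a set" where "X \<subseteq> (\<Union>i<covering_number X \<delta>. U i)"
    "\<And>i. i < covering_number X \<delta> \<Longrightarrow> bounded (U i) \<and> diameter (U i) \<le> \<delta>"
  using LeastI_ex [OF ex_finite_cover [OF assms]] unfolding covering_number_def [symmetric] by metis

lemma covering_number_ge:
  fixes X :: "'a::metric_space set"
  assumes X: "compact X" and "has_content s X"
  obtains c where "c > 0" "\<And>\<delta>. 0 < \<delta> \<Longrightarrow> \<delta> \<le> 1 \<Longrightarrow> c * \<delta> powr - s \<le> real (covering_number X \<delta>)"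
proof -
  obtain c where c: "c > 0" "\<And>n V \<delta>. X \<subseteq> (\<Union>i<n. V i) \<Longrightarrow>
    (\<forall>i<n. 0 < \<delta> i \<and> \<delta> i \<le> 1 \<and> (\<forall>x\<in>V i. \<forall>y\<in>V i. dist x y \<le> \<delta> i)) \<Longrightarrow> c \<le> (\<Sum>i<n::nat. \<delta> i powr s)"
    using assms(2) unfolding has_content_def by auto
  have "c * \<delta> powr - s \<le> real (covering_number X \<delta>)" if \<delta>: "0 < \<delta>" "\<delta> \<le> 1" for \<delta>
  proof -
    obtain U :: "nat \<Rightarrow> 'a set" where U: "X \<subseteq> (\<Union>i<covering_number X \<delta>. U i)"
      "\<And>i. i < covering_number X \<delta> \<Longrightarrow> bounded (U i) \<and> diameter (U i) \<le> \<delta>"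
      using covering_number_cover [OF X \<delta>(1)] by metis
    have "c \<le> (\<Sum>i<covering_number X \<delta>. \<delta> powr s)"
    proof (rule c(2) [OF U(1)], intro allI impI conjI ballI)
      fix i x y assume "i < covering_number X \<delta>" "x \<in> U i" "y \<in> U i"
      then show "dist x y \<le> \<delta>"
        using U(2) [of i] diameter_bounded_bound [of "U i" x y] by auto
    qed (use \<delta> in auto)
    then show ?thesis using \<delta> by (simp add: powr_minus field_simps)
  qed
  with c(1) show ?thesis by (rule that)
qed

text \<open>A cover by sets of diameter at most \<open>r\<close> has sum at most
  \<open>C * r powr (s - s')\<close>, which tends to 0; the finite cover is filled up with empty
  sets, whose contribution is 0.\<close>

lemma hausdorff_measure_zero:
  fixes X :: "'a::metric_space set"
  assumes X: "compact X" and s: "s' < s" "0 < s" and covers: "small_covers s' X"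
  shows "hausdorff_measure s X = 0"
proof -
  obtain C where N: "\<And>\<delta>. 0 < \<delta> \<Longrightarrow> \<delta> \<le> 1 / 2 \<Longrightarrow> real (covering_number X \<delta>) \<le> C * \<delta> powr - s'"
    using covers unfolding small_covers_def by blast
  have "hausdorff_pre s \<delta> X \<le> 0" if "\<delta> > 0" for \<delta>
  proof (rule tendsto_lowerbound)
    have "((\<lambda>r. C * r powr (s - s')) \<longlongrightarrow> C * 0) (at_right 0)"
    proof (rule tendsto_mult [OF tendsto_const])
      have "((\<lambda>r. r powr (s - s')) \<longlongrightarrow> 0 powr (s - s')) (at_right 0)"
        by (rule tendsto_powr' [OF tendsto_ident_at tendsto_const])
          (use s in \<open>auto simp: eventually_at_right_less less_imp_le intro: eventually_mono [OF eventually_at_right_less]\<close>)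
      then show "((\<lambda>r. r powr (s - s')) \<longlongrightarrow> 0) (at_right 0)" by simp
    qed
    then show "((\<lambda>r. ennreal (C * r powr (s - s'))) \<longlongrightarrow> 0) (at_right 0)"
      by (intro tendsto_ennrealI [where x = 0, simplified]) simp
    show "eventually (\<lambda>r. hausdorff_pre s \<delta> X \<le> ennreal (C * r powr (s - s'))) (at_right 0)"
      unfolding eventually_at_right_field
    proof (intro exI [of _ "min \<delta> (1 / 2)"] conjI allI impI)
      show "min \<delta> (1 / 2) > 0" using that by simp
      fix r :: real assume r: "0 < r" "r < min \<delta> (1 / 2)"
      obtain U :: "nat \<Rightarrow> 'a set" where U: "X \<subseteq> (\<Union>i<covering_number X r. U i)"
        "\<And>i. i < covering_number X r \<Longrightarrow> bounded (U i) \<and> diameter (U i) \<le> r"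
        using covering_number_cover [OF X r(1)] by metis
      define V where "V = (\<lambda>i. if i < covering_number X r then U i else {})"
      have "hausdorff_pre s \<delta> X \<le> (\<Sum>n. ennreal (diameter (V n) powr s))"
        unfolding hausdorff_pre_def
      proof (rule INF_lower)
        have "X \<subseteq> (\<Union>n. V n)" using U(1) by (force simp: V_def)
        moreover have "bounded (V n) \<and> diameter (V n) \<le> \<delta>" for n
          using U(2) [of n] r that by (auto simp: V_def)
        ultimately show "V \<in> {U. X \<subseteq> (\<Union>n. U n) \<and> (\<forall>n. bounded (U n) \<and> diameter (U n) \<le> \<delta>)}" by blast
      qed
      also have "\<dots> = (\<Sum>n<covering_number X r. ennreal (diameter (V n) powr s))"
        by (rule suminf_finite) (auto simp: V_def)
      also have "\<dots> \<le> (\<Sum>n<covering_number X r. ennreal (r powr s))"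
        using U(2) s(2) diameter_ge_0
        by (intro sum_mono ennreal_leI powr_mono2) (auto simp: V_def)
      also have "\<dots> = ennreal (real (covering_number X r) * r powr s)"
        by (simp add: ennreal_mult' ennreal_of_nat_eq_real_of_nat)
      also have "\<dots> \<le> ennreal (C * r powr - s' * r powr s)"
        using N [of r] r by (intro ennreal_leI mult_right_mono) auto
      also have "C * r powr - s' * r powr s = C * r powr (s - s')"
        using r by (simp add: powr_add [symmetric])
      finally show "hausdorff_pre s \<delta> X \<le> ennreal (C * r powr (s - s'))" .
    qed
  qed simp
  then show ?thesis unfolding hausdorff_measure_def by (intro antisym SUP_least) auto
qed

text \<open>Constants disappear in the quotient of logarithms, so power bounds with exponents
  arbitrarily close to \<open>D\<close> squeeze the limit. The lower bound also shows that the
  covering number is positive before logarithms are taken.\<close>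

lemma minkowski_dimI:
  fixes X :: "'a::metric_space set"
  assumes D: "D > 0"
    and lower: "\<And>s. 0 < s \<Longrightarrow> s < D \<Longrightarrow> \<exists>c>0. \<forall>\<delta>. 0 < \<delta> \<longrightarrow> \<delta> \<le> 1 \<longrightarrow> c * \<delta> powr - s \<le> real (covering_number X \<delta>)"
    and upper: "\<And>s. D < s \<Longrightarrow> small_covers s X"
  shows "has_minkowski_dim X D"
proof -
  have lim: "((\<lambda>\<delta>. s + ln c / (- ln \<delta>)) \<longlongrightarrow> s) (at_right 0)" for s c :: real
    by real_asymp
  have pos: "real (covering_number X \<delta>) > 0" if "0 < \<delta>" "\<delta> \<le> 1" for \<delta>
  proof -
    have "\<exists>c>0. \<forall>\<delta>. 0 < \<delta> \<longrightarrow> \<delta> \<le> 1 \<longrightarrow> c * \<delta> powr - (D / 2) \<le> real (covering_number X \<delta>)"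
      using D by (intro lower) auto
    then obtain c where "c > 0" and c: "\<forall>\<delta>. 0 < \<delta> \<longrightarrow> \<delta> \<le> 1 \<longrightarrow> c * \<delta> powr - (D / 2) \<le> real (covering_number X \<delta>)"
      by blast
    have "c * \<delta> powr - (D / 2) \<le> real (covering_number X \<delta>)" using c that by blast
    moreover have "0 < c * \<delta> powr - (D / 2)" using \<open>c > 0\<close> that by simp
    ultimately show ?thesis by linarith
  qed
  have quot: "ln (c * \<delta> powr - s) / (- ln \<delta>) = s + ln c / (- ln \<delta>)" if "c > 0" "0 < \<delta>" "\<delta> < 1" for c \<delta> s :: real
    using that by (simp add: ln_mult ln_powr field_simps)
  show ?thesis unfolding has_minkowski_dim_def
  proof (rule order_tendstoI)
    fix a assume a: "a < D"
    define s where "s = (max a 0 + D) / 2"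
    have s: "0 < s" "s < D" "a < s" using a D by (auto simp: s_def)
    obtain c where c: "c > 0" "\<And>\<delta>. 0 < \<delta> \<Longrightarrow> \<delta> \<le> 1 \<Longrightarrow> c * \<delta> powr - s \<le> real (covering_number X \<delta>)"
      using lower [OF s(1,2)] by auto
    have "\<forall>\<^sub>F \<delta> in at_right 0. a < s + ln c / (- ln \<delta>)" using lim s(3) by (rule order_tendstoD(1))
    moreover have "\<forall>\<^sub>F \<delta> in at_right (0::real). 0 < \<delta> \<and> \<delta> < 1"
      by (auto simp: eventually_at_right_field intro: exI [of _ 1])
    ultimately show "\<forall>\<^sub>F \<delta> in at_right 0. a < ln (real (covering_number X \<delta>)) / (- ln \<delta>)"
    proof eventually_elim
      case (elim \<delta>)
      then have "ln (c * \<delta> powr - s) / (- ln \<delta>) \<le> ln (real (covering_number X \<delta>)) / (- ln \<delta>)"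
        using c pos [of \<delta>] by (intro divide_right_mono ln_mono) auto
      with elim c show ?case by (simp only: quot)
    qed
  next
    fix a assume a: "D < a"
    define s where "s = (a + D) / 2"
    have s: "D < s" "s < a" using a by (auto simp: s_def)
    obtain C where C: "C > 0" "\<And>\<delta>. 0 < \<delta> \<Longrightarrow> \<delta> \<le> 1 / 2 \<Longrightarrow> real (covering_number X \<delta>) \<le> C * \<delta> powr - s"
      using upper [OF s(1)] unfolding small_covers_def by auto
    have "\<forall>\<^sub>F \<delta> in at_right 0. s + ln C / (- ln \<delta>) < a" using lim s(2) by (rule order_tendstoD(2))
    moreover have "\<forall>\<^sub>F \<delta> in at_right (0::real). 0 < \<delta> \<and> \<delta> < 1 / 2"
      by (auto simp: eventually_at_right_field intro: exI [of _ "1 / 2"])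
    ultimately show "\<forall>\<^sub>F \<delta> in at_right 0. ln (real (covering_number X \<delta>)) / (- ln \<delta>) < a"
    proof eventually_elim
      case (elim \<delta>)
      then have "ln (real (covering_number X \<delta>)) / (- ln \<delta>) \<le> ln (C * \<delta> powr - s) / (- ln \<delta>)"
        using C pos [of \<delta>] by (intro divide_right_mono ln_mono) auto
      also have "\<dots> = s + ln C / (- ln \<delta>)" using elim C by (intro quot) auto
      finally show ?case using elim by linarith
    qed
  qed
qed

lemma dimensions_eqI:
  fixes X :: "'a::metric_space set"
  assumes X: "compact X" and D: "D > 0"
    and lower: "\<And>s. 0 < s \<Longrightarrow> s < D \<Longrightarrow> has_content s X"
    and upper: "\<And>s. D < s \<Longrightarrow> small_covers s X"
  shows "hausdorff_dim X = D \<and> has_minkowski_dim X D"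
proof
  show "has_minkowski_dim X D"
  proof (rule minkowski_dimI [OF D _ upper])
    fix s assume "0 < s" "s < D"
    then show "\<exists>c>0. \<forall>\<delta>. 0 < \<delta> \<longrightarrow> \<delta> \<le> 1 \<longrightarrow> c * \<delta> powr - s \<le> real (covering_number X \<delta>)"
      using covering_number_ge [OF X lower] by metis
  qed
  let ?S = "{s. 0 < s \<and> hausdorff_measure s X = 0}"
  have zero: "s \<in> ?S" if "D < s" for s
  proof -
    have "hausdorff_measure s X = 0"
      using that D upper [of "(s + D) / 2"] by (intro hausdorff_measure_zero [OF X, of "(s + D) / 2"]) auto
    then show ?thesis using that D by simp
  qed
  have ge: "D \<le> s" if "s \<in> ?S" for s
    using that hausdorff_measure_nonzero [OF X _ lower, of s] by force
  show "hausdorff_dim X = D"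
    unfolding hausdorff_dim_def
  proof (rule antisym)
    show "D \<le> Inf ?S" using zero [of "D + 1"] by (intro cInf_greatest ge) auto
    show "Inf ?S \<le> D"
    proof (rule field_le_epsilon)
      fix e :: real assume "e > 0"
      have "bdd_below ?S" by (rule bdd_belowI [of _ D]) (rule ge)
      then show "Inf ?S \<le> D + e" using zero [of "D + e"] \<open>e > 0\<close> by (intro cInf_lower) auto
    qed
  qed
qed

section \<open>Grid covers of boxes and Lebesgue measure\<close>

definition grid_cell :: "real \<Rightarrow> ('d \<Rightarrow> int) \<Rightarrow> (real^'d::finite) set" where
  "grid_cell \<eta> z = {x. \<forall>k. \<lfloor>x $ k / \<eta>\<rfloor> = z k}"

lemma grid_cell_diff:
  assumes "\<eta> > 0" "x \<in> grid_cell \<eta> z" "y \<in> grid_cell \<eta> z"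
  shows "\<bar>x $ k - y $ k\<bar> \<le> \<eta>"
proof -
  have "\<lfloor>x $ k / \<eta>\<rfloor> = \<lfloor>y $ k / \<eta>\<rfloor>" using assms by (simp add: grid_cell_def)
  then have "\<bar>x $ k / \<eta> - y $ k / \<eta>\<bar> \<le> 1" by linarith
  then have "\<bar>x $ k - y $ k\<bar> / \<eta> \<le> 1" using assms(1) by (simp add: diff_divide_distrib [symmetric] abs_divide)
  then show ?thesis using assms(1) by (simp add: divide_le_eq)
qed

text \<open>Cells of side \<open>\<delta> / CARD('d)\<close> have diameter at most
  \<open>\<delta>\<close>, since the norm is bounded by the sum of the moduli of the
  coordinates.\<close>

lemma covering_number_le_grid:
  fixes E :: "(real^'d::finite) set"
  assumes \<delta>: "\<delta> > 0" and I: "finite I" and E: "E \<subseteq> (\<Union>z\<in>I. grid_cell (\<delta> / real CARD('d)) z)"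
  shows "covering_number E \<delta> \<le> card I"
proof -
  let ?c = "grid_cell (\<delta> / real CARD('d)) :: _ \<Rightarrow> (real^'d) set"
  have d: "\<delta> / real CARD('d) > 0" using \<delta> by simp
  have dist: "dist x y \<le> \<delta>" if "x \<in> ?c z" "y \<in> ?c z" for x y z
  proof -
    have "dist x y \<le> (\<Sum>k\<in>UNIV. \<bar>(x - y) $ k\<bar>)" unfolding dist_norm by (rule norm_le_l1_cart)
    also have "\<dots> \<le> (\<Sum>k\<in>(UNIV :: 'd set). \<delta> / real CARD('d))"
      using grid_cell_diff [OF d that] by (intro sum_mono) auto
    finally show ?thesis by simp
  qed
  obtain f where f: "bij_betw f {0..<card I} I" using ex_bij_betw_nat_finite [OF I] by auto
  have "E \<subseteq> (\<Union>i<card I. ?c (f i))"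
  proof
    fix x assume "x \<in> E"
    then obtain z where "z \<in> I" "x \<in> ?c z" using E by blast
    then obtain i where "i < card I" "f i = z" using f by (force simp: bij_betw_def image_iff)
    then show "x \<in> (\<Union>i<card I. ?c (f i))" using \<open>x \<in> ?c z\<close> by blast
  qed
  moreover have "bounded (?c z)" for z
    unfolding bounded_two_points using dist by blast
  moreover have "diameter (?c z) \<le> \<delta>" for z
    using dist \<delta> by (intro diameter_le_dist) auto
  ultimately have "\<exists>U :: nat \<Rightarrow> (real^'d) set. E \<subseteq> (\<Union>i<card I. U i) \<and> (\<forall>i<card I. bounded (U i) \<and> diameter (U i) \<le> \<delta>)"
    by (intro exI [of _ "\<lambda>i. ?c (f i)"]) auto
  then show ?thesis unfolding covering_number_def by (rule Least_le)
qed

lemma covering_number_le_boxes: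
  fixes E :: "(real^'d::finite) set" and p l :: "'u \<Rightarrow> 'd \<Rightarrow> real"
  assumes \<delta>: "\<delta> > 0" and F: "finite F" and l: "\<And>u k. 0 \<le> l u k"
    and E: "\<And>x. x \<in> E \<Longrightarrow> \<exists>u\<in>F. \<forall>k. \<bar>x $ k - p u k\<bar> \<le> l u k"
  shows "real (covering_number E \<delta>) \<le> (\<Sum>u\<in>F. \<Prod>k\<in>UNIV. 2 * l u k * real CARD('d) / \<delta> + 2)"
proof -
  define \<eta> where "\<eta> = \<delta> / real CARD('d)"
  have \<eta>: "\<eta> > 0" using \<delta> by (simp add: \<eta>_def)
  define R where "R = (\<lambda>u k. {\<lfloor>(p u k - l u k) / \<eta>\<rfloor>..\<lfloor>(p u k + l u k) / \<eta>\<rfloor>})"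
  let ?I = "\<Union>u\<in>F. PiE UNIV (R u)"
  have fin: "finite (PiE UNIV (R u))" for u by (intro finite_PiE) (auto simp: R_def)
  have "covering_number E \<delta> \<le> card ?I"
  proof (rule covering_number_le_grid [OF \<delta>])
    show "finite ?I" using F fin by blast
    show "E \<subseteq> (\<Union>z\<in>?I. grid_cell (\<delta> / real CARD('d)) z)"
    proof
      fix x assume "x \<in> E"
      then obtain u where u: "u \<in> F" "\<And>k. \<bar>x $ k - p u k\<bar> \<le> l u k" using E by blast
      have "\<lfloor>x $ k / \<eta>\<rfloor> \<in> R u k" for k
      proof -
        have "(p u k - l u k) / \<eta> \<le> x $ k / \<eta>" "x $ k / \<eta> \<le> (p u k + l u k) / \<eta>"
          using u(2) [of k] \<eta> by (auto intro!: divide_right_mono)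
        then show ?thesis unfolding R_def by (auto intro: floor_mono)
      qed
      then have "(\<lambda>k. \<lfloor>x $ k / \<eta>\<rfloor>) \<in> ?I" using u(1) by auto
      moreover have "x \<in> grid_cell (\<delta> / real CARD('d)) (\<lambda>k. \<lfloor>x $ k / \<eta>\<rfloor>)"
        by (simp add: grid_cell_def \<eta>_def)
      ultimately show "x \<in> (\<Union>z\<in>?I. grid_cell (\<delta> / real CARD('d)) z)" by blast
    qed
  qed
  also have "\<dots> \<le> (\<Sum>u\<in>F. card (PiE UNIV (R u)))" by (rule card_UN_le [OF F])
  finally have "real (covering_number E \<delta>) \<le> (\<Sum>u\<in>F. real (card (PiE UNIV (R u))))"
    by (simp only: of_nat_sum [symmetric] of_nat_le_iff)
  also have "\<dots> = (\<Sum>u\<in>F. \<Prod>k\<in>UNIV. real (card (R u k)))"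
    by (simp add: card_PiE of_nat_prod)
  also have "\<dots> \<le> (\<Sum>u\<in>F. \<Prod>k\<in>UNIV. 2 * l u k * real CARD('d) / \<delta> + 2)"
  proof (intro sum_mono prod_mono conjI)
    fix u k
    have "(p u k - l u k) / \<eta> \<le> (p u k + l u k) / \<eta>" using l [of u k] \<eta> by (intro divide_right_mono) auto
    \<comment> \<open>The integers from the floor of \<open>x\<close> to the floor of
      \<open>y\<close> number fewer than \<open>y - x + 2\<close>, which explains the summand
      2.\<close>
    then have "real (card (R u k)) \<le> (p u k + l u k) / \<eta> - (p u k - l u k) / \<eta> + 2"
      unfolding R_def card_atLeastAtMost_int by linarith
    also have "\<dots> = 2 * l u k * real CARD('d) / \<delta> + 2"
      using \<delta> by (simp add: \<eta>_def field_simps)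
    finally show "real (card (R u k)) \<le> 2 * l u k * real CARD('d) / \<delta> + 2" .
  qed simp
  finally show ?thesis .
qed

text \<open>If \<open>X\<close> were null, outer regularity would give an open set around it of
  volume below \<open>c\<close>. At a fine good scale all grid cells meeting \<open>X\<close> lie in
  that set, and by the dyadic content their total volume is at least \<open>c\<close>.\<close>

lemma lebesgue_pos_if_dyadic_count:
  fixes X :: "(real^'d::finite) set"
  assumes X: "compact X" and c: "c > 0"
    and count: "\<exists>\<^sub>\<infinity>Q. dyadic_content (real CARD('d)) X c Q"
  shows "emeasure lebesgue X > 0"
proof (rule ccontr)
  assume "\<not> emeasure lebesgue X > 0"
  then have X0: "emeasure lborel X = 0" using X by (simp add: borel_compact)
  obtain O' where O': "open O'" "X \<subseteq> O'" "emeasure lborel (O' - X) < ennreal c"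
    using outer_regular_lborel [of X c] X c by (auto simp: borel_compact)
  have "emeasure lborel O' \<le> emeasure lborel (O' - X) + emeasure lborel X"
    using O' X by (intro order_trans [OF emeasure_mono emeasure_subadditive]) (auto simp: borel_compact)
  then have small: "emeasure lborel O' < ennreal c" using O'(3) X0 by simp
  obtain r where r: "r > 0" "(\<Union>x\<in>X. ball x r) \<subseteq> O'"
    using compact_subset_open_imp_ball_epsilon_subset [OF X O'(1,2)] by auto
  obtain Q0 where Q0: "(1 / 2 :: real) ^ Q0 < r / real CARD('d)"
    using real_arch_pow_inv [of "r / real CARD('d)" "1 / 2"] r by auto
  obtain Q where Q: "Q \<ge> Q0" and dyadic: "dyadic_content (real CARD('d)) X c Q"
    using count unfolding INFM_nat_le by blast
  define \<eta> :: real where "\<eta> = (1 / 2) ^ Q"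
  have \<eta>: "\<eta> > 0" "\<eta> * real CARD('d) < r"
  proof -
    have "\<eta> \<le> (1 / 2) ^ Q0" unfolding \<eta>_def using Q by (intro power_decreasing) auto
    then have "\<eta> < r / real CARD('d)" using Q0 by linarith
    then show "\<eta> * real CARD('d) < r" by (simp add: pos_less_divide_eq)
  qed (simp add: \<eta>_def)
  define cell where "cell = (\<lambda>z :: int^'d. grid_cell \<eta> (\<lambda>k. z $ k) :: (real^'d) set)"
  define I where "I = {z. cell z \<inter> X \<noteq> {}}"
  obtain b where b: "\<And>x. x \<in> X \<Longrightarrow> norm x \<le> b" using compact_imp_bounded [OF X] bounded_iff by metis
  have "I \<subseteq> (\<lambda>f. \<chi> k. f k) ` (PiE UNIV (\<lambda>_ :: 'd. {\<lfloor>- b / \<eta>\<rfloor>..\<lfloor>b / \<eta>\<rfloor>}))"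
  proof
    fix z assume "z \<in> I"
    then obtain x where x: "x \<in> X" "\<And>k. \<lfloor>x $ k / \<eta>\<rfloor> = z $ k" by (auto simp: I_def cell_def grid_cell_def)
    have "z $ k \<in> {\<lfloor>- b / \<eta>\<rfloor>..\<lfloor>b / \<eta>\<rfloor>}" for k
    proof -
      have "\<bar>x $ k\<bar> \<le> b" using component_le_norm_cart [of x k] b [OF x(1)] by linarith
      then have "- b \<le> x $ k" "x $ k \<le> b" by auto
      then have "- b / \<eta> \<le> x $ k / \<eta>" "x $ k / \<eta> \<le> b / \<eta>"
        using \<eta>(1) divide_right_mono [of "- b" "x $ k" \<eta>] divide_right_mono [of "x $ k" b \<eta>] by auto
      then show ?thesis unfolding x(2) [of k, symmetric] by (auto intro: floor_mono)
    qed
    then show "z \<in> (\<lambda>f. \<chi> k. f k) ` (PiE UNIV (\<lambda>_ :: 'd. {\<lfloor>- b / \<eta>\<rfloor>..\<lfloor>b / \<eta>\<rfloor>}))"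
      by (intro image_eqI [of _ _ "\<lambda>k. z $ k"]) (auto simp: vec_eq_iff)
  qed
  then have finI: "finite I" by (rule finite_subset) (intro finite_imageI finite_PiE, auto)
  have cover: "X \<subseteq> (\<Union>z\<in>I. cell z)"
  proof
    fix x assume "x \<in> X"
    moreover have "x \<in> cell (\<chi> k. \<lfloor>x $ k / \<eta>\<rfloor>)" by (simp add: cell_def grid_cell_def)
    ultimately show "x \<in> (\<Union>z\<in>I. cell z)" unfolding I_def by blast
  qed
  have "c \<le> real (card I) * \<eta> powr real CARD('d)"
    unfolding \<eta>_def
  proof (rule dyadic [unfolded dyadic_content_def, rule_format, OF finI cover])
    show "\<bar>x $ k - y $ k\<bar> \<le> (1 / 2) ^ Q" if "x \<in> cell z" "y \<in> cell z" for x y z k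
      using grid_cell_diff [OF \<eta>(1)] that by (simp add: cell_def \<eta>_def)
  qed
  then have le: "c \<le> real (card I) * \<eta> ^ CARD('d)"
    using \<eta>(1) by (simp add: powr_realpow)
  \<comment> \<open>Open boxes inside the half-open cells: they inherit disjointness and have an
    explicit volume.\<close>
  define bx where "bx = (\<lambda>z :: int^'d. box (\<chi> k. \<eta> * real_of_int (z $ k)) (\<chi> k. \<eta> * (real_of_int (z $ k) + 1)) :: (real^'d) set)"
  have bx_cell: "bx z \<subseteq> cell z" for z
  proof
    fix x assume x: "x \<in> bx z"
    have "\<lfloor>x $ k / \<eta>\<rfloor> = z $ k" for k
    proof (rule floor_unique)
      have "\<eta> * real_of_int (z $ k) < x $ k" "x $ k < \<eta> * (real_of_int (z $ k) + 1)"
        using x by (auto simp: bx_def mem_box_cart)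
      then show "of_int (z $ k) \<le> x $ k / \<eta>" "x $ k / \<eta> < of_int (z $ k) + 1"
        using \<eta>(1) by (simp_all add: pos_le_divide_eq pos_divide_less_eq mult.commute)
    qed
    then show "x \<in> cell z" by (simp add: cell_def grid_cell_def)
  qed
  have disj: "disjoint_family_on bx I"
  proof -
    have "z = z'" if "x \<in> cell z" "x \<in> cell z'" for x z z'
      using that by (auto simp: cell_def grid_cell_def vec_eq_iff)
    then show ?thesis using bx_cell unfolding disjoint_family_on_def by blast
  qed
  have vol: "emeasure lborel (bx z) = ennreal (\<eta> ^ CARD('d))" for z
  proof -
    let ?l = "(\<chi> k. \<eta> * real_of_int (z $ k)) :: real^'d" and ?u = "(\<chi> k. \<eta> * (real_of_int (z $ k) + 1)) :: real^'d"
    have *: "(?u - ?l) \<bullet> b = \<eta>" if "b \<in> Basis" for b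
      using that by (auto simp: Basis_vec_def inner_axis algebra_simps)
    have "emeasure lborel (bx z) = ennreal (\<Prod>b\<in>Basis. (?u - ?l) \<bullet> b)"
      unfolding bx_def
      by (rule emeasure_lborel_box) (use * \<eta>(1) in \<open>force simp: inner_diff_left\<close>)
    also have "(\<Prod>b\<in>Basis. (?u - ?l) \<bullet> b) = \<eta> ^ CARD('d)"
      using * by (simp add: DIM_cart)
    finally show ?thesis .
  qed
  have sub: "bx z \<subseteq> O'" if z: "z \<in> I" for z
  proof -
    obtain x where x: "x \<in> X" "x \<in> cell z" using z by (auto simp: I_def)
    have "y \<in> ball x r" if "y \<in> cell z" for y
    proof -
      have "dist x y \<le> (\<Sum>k\<in>UNIV. \<bar>(x - y) $ k\<bar>)" unfolding dist_norm by (rule norm_le_l1_cart)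
      also have "\<dots> \<le> (\<Sum>k\<in>(UNIV :: 'd set). \<eta>)"
        using grid_cell_diff [OF \<eta>(1)] x(2) that by (intro sum_mono) (auto simp: cell_def)
      also have "\<dots> < r" using \<eta>(2) by (simp add: mult.commute)
      finally show ?thesis by simp
    qed
    then show ?thesis using r(2) x(1) bx_cell [of z] by blast
  qed
  have "ennreal (real (card I) * \<eta> ^ CARD('d)) = (\<Sum>z\<in>I. emeasure lborel (bx z))"
    using \<eta>(1) by (simp add: vol ennreal_mult' ennreal_of_nat_eq_real_of_nat)
  also have "\<dots> = emeasure lborel (\<Union>z\<in>I. bx z)"
    using disj finI by (intro sum_emeasure) (auto simp: bx_def)
  also have "\<dots> \<le> emeasure lborel O'"
    using sub O'(1) by (intro emeasure_mono) auto
  also have "\<dots> < ennreal c" by (rule small)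
  finally show False using le c by (simp add: ennreal_less_iff)
qed

subsection \<open>Exponents and pressure\<close>

text \<open>Exponent of the coordinate \<open>k\<close> in \<open>phi_tau s \<tau>\<close>, for \<open>s\<close> at most the dimension.\<close>

definition texp :: "real \<Rightarrow> (nat \<Rightarrow> 'd::finite) \<Rightarrow> 'd \<Rightarrow> real" where
  "texp s \<tau> k = min 1 (max 0 (s - real (the_inv_into {..<CARD('d)} \<tau> k)))"

lemma texp_bounds: "0 \<le> texp s \<tau> k" "texp s \<tau> k \<le> 1"
  by (auto simp: texp_def)

lemma texp_mono: "s \<le> s' \<Longrightarrow> texp s \<tau> k \<le> texp s' \<tau> k"
  by (auto simp: texp_def)

lemma texp_nth: "\<tau> \<in> perms_of \<Longrightarrow> j < CARD('d) \<Longrightarrow> texp s \<tau> (\<tau> j :: 'd::finite) = min 1 (max 0 (s - real j))"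
  unfolding texp_def perms_of_def bij_betw_def by (simp add: the_inv_into_f_f)

lemma prod_perm:
  "\<tau> \<in> perms_of \<Longrightarrow> (\<Prod>k\<in>UNIV. f k) = (\<Prod>j<CARD('d). f (\<tau> j :: 'd::finite))"
  unfolding perms_of_def by (auto intro: prod.reindex_bij_betw [symmetric])

lemma sum_perm:
  "\<tau> \<in> perms_of \<Longrightarrow> (\<Sum>k\<in>UNIV. f k) = (\<Sum>j<CARD('d). f (\<tau> j :: 'd::finite))"
  unfolding perms_of_def by (auto intro: sum.reindex_bij_betw [symmetric])

lemma sum_clamp: "0 \<le> s \<Longrightarrow> (\<Sum>j<n. min 1 (max 0 (s - real j))) = min s (real n)"
  by (induction n) auto

lemma sum_texp:
  assumes "\<tau> \<in> perms_of" "0 \<le> s" "s \<le> real CARD('d)"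
  shows "(\<Sum>k\<in>UNIV. texp s \<tau> (k :: 'd::finite)) = s"
  using assms by (simp add: sum_perm texp_nth sum_clamp)

text \<open>With \<open>m\<close> the floor of \<open>s\<close>, the first \<open>m\<close>
  coordinates get exponent 1, the next one the fractional part, the rest 0; entries are nonzero
  because \<open>0 powr 0 = 0\<close>. As \<open>\<tau>\<close> starts at index 0, the fractional
  coordinate has index \<open>nat \<lceil>s\<rceil> - 1\<close>, which is \<open>m\<close> when
  \<open>s\<close> is not an integer.\<close>

lemma phi_tau_texp:
  fixes a :: "'d::finite \<Rightarrow> real"
  assumes \<tau>: "\<tau> \<in> perms_of" and s: "0 \<le> s" "s \<le> real CARD('d)" and a: "\<And>k. a k \<noteq> 0"
  shows "phi_tau s \<tau> a = (\<Prod>k\<in>UNIV. \<bar>a k\<bar> powr texp s \<tau> k)"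
proof -
  define m where "m = nat \<lfloor>s\<rfloor>"
  have m: "real m \<le> s" "s < real m + 1" "real_of_int \<lfloor>s\<rfloor> = real m" using s(1) by (auto simp: m_def)
  have prefix: "(\<Prod>j<n. \<bar>a (\<tau> j)\<bar> powr min 1 (max 0 (s - real j))) = (\<Prod>j<n. \<bar>a (\<tau> j)\<bar>)" if "n \<le> m" for n
    using that m a by (intro prod.cong refl) auto
  have full: "(\<Prod>j<n. \<bar>a (\<tau> j)\<bar> powr min 1 (max 0 (s - real j)))
      = (\<Prod>j<m. \<bar>a (\<tau> j)\<bar>) * \<bar>a (\<tau> m)\<bar> powr (s - real m)" if "m < n" for n
    using that
  proof (induction n)
    case (Suc n)
    show ?case
    proof (cases "m < n")
      case True
      then show ?thesis using Suc.IH m a by simp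
    next
      case False
      then have "n = m" using Suc.prems by simp
      then show ?thesis using prefix [of m] m by simp
    qed
  qed simp
  have prod: "(\<Prod>k\<in>UNIV. \<bar>a k\<bar> powr texp s \<tau> k) = (\<Prod>j<CARD('d). \<bar>a (\<tau> j)\<bar> powr min 1 (max 0 (s - real j)))"
    by (simp add: prod_perm [OF \<tau>] texp_nth [OF \<tau>])
  show ?thesis
  proof (cases "m < CARD('d)")
    case True
    show ?thesis
    proof (cases "s = real m")
      case True
      then show ?thesis
        unfolding prod full [OF \<open>m < CARD('d)\<close>] using s m a by (simp add: phi_tau_def m_def [symmetric])
    next
      case False
      then have "\<lceil>s\<rceil> = \<lfloor>s\<rfloor> + 1" using m by linarith
      then have "nat \<lceil>s\<rceil> - 1 = m" using s(1) by (simp add: m_def nat_add_distrib)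
      then show ?thesis
        unfolding prod full [OF \<open>m < CARD('d)\<close>] using s m False by (simp add: phi_tau_def m_def [symmetric])
    qed
  next
    case False
    then have "m = CARD('d)" "s = real m" using m s by linarith+
    moreover have "phi_tau s \<tau> a = (\<Prod>j<m. \<bar>a (\<tau> j)\<bar>)"
      unfolding phi_tau_def m_def [symmetric]
      by (subst if_P, rule s(2), subst if_P, simp_all add: \<open>s = real m\<close>)
    ultimately show ?thesis
      unfolding prod using prefix [of "CARD('d)"] by simp
  qed
qed

text \<open>\<open>perms_of\<close> itself is infinite as soon as the dimension exceeds 1, since the
  values of \<open>\<tau>\<close> beyond the dimension are free; finite maxima and finite
  intersections of almost sure events therefore go through the exponent vectors.\<close>

lemma finite_texp: "finite (texp s ` (perms_of :: (nat \<Rightarrow> 'd::finite) set))"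
proof (rule finite_subset)
  let ?V = "(\<lambda>j. min 1 (max 0 (s - real j))) ` {..<CARD('d)}"
  show "texp s ` (perms_of :: (nat \<Rightarrow> 'd) set) \<subseteq> PiE UNIV (\<lambda>_. ?V)"
  proof (intro subsetI PiE_I; elim imageE; hypsubst?)
    fix \<tau> :: "nat \<Rightarrow> 'd" and k assume "\<tau> \<in> perms_of"
    then have "k \<in> \<tau> ` {..<CARD('d)}" by (simp add: perms_of_def bij_betw_def)
    then obtain j where "j < CARD('d)" "k = \<tau> j" by blast
    then show "texp s \<tau> k \<in> ?V" using texp_nth [OF \<open>\<tau> \<in> perms_of\<close>, of j s] by auto
  qed auto
  show "finite (PiE UNIV (\<lambda>_ :: 'd. ?V))" by (intro finite_PiE) auto
qed

lemma perm_of_list: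
  assumes "distinct xs" "set xs = (UNIV :: 'd::finite set)"
  shows "(\<lambda>j. xs ! j) \<in> perms_of" "length xs = CARD('d)"
proof -
  show l: "length xs = CARD('d)" using assms distinct_card by fastforce
  show "(\<lambda>j. xs ! j) \<in> perms_of"
    unfolding perms_of_def using bij_betw_nth [OF assms(1) refl refl] assms(2) l by simp
qed

lemma perms_of_nonempty: "(perms_of :: (nat \<Rightarrow> 'd::finite) set) \<noteq> {}"
proof -
  obtain xs :: "'d list" where "set xs = UNIV" "distinct xs"
    using finite_distinct_list [of "UNIV :: 'd set"] by auto
  then show ?thesis using perm_of_list [of xs] by blast
qed

text \<open>A box whose sides exceed \<open>\<delta>\<close> in at most \<open>\<lfloor>s\<rfloor>\<close> directions while at least \<open>\<lfloor>s\<rfloor> + 1\<close>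
  sides are comparable to \<open>\<delta>\<close> is covered by about \<open>\<delta> powr - s * phi_tau s \<tau>\<close> cubes of side \<open>\<delta>\<close>,
  where \<open>\<tau>\<close> lists the long sides first.\<close>

lemma box_count_le_texp:
  fixes a :: "'d::finite \<Rightarrow> real"
  assumes s: "0 < s" "s < real CARD('d)" and \<delta>: "0 < \<delta>" and lo: "0 < lo" "lo \<le> 1"
    and a: "\<And>k. 0 < a k"
    and big: "card {k. a k > \<delta>} \<le> nat \<lfloor>s\<rfloor>" and mid: "nat \<lfloor>s\<rfloor> < card {k. a k \<ge> lo * \<delta>}"
  shows "\<exists>e\<in>texp s ` perms_of. (\<Prod>k\<in>UNIV. max 1 (a k / \<delta>))
    \<le> (1 / lo) ^ CARD('d) * \<delta> powr - s * (\<Prod>k\<in>UNIV. a k powr e k)"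
proof -
  define m where "m = nat \<lfloor>s\<rfloor>"
  have m: "real m \<le> s" "s < real m + 1" using s(1) by (auto simp: m_def)
  let ?S = "{k. a k > \<delta>}" and ?S' = "{k. a k \<ge> lo * \<delta>}"
  have SS: "?S \<subseteq> ?S'"
  proof -
    have "lo * \<delta> \<le> \<delta>" using lo \<delta> by (simp add: mult_left_le_one_le)
    then show ?thesis by auto
  qed
  obtain xs where xs: "set xs = ?S" "distinct xs" using finite_distinct_list [of ?S] by auto
  obtain ys where ys: "set ys = ?S' - ?S" "distinct ys" using finite_distinct_list [of "?S' - ?S"] by auto
  obtain zs where zs: "set zs = - ?S'" "distinct zs" using finite_distinct_list [of "- ?S'"] by auto
  \<comment> \<open>Long sides first, then sides comparable to \<open>\<delta>\<close>, then short
    ones. The two cardinality conditions put position \<open>nat \<lfloor>s\<rfloor>\<close>, the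
    only one that may carry a fractional exponent, into the middle group.\<close>
  define l where "l = xs @ ys @ zs"
  define \<tau> where "\<tau> = (\<lambda>j. l ! j)"
  have l: "distinct l" "set l = UNIV" using xs ys zs SS by (auto simp: l_def)
  have \<tau>: "\<tau> \<in> perms_of" and len: "length l = CARD('d)" using perm_of_list [OF l] by (auto simp: \<tau>_def)
  have lx: "length xs \<le> m" using big distinct_card [OF xs(2)] by (simp add: xs(1) m_def)
  have "length (xs @ ys) = card ?S'"
  proof -
    have "distinct (xs @ ys)" "set (xs @ ys) = ?S'" using xs ys SS by auto
    then show ?thesis using distinct_card by fastforce
  qed
  then have lxy: "m < length (xs @ ys)" using mid by (simp add: m_def)
  \<comment> \<open>Long sides have exponent 1 and short sides exponent 0, so these factors are
    exact; a middle side lies between \<open>lo * \<delta>\<close> and \<open>\<delta>\<close>,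
    where any exponent in [0,1] costs at most \<open>1 / lo\<close>.\<close>
  have each: "max 1 (a k / \<delta>) \<le> (1 / lo) * (a k / \<delta>) powr texp s \<tau> k" for k
  proof -
    obtain j where j: "j < CARD('d)" "k = \<tau> j"
      using l(2) len by (metis UNIV_I \<tau>_def in_set_conv_nth)
    have e: "texp s \<tau> k = min 1 (max 0 (s - real j))" unfolding j(2) by (rule texp_nth [OF \<tau> j(1)])
    have ak: "0 < a k / \<delta>" using a \<delta> by simp
    consider "j < length xs" | "length xs \<le> j" "j < length (xs @ ys)" | "length (xs @ ys) \<le> j" by linarith
    then show ?thesis
    proof cases
      case 1
      then have "k \<in> ?S" using xs(1) nth_mem [of j xs] by (simp add: j(2) \<tau>_def l_def nth_append)
      then have "1 < a k / \<delta>" using \<delta> by simp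
      then have max: "max 1 (a k / \<delta>) = a k / \<delta>" by simp
      have "texp s \<tau> k = 1" using e 1 lx m by auto
      then have e1: "(a k / \<delta>) powr texp s \<tau> k = a k / \<delta>" using ak by (simp only: powr_one less_imp_le)
      have "1 * (a k / \<delta>) \<le> (1 / lo) * (a k / \<delta>)" using lo ak by (intro mult_right_mono) auto
      then show ?thesis unfolding max e1 by simp
    next
      case 2
      then have "k \<in> ?S' - ?S"
        unfolding ys(1) [symmetric] j(2) \<tau>_def l_def
        by (metis (no_types, lifting) add_diff_inverse_nat add_less_cancel_left append.assoc leD length_append nth_append nth_mem)
      then have k: "lo \<le> a k / \<delta>" "a k / \<delta> \<le> 1" using \<delta> by (auto simp: pos_le_divide_eq)
      have "lo \<le> lo powr texp s \<tau> k"
        using powr_mono' [of "texp s \<tau> k" 1 lo] texp_bounds [of s \<tau> k] lo by simp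
      also have "\<dots> \<le> (a k / \<delta>) powr texp s \<tau> k" using k lo texp_bounds(1) by (intro powr_mono2) auto
      finally show ?thesis using k lo by (simp add: field_simps)
    next
      case 3
      then have "\<tau> j = zs ! (j - length (xs @ ys))" unfolding \<tau>_def l_def append_assoc [symmetric] nth_append by simp
      moreover have "j - length (xs @ ys) < length zs" using 3 j(1) len by (simp add: l_def)
      ultimately have "k \<in> - ?S'" using zs(1) nth_mem [of "j - length (xs @ ys)" zs] j(2) by simp
      then have "k \<notin> ?S" using SS by blast
      then have "a k / \<delta> \<le> 1" using \<delta> by (simp add: not_less)
      moreover have "texp s \<tau> k = 0" using e 3 lxy m by auto
      ultimately show ?thesis using lo ak a [of k] \<delta> by (simp add: field_simps)
    qed
  qed
  have "(\<Prod>k\<in>UNIV. max 1 (a k / \<delta>)) \<le> (\<Prod>k\<in>UNIV. (1 / lo) * (a k / \<delta>) powr texp s \<tau> k)"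
    using each by (intro prod_mono) (auto intro: order_trans [OF zero_le_one])
  also have "\<dots> = (1 / lo) ^ CARD('d) * ((\<Prod>k\<in>UNIV. a k powr texp s \<tau> k) / (\<Prod>k\<in>UNIV. \<delta> powr texp s \<tau> k))"
    using a \<delta> by (simp add: prod.distrib powr_divide less_imp_le prod_dividef power_one_over)
  also have "(\<Prod>k\<in>UNIV. \<delta> powr texp s \<tau> k) = \<delta> powr (\<Sum>k\<in>UNIV. texp s \<tau> k)"
    using \<delta> by (simp add: powr_sum)
  also have "(\<Sum>k\<in>UNIV. texp s \<tau> k) = s" using \<tau> s by (intro sum_texp) auto
  also have "(1 / lo) ^ CARD('d) * ((\<Prod>k\<in>UNIV. a k powr texp s \<tau> k) / \<delta> powr s)
      = (1 / lo) ^ CARD('d) * \<delta> powr - s * (\<Prod>k\<in>UNIV. a k powr texp s \<tau> k)"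
    by (simp add: powr_minus field_simps)
  finally show ?thesis using \<tau> by blast
qed

context random_sponge
begin

definition words :: "nat \<Rightarrow> nat list set" where
  "words n = {u\<in>fin_words N. length u = n}"

text \<open>The pressure as a function of the exponent vector: for \<open>s\<close> at most the
  dimension, its value at \<open>texp s \<tau>\<close> is the sum whose maximum over
  \<open>\<tau>\<close> is \<open>pressure\<close> (\<open>phi_tau_integral\<close>).\<close>

definition press :: "('d \<Rightarrow> real) \<Rightarrow> real" where
  "press e = (\<Sum>i=1..N. mean_weight e [i])"

lemma words_eq: "words n = {u. set u \<subseteq> {1..N} \<and> length u = n}"
  by (auto simp: words_def fin_words_def)

lemma finite_words: "finite (words n)"
  unfolding words_eq by (rule finite_lists_length_eq) simp

lemma sum_words_Suc: "(\<Sum>u\<in>words (Suc n). f u) = (\<Sum>i=1..N. \<Sum>u\<in>words n. f (i # u))"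
proof -
  have "words (Suc n) = (\<lambda>(i, u). i # u) ` ({1..N} \<times> words n)"
    unfolding words_eq by (auto simp: length_Suc_conv image_iff)
  then have "(\<Sum>u\<in>words (Suc n). f u) = (\<Sum>(i, u)\<in>{1..N} \<times> words n. f (i # u))"
    by (simp add: sum.reindex inj_on_def case_prod_unfold)
  then show ?thesis by (simp add: sum.cartesian_product)
qed

lemma sum_words_mean_weight: "(\<Sum>u\<in>words n. mean_weight e u) = press e ^ n"
proof (induction n)
  case 0
  have "words 0 = {[]}" by (auto simp: words_def)
  then show ?case by simp
next
  case (Suc n)
  have "mean_weight e (i # u) = mean_weight e [i] * mean_weight e u" for i u
    using mean_weight_append [of e "[i]" u] by simp
  then have "(\<Sum>u\<in>words (Suc n). mean_weight e u) = (\<Sum>i=1..N. \<Sum>u\<in>words n. mean_weight e [i] * mean_weight e u)"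
    unfolding sum_words_Suc by (intro sum.cong refl)
  also have "\<dots> = press e * (\<Sum>u\<in>words n. mean_weight e u)"
    unfolding press_def by (rule sum_product [symmetric])
  finally show ?case by (simp add: Suc.IH)
qed

lemma moment_le:
  assumes "i \<in> {1..N}" "0 \<le> s" "s \<le> s'"
  shows "moment k s' i \<le> hi powr (s' - s) * moment k s i"
proof -
  have "moment k s' i \<le> (\<integral>\<omega>. hi powr (s' - s) * \<bar>\<alpha> k [i] \<omega>\<bar> powr s \<partial>M)"
    unfolding moment_def
  proof (rule integral_mono)
    show "integrable M (\<lambda>\<omega>. \<bar>\<alpha> k [i] \<omega>\<bar> powr s')" using assms by (intro moment_integrable) auto
    show "integrable M (\<lambda>\<omega>. hi powr (s' - s) * \<bar>\<alpha> k [i] \<omega>\<bar> powr s)"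
      using assms by (intro integrable_mult_right moment_integrable) auto
    fix \<omega>
    have "\<bar>\<alpha> k [i] \<omega>\<bar> powr s' = \<bar>\<alpha> k [i] \<omega>\<bar> powr (s' - s) * \<bar>\<alpha> k [i] \<omega>\<bar> powr s"
      by (simp add: powr_add [symmetric])
    also have "\<dots> \<le> hi powr (s' - s) * \<bar>\<alpha> k [i] \<omega>\<bar> powr s"
      using assms env.a_le by (intro mult_right_mono powr_mono2) auto
    finally show "\<bar>\<alpha> k [i] \<omega>\<bar> powr s' \<le> hi powr (s' - s) * \<bar>\<alpha> k [i] \<omega>\<bar> powr s" .
  qed
  then show ?thesis by (simp add: moment_def)
qed

text \<open>Every contraction is at most \<open>hi < 1\<close>, so raising the exponents by a total
  of \<open>h\<close> multiplies the pressure by at most \<open>hi powr h\<close>. It is used on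
  both sides of the root \<open>s0\<close>: below it the pressure exceeds 1, above it drops under
  1.\<close>

lemma press_le:
  assumes e: "\<And>k. 0 \<le> e k" "\<And>k. e k \<le> e' k"
  shows "press e' \<le> hi powr ((\<Sum>k\<in>UNIV. e' k) - (\<Sum>k\<in>UNIV. e k)) * press e"
proof -
  have "mean_weight e' [i] \<le> hi powr ((\<Sum>k\<in>UNIV. e' k) - (\<Sum>k\<in>UNIV. e k)) * mean_weight e [i]" if i: "i \<in> {1..N}" for i
  proof -
    have "mean_weight e' [i] \<le> (\<Prod>k\<in>UNIV. hi powr (e' k - e k) * moment k (e k) i)"
      unfolding mean_weight_def using i e order_trans [OF e]
      by (intro prod_mono) (auto intro!: moment_le less_imp_le [OF moment_pos])
    also have "\<dots> = (\<Prod>k\<in>UNIV. hi powr (e' k - e k)) * mean_weight e [i]"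
      by (simp add: prod.distrib mean_weight_def)
    also have "(\<Prod>k\<in>UNIV. hi powr (e' k - e k)) = hi powr (\<Sum>k\<in>UNIV. e' k - e k)"
      using env.hi_pos by (simp add: powr_sum)
    also have "(\<Sum>k\<in>UNIV. e' k - e k) = (\<Sum>k\<in>UNIV. e' k) - (\<Sum>k\<in>UNIV. e k)"
      by (rule sum_subtractf)
    finally show ?thesis .
  qed
  then show ?thesis unfolding press_def sum_distrib_left by (intro sum_mono) auto
qed

lemma mean_weight_single_nonneg: "i \<in> {1..N} \<Longrightarrow> (\<And>k. 0 \<le> e k) \<Longrightarrow> 0 \<le> mean_weight e [i]"
  by (rule mean_weight_nonneg) auto

lemma press_nonneg: "(\<And>k. 0 \<le> e k) \<Longrightarrow> 0 \<le> press e"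
  unfolding press_def by (intro sum_nonneg mean_weight_single_nonneg) auto

lemma integral_weight_single:
  assumes "i \<in> {1..N}" "\<And>k. 0 \<le> e k"
  shows "(\<integral>\<omega>. (\<Prod>k\<in>UNIV. \<bar>\<alpha> k [i] \<omega>\<bar> powr e k) \<partial>M) = mean_weight e [i]"
proof -
  have "(\<integral>\<omega>. weight e [] [i] \<omega> \<partial>M) = enn2real (\<integral>\<^sup>+\<omega>. ennreal (weight e [] [i] \<omega>) \<partial>M)"
    using assms by (intro integral_eq_nn_integral weight_measurable) (auto simp: weight_nonneg)
  also have "\<dots> = mean_weight e [i]"
    using assms by (simp add: nn_weight mean_weight_nonneg)
  finally show ?thesis by (simp add: weight_def)
qed

section \<open>Upper bound by stopped cylinders\<close>

lemma AE_total_weight: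
  assumes e: "\<And>k. 0 \<le> e k" and sub: "press e < 1"
  shows "AE \<omega> in M. \<exists>C. \<forall>n. (\<Sum>j\<le>n. \<Sum>u\<in>words j. weight e [] u \<omega>) \<le> C"
proof -
  let ?W = "\<lambda>\<omega>. \<Sum>j. \<Sum>u\<in>words j. ennreal (weight e [] u \<omega>)"
  have meas: "weight e [] u \<in> borel_measurable M" if "u \<in> words j" for u j
    using that by (intro weight_measurable) (auto simp: words_def)
  have meas': "(\<lambda>\<omega>. \<Sum>u\<in>words j. ennreal (weight e [] u \<omega>)) \<in> borel_measurable M" for j
    using meas by (intro borel_measurable_sum) auto
  have p0: "0 \<le> press e" using e by (rule press_nonneg)
  have "(\<integral>\<^sup>+\<omega>. ?W \<omega> \<partial>M) = (\<Sum>j. \<integral>\<^sup>+\<omega>. (\<Sum>u\<in>words j. ennreal (weight e [] u \<omega>)) \<partial>M)"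
    by (rule nn_integral_suminf) (rule meas')
  also have "\<dots> = (\<Sum>j. ennreal (press e ^ j))"
  proof (intro suminf_cong)
    fix j
    have "(\<integral>\<^sup>+\<omega>. (\<Sum>u\<in>words j. ennreal (weight e [] u \<omega>)) \<partial>M) = (\<Sum>u\<in>words j. \<integral>\<^sup>+\<omega>. ennreal (weight e [] u \<omega>) \<partial>M)"
      using meas by (intro nn_integral_sum) auto
    also have "\<dots> = (\<Sum>u\<in>words j. ennreal (mean_weight e u))"
      using e by (intro sum.cong refl nn_weight) (auto simp: words_def)
    also have "\<dots> = ennreal (press e ^ j)"
      using e by (subst sum_ennreal) (auto simp: words_def mean_weight_nonneg sum_words_mean_weight [symmetric])
    finally show "(\<integral>\<^sup>+\<omega>. (\<Sum>u\<in>words j. ennreal (weight e [] u \<omega>)) \<partial>M) = ennreal (press e ^ j)" .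
  qed
  also have "\<dots> = ennreal (\<Sum>j. press e ^ j)"
    using p0 sub by (intro suminf_ennreal2 summable_geometric) auto
  finally have "(\<integral>\<^sup>+\<omega>. ?W \<omega> \<partial>M) \<noteq> \<infinity>" by simp
  then have "AE \<omega> in M. ?W \<omega> \<noteq> \<infinity>"
    using meas' by (intro nn_integral_noteq_infinite) auto
  then show ?thesis
  proof (rule AE_mp, intro AE_I2 impI)
    fix \<omega> assume fin: "?W \<omega> \<noteq> \<infinity>"
    show "\<exists>C. \<forall>n. (\<Sum>j\<le>n. \<Sum>u\<in>words j. weight e [] u \<omega>) \<le> C"
    proof (intro exI allI)
      fix n
      have "ennreal (\<Sum>j\<le>n. \<Sum>u\<in>words j. weight e [] u \<omega>) = (\<Sum>j\<le>n. \<Sum>u\<in>words j. ennreal (weight e [] u \<omega>))"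
        by (simp add: weight_nonneg sum_nonneg)
      also have "\<dots> \<le> ?W \<omega>" by (intro sum_le_suminf) auto
      also have "\<dots> = ennreal (enn2real (?W \<omega>))" using fin by (simp add: less_top)
      finally show "(\<Sum>j\<le>n. \<Sum>u\<in>words j. weight e [] u \<omega>) \<le> enn2real (?W \<omega>)"
        by (simp add: ennreal_le_iff)
    qed
  qed
qed

lemma sponge_in_box:
  assumes "w \<in> inf_words N"
  shows "\<bar>sponge_proj \<alpha> t \<omega> w $ k - P k [] (prefix_word w n) 0 \<omega>\<bar> \<le> env.Rb * \<bar>A k [] (prefix_word w n) \<omega>\<bar>"
proof -
  let ?x = "proj (\<lambda>u. \<alpha> k u \<omega>) (\<lambda>i. t i $ k) ([] @ prefix_word w n) (\<lambda>j. w (n + j))"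
  have "sponge_proj \<alpha> t \<omega> w $ k - P k [] (prefix_word w n) 0 \<omega> = A k [] (prefix_word w n) \<omega> * (?x - 0)"
    unfolding sponge_proj_nth env.proj_prefix [of k \<omega> "[]" w n] by (rule ppt_diff)
  also have "\<bar>\<dots>\<bar> = \<bar>?x\<bar> * \<bar>A k [] (prefix_word w n) \<omega>\<bar>" by (simp add: abs_mult)
  also have "\<dots> \<le> env.Rb * \<bar>A k [] (prefix_word w n) \<omega>\<bar>"
    by (intro mult_right_mono env.proj_le) auto
  finally show ?thesis .
qed

lemma small_covers_trivial:
  assumes s: "real CARD('d) \<le> s"
  shows "small_covers s (sponge N \<alpha> t \<omega>)"
  unfolding small_covers_def
proof (intro exI conjI allI impI)
  show "0 < (2 * env.Rb * real CARD('d) + 2) ^ CARD('d)"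
    using env.Rb_nonneg by (intro zero_less_power add_nonneg_pos) auto
  fix \<delta> :: real assume \<delta>: "0 < \<delta>" "\<delta> \<le> 1 / 2"
  have R: "0 \<le> env.Rb" by (rule env.Rb_nonneg)
  have "real (covering_number (sponge N \<alpha> t \<omega>) \<delta>) \<le> (\<Sum>u\<in>{()}. \<Prod>k\<in>(UNIV :: 'd set). 2 * env.Rb * real CARD('d) / \<delta> + 2)"
  proof (rule covering_number_le_boxes [OF \<delta>(1), where p = "\<lambda>_ _. 0"])
    fix x assume "x \<in> sponge N \<alpha> t \<omega>"
    then obtain w where "x = sponge_proj \<alpha> t \<omega> w" by (auto simp: sponge_def)
    then show "\<exists>u\<in>{()}. \<forall>k. \<bar>x $ k - 0\<bar> \<le> env.Rb" by (simp add: sponge_proj_nth env.proj_le)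
  qed (use R in auto)
  also have "\<dots> = (2 * env.Rb * real CARD('d) / \<delta> + 2) ^ CARD('d)" by simp
  also have "\<dots> \<le> ((2 * env.Rb * real CARD('d) + 2) * (1 / \<delta>)) ^ CARD('d)"
    using R \<delta> by (intro power_mono) (auto simp: field_simps)
  also have "\<dots> = (2 * env.Rb * real CARD('d) + 2) ^ CARD('d) * (1 / \<delta>) ^ CARD('d)"
    by (rule power_mult_distrib)
  also have "(1 / \<delta>) ^ CARD('d) = \<delta> powr - real CARD('d)"
    using \<delta> by (simp add: powr_minus powr_realpow power_one_over inverse_eq_divide)
  also have "(2 * env.Rb * real CARD('d) + 2) ^ CARD('d) * \<delta> powr - real CARD('d)
      \<le> (2 * env.Rb * real CARD('d) + 2) ^ CARD('d) * \<delta> powr - s"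
    using s \<delta> R by (intro mult_left_mono powr_mono') auto
  finally show "real (covering_number (sponge N \<alpha> t \<omega>) \<delta>) \<le> (2 * env.Rb * real CARD('d) + 2) ^ CARD('d) * \<delta> powr - s" .
qed

lemma AE_covering_number_le:
  assumes s: "0 < s" "s < real CARD('d)" and sub: "\<And>\<tau>. \<tau> \<in> perms_of \<Longrightarrow> press (texp s \<tau>) < 1"
  shows "AE \<omega> in M. small_covers s (sponge N \<alpha> t \<omega>)"
proof -
  let ?E = "texp s ` (perms_of :: (nat \<Rightarrow> 'd) set)"
  have "AE \<omega> in M. \<forall>e\<in>?E. \<exists>C. \<forall>n. (\<Sum>j\<le>n. \<Sum>u\<in>words j. weight e [] u \<omega>) \<le> C"
    using finite_texp texp_bounds sub by (intro AE_finite_allI AE_total_weight) auto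
  then show ?thesis
  proof (rule AE_mp, intro AE_I2 impI)
    fix \<omega> assume "\<forall>e\<in>?E. \<exists>C. \<forall>n. (\<Sum>j\<le>n. \<Sum>u\<in>words j. weight e [] u \<omega>) \<le> C"
    then obtain C where C: "\<And>e n. e \<in> ?E \<Longrightarrow> (\<Sum>j\<le>n. \<Sum>u\<in>words j. weight e [] u \<omega>) \<le> C e"
      by metis
    define W where "W = (\<Sum>e\<in>?E. C e)"
    let ?c = "(2 * env.Rb * real CARD('d) + 2) ^ CARD('d) * (1 / lo) ^ CARD('d)"
    have R: "0 \<le> env.Rb" by (rule env.Rb_nonneg)
    have c: "0 < ?c" using R env.lo by (simp add: add_nonneg_pos)
    have lo1: "lo \<le> 1" using env.lo_le_hi env.hi by simp
    have "real (covering_number (sponge N \<alpha> t \<omega>) \<delta>) \<le> (?c * \<bar>W\<bar> + 1) * \<delta> powr - s"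
      if \<delta>: "0 < \<delta>" "\<delta> \<le> 1 / 2" for \<delta>
    proof -
      have "(\<lambda>n. hi ^ n) \<longlonglongrightarrow> 0" using env.hi env.hi_pos by (intro LIMSEQ_realpow_zero) auto
      then have "\<forall>\<^sub>F n in sequentially. hi ^ n < \<delta>" using \<delta>(1) by (rule order_tendstoD(2))
      then obtain n1 where n1: "hi ^ n1 < \<delta>" by (auto simp: eventually_sequentially)
      \<comment> \<open>The stopping rule. Its second half is what \<open>box_count_le_texp\<close>
        needs; it holds automatically at the first prefix that satisfies the first half.\<close>
      define good where "good = (\<lambda>u. card {k. \<bar>A k [] u \<omega>\<bar> > \<delta>} \<le> nat \<lfloor>s\<rfloor> \<and>
          nat \<lfloor>s\<rfloor> < card {k. \<bar>A k [] u \<omega>\<bar> \<ge> lo * \<delta>})"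
      define F where "F = {u\<in>(\<Union>j\<le>n1. words j). good u}"
      have fin: "finite F" unfolding F_def using finite_words by auto
      have floor: "nat \<lfloor>s\<rfloor> < CARD('d)" using s by linarith
      have stop: "\<exists>n\<le>n1. good (prefix_word w n)" for w
      proof -
        let ?P = "\<lambda>n. card {k. \<bar>A k [] (prefix_word w n) \<omega>\<bar> > \<delta>} \<le> nat \<lfloor>s\<rfloor>"
        have "\<bar>A k [] (prefix_word w n1) \<omega>\<bar> \<le> \<delta>" for k
          using env.cprod_le [of k \<omega> "[]" "prefix_word w n1"] n1 by simp
        then have "{k. \<bar>A k [] (prefix_word w n1) \<omega>\<bar> > \<delta>} = {}" by (auto simp: not_less)
        then have P1: "?P n1" by simp
        define n where "n = (LEAST n. ?P n)"
        have Pn: "?P n" and n: "n \<le> n1" unfolding n_def using P1 by (rule LeastI, rule Least_le)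
        \<comment> \<open>At the empty word all sides equal 1, which exceeds
          \<open>\<delta>\<close>, and \<open>nat \<lfloor>s\<rfloor>\<close> is below the
          dimension; so there is a previous prefix, with too many long sides, and one more letter
          multiplies each of them by at least \<open>lo\<close>.\<close>
        have "n \<noteq> 0"
        proof
          assume "n = 0"
          moreover have "{k :: 'd. \<bar>A k [] (prefix_word w 0) \<omega>\<bar> > \<delta>} = UNIV" using \<delta> by simp
          ultimately show False using Pn floor by simp
        qed
        then obtain n' where n': "n = Suc n'" by (cases n) auto
        have "\<not> ?P n'" using not_less_Least [of n' ?P] n' by (simp add: n_def)
        then have "nat \<lfloor>s\<rfloor> < card {k. \<bar>A k [] (prefix_word w n') \<omega>\<bar> > \<delta>}" by simp
        also have "\<dots> \<le> card {k. \<bar>A k [] (prefix_word w n) \<omega>\<bar> \<ge> lo * \<delta>}"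
        proof (intro card_mono subsetI)
          fix k assume "k \<in> {k. \<bar>A k [] (prefix_word w n') \<omega>\<bar> > \<delta>}"
          then have "\<delta> * lo \<le> \<bar>A k [] (prefix_word w n') \<omega>\<bar> * \<bar>\<alpha> k (prefix_word w n' @ [w n']) \<omega>\<bar>"
            using env.a_ge env.lo by (intro mult_mono) auto
          then show "k \<in> {k. \<bar>A k [] (prefix_word w n) \<omega>\<bar> \<ge> lo * \<delta>}"
            by (simp add: n' prefix_word_Suc cprod_append abs_mult mult.commute)
        qed simp
        finally have "good (prefix_word w n)" using Pn by (simp add: good_def)
        then show ?thesis using n by blast
      qed
      have "real (covering_number (sponge N \<alpha> t \<omega>) \<delta>)
          \<le> (\<Sum>u\<in>F. \<Prod>k\<in>UNIV. 2 * (env.Rb * \<bar>A k [] u \<omega>\<bar>) * real CARD('d) / \<delta> + 2)"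
      proof (rule covering_number_le_boxes [OF \<delta>(1) fin, where p = "\<lambda>u k. P k [] u 0 \<omega>"])
        show "0 \<le> env.Rb * \<bar>A k [] u \<omega>\<bar>" for u k using R by simp
        fix x assume "x \<in> sponge N \<alpha> t \<omega>"
        then obtain w where w: "w \<in> inf_words N" "x = sponge_proj \<alpha> t \<omega> w" by (auto simp: sponge_def)
        obtain n where "n \<le> n1" "good (prefix_word w n)" using stop by blast
        then have "prefix_word w n \<in> F" using w(1) by (auto simp: F_def words_def prefix_word_in)
        then show "\<exists>u\<in>F. \<forall>k. \<bar>x $ k - P k [] u 0 \<omega>\<bar> \<le> env.Rb * \<bar>A k [] u \<omega>\<bar>"
          using sponge_in_box [OF w(1)] w(2) by blast
      qed
      also have "\<dots> \<le> (\<Sum>u\<in>F. ?c * \<delta> powr - s * (\<Sum>e\<in>?E. weight e [] u \<omega>))"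
      proof (rule sum_mono)
        fix u assume "u \<in> F"
        then have "good u" by (simp add: F_def)
        then obtain e where e: "e \<in> ?E" "(\<Prod>k\<in>UNIV. max 1 (\<bar>A k [] u \<omega>\<bar> / \<delta>))
            \<le> (1 / lo) ^ CARD('d) * \<delta> powr - s * (\<Prod>k\<in>UNIV. \<bar>A k [] u \<omega>\<bar> powr e k)"
          using box_count_le_texp [OF s \<delta>(1) env.lo lo1, of "\<lambda>k. \<bar>A k [] u \<omega>\<bar>"] env.cprod_nonzero
          unfolding good_def by auto
        have "(\<Prod>k\<in>UNIV. 2 * (env.Rb * \<bar>A k [] u \<omega>\<bar>) * real CARD('d) / \<delta> + 2)
            \<le> (\<Prod>k\<in>(UNIV :: 'd set). (2 * env.Rb * real CARD('d) + 2) * max 1 (\<bar>A k [] u \<omega>\<bar> / \<delta>))"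
        proof (intro prod_mono conjI)
          fix k
          let ?q = "\<bar>A k [] u \<omega>\<bar> / \<delta>"
          have q: "0 \<le> ?q" using \<delta> by simp
          show "0 \<le> 2 * (env.Rb * \<bar>A k [] u \<omega>\<bar>) * real CARD('d) / \<delta> + 2" using R \<delta> by simp
          have "2 * (env.Rb * \<bar>A k [] u \<omega>\<bar>) * real CARD('d) / \<delta> = (2 * env.Rb * real CARD('d)) * ?q" by simp
          also have "\<dots> \<le> (2 * env.Rb * real CARD('d)) * max 1 ?q" using R by (intro mult_left_mono) auto
          finally show "2 * (env.Rb * \<bar>A k [] u \<omega>\<bar>) * real CARD('d) / \<delta> + 2
              \<le> (2 * env.Rb * real CARD('d) + 2) * max 1 ?q"
            unfolding distrib_right by (intro add_mono) auto
        qed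
        also have "\<dots> = (2 * env.Rb * real CARD('d) + 2) ^ CARD('d) * (\<Prod>k\<in>UNIV. max 1 (\<bar>A k [] u \<omega>\<bar> / \<delta>))"
          by (simp add: prod.distrib)
        also have "\<dots> \<le> (2 * env.Rb * real CARD('d) + 2) ^ CARD('d)
            * ((1 / lo) ^ CARD('d) * \<delta> powr - s * weight e [] u \<omega>)"
          using e(2) R by (intro mult_left_mono) (auto simp: weight_def)
        also have "\<dots> = ?c * \<delta> powr - s * weight e [] u \<omega>" by (simp only: mult_ac)
        \<comment> \<open>The exponent vector depends on \<open>u\<close>; summing over the finitely
          many possible ones removes this dependence.\<close>
        also have "\<dots> \<le> ?c * \<delta> powr - s * (\<Sum>e\<in>?E. weight e [] u \<omega>)"
          using c e(1) by (intro mult_left_mono member_le_sum finite_texp) (auto simp: weight_nonneg)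
        finally show "(\<Prod>k\<in>UNIV. 2 * (env.Rb * \<bar>A k [] u \<omega>\<bar>) * real CARD('d) / \<delta> + 2)
            \<le> ?c * \<delta> powr - s * (\<Sum>e\<in>?E. weight e [] u \<omega>)" .
      qed
      also have "\<dots> = ?c * \<delta> powr - s * (\<Sum>e\<in>?E. \<Sum>u\<in>F. weight e [] u \<omega>)"
        by (simp only: sum_distrib_left [symmetric] sum.swap [of _ _ F])
      also have "\<dots> \<le> ?c * \<delta> powr - s * W"
      proof (intro mult_left_mono)
        show "(\<Sum>e\<in>?E. \<Sum>u\<in>F. weight e [] u \<omega>) \<le> W"
          unfolding W_def
        proof (rule sum_mono)
          fix e assume e: "e \<in> ?E"
          have "(\<Sum>u\<in>F. weight e [] u \<omega>) \<le> (\<Sum>u\<in>(\<Union>j\<le>n1. words j). weight e [] u \<omega>)"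
            using finite_words by (intro sum_mono2) (auto simp: F_def weight_nonneg)
          also have "\<dots> = (\<Sum>j\<le>n1. \<Sum>u\<in>words j. weight e [] u \<omega>)"
            using finite_words by (intro sum.UNION_disjoint) (auto simp: words_def)
          also have "\<dots> \<le> C e" using e by (rule C)
          finally show "(\<Sum>u\<in>F. weight e [] u \<omega>) \<le> C e" .
        qed
      qed (use c in auto)
      also have "\<dots> = (?c * W) * \<delta> powr - s" by (simp only: mult_ac)
      also have "\<dots> \<le> (?c * \<bar>W\<bar> + 1) * \<delta> powr - s"
      proof (rule mult_right_mono)
        have "?c * W \<le> ?c * \<bar>W\<bar>" by (rule mult_left_mono) (use c in auto)
        then show "?c * W \<le> ?c * \<bar>W\<bar> + 1" by linarith
      qed simp
      finally show ?thesis .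
    qed
    moreover have "0 < ?c * \<bar>W\<bar> + 1" using c by (simp add: add_nonneg_pos)
    ultimately show "small_covers s (sponge N \<alpha> t \<omega>)" unfolding small_covers_def by blast
  qed
qed

section \<open>Lower bound and the dimension formula\<close>

lemma AE_lower:
  assumes N: "N \<ge> 2" and e: "\<And>k. 0 \<le> e k" "\<And>k. e k \<le> 1" and super: "press e > 1"
    and trans: "\<And>k. \<exists>i\<in>{1..N}. \<exists>j\<in>{1..N}. t i $ k \<noteq> t j $ k"
    and smooth: "\<And>k. \<exists>l\<in>{1..N}. eventually_smooth (distr M borel (\<lambda>\<omega>. ln \<bar>\<alpha> k [l] \<omega>\<bar>))"
  shows "0 < s \<Longrightarrow> s < (\<Sum>k\<in>UNIV. e k) \<Longrightarrow> AE \<omega> in M. has_content s (sponge N \<alpha> t \<omega>)"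
    and "(\<Sum>k\<in>UNIV. e k) = real CARD('d) \<Longrightarrow> AE \<omega> in M. emeasure lebesgue (sponge N \<alpha> t \<omega>) > 0"
proof -
  obtain sfx where sfx: "sfx \<in> fin_words N" "sfx \<noteq> []"
    and sep: "\<And>k s n0. 0 \<le> s \<Longrightarrow> s \<le> 1 \<Longrightarrow> \<exists>D\<ge>0. separating k s n0 sfx D"
    using ex_separating [OF _ trans smooth] N by (metis one_le_numeral order_trans)
  have pos: "0 < mean_weight e sfx"
  proof -
    have "0 < wmoment k (e k) u" if "u \<in> fin_words N" for u k
      using that by (induction u) (auto intro!: mult_pos_pos moment_pos e)
    then show ?thesis using sfx by (auto simp: mean_weight_def intro!: prod_pos)
  qed
  obtain n where n: "1 / mean_weight e sfx < press e ^ n"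
    using real_arch_pow [OF super] by blast
  define n0 where "n0 = Suc n"
  have "press e ^ n \<le> press e ^ n0" using super by (intro power_increasing) (auto simp: n0_def)
  then have "1 < press e ^ n0 * mean_weight e sfx"
    using n pos by (simp add: pos_divide_less_eq) (smt (verit) mult_right_mono)
  then have big: "(\<Sum>b\<in>{b\<in>fin_words N. length b = n0}. mean_weight e (b @ sfx)) > 1"
    by (simp add: mean_weight_append sum_distrib_right [symmetric] words_def [symmetric] sum_words_mean_weight)
  have "\<forall>k. \<exists>D. D \<ge> 0 \<and> separating k (e k) n0 sfx D" using sep e by blast
  from choice [OF this] obtain D where D: "\<forall>k. D k \<ge> 0 \<and> separating k (e k) n0 sfx (D k)" ..
  interpret sponge_blocks M N \<alpha> t lo hi T e n0 sfx D
    by unfold_locales (use e sfx D big N in \<open>auto simp: n0_def\<close>)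
  show "AE \<omega> in M. has_content s (sponge N \<alpha> t \<omega>)" if "0 < s" "s < (\<Sum>k\<in>UNIV. e k)"
    by (rule AE_content [OF that])
  show "AE \<omega> in M. emeasure lebesgue (sponge N \<alpha> t \<omega>) > 0" if eq: "(\<Sum>k\<in>UNIV. e k) = real CARD('d)"
    using AE_dyadic_count unfolding eq
  proof eventually_elim
    case (elim \<omega>)
    then obtain c where "c > 0" "\<exists>\<^sub>\<infinity>Q. dyadic_content (real CARD('d)) (sponge N \<alpha> t \<omega>) c Q" by blast
    then show ?case by (rule lebesgue_pos_if_dyadic_count [OF compact_sponge [OF env]])
  qed
qed

lemma phi_tau_integral:
  assumes "\<tau> \<in> perms_of" "0 \<le> s" "s \<le> real CARD('d)"
  shows "(\<Sum>i=1..N. \<integral>\<omega>. phi_tau s \<tau> (\<lambda>k. \<alpha> k [i] \<omega>) \<partial>M) = press (texp s \<tau>)"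
  unfolding press_def
proof (intro sum.cong refl)
  fix i assume i: "i \<in> {1..N}"
  have "phi_tau s \<tau> (\<lambda>k. \<alpha> k [i] \<omega>) = (\<Prod>k\<in>UNIV. \<bar>\<alpha> k [i] \<omega>\<bar> powr texp s \<tau> k)" for \<omega>
    using assms env.a_nonzero by (intro phi_tau_texp) auto
  then show "(\<integral>\<omega>. phi_tau s \<tau> (\<lambda>k. \<alpha> k [i] \<omega>) \<partial>M) = mean_weight (texp s \<tau>) [i]"
    using integral_weight_single [OF i texp_bounds(1)] by simp
qed

lemma phi_tau_integral_above:
  assumes "real CARD('d) < s"
  shows "(\<Sum>i=1..N. \<integral>\<omega>. phi_tau s \<tau> (\<lambda>k. \<alpha> k [i] \<omega>) \<partial>M) = press (\<lambda>_. s / real CARD('d))"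
  unfolding press_def
proof (intro sum.cong refl)
  fix i assume i: "i \<in> {1..N}"
  have s: "0 \<le> s / real CARD('d)" using assms by (intro divide_nonneg_pos) (auto intro: order_trans [OF of_nat_0_le_iff less_imp_le])
  have "phi_tau s \<tau> (\<lambda>k. \<alpha> k [i] \<omega>) = (\<Prod>k\<in>UNIV. \<bar>\<alpha> k [i] \<omega>\<bar> powr (s / real CARD('d)))" for \<omega>
    using assms by (simp add: phi_tau_def prod_powr_distrib)
  then show "(\<integral>\<omega>. phi_tau s \<tau> (\<lambda>k. \<alpha> k [i] \<omega>) \<partial>M) = mean_weight (\<lambda>_. s / real CARD('d)) [i]"
    using integral_weight_single [OF i, of "\<lambda>_. s / real CARD('d)"] s by simp
qed

text \<open>Up to the dimension, \<open>e\<close> is the exponent vector of a maximizing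
  permutation; above it all permutations give the same value and \<open>e\<close> is constantly
  \<open>s0 / CARD('d)\<close>. The bound by a maximum covers both cases at once.\<close>

lemma pressure_root:
  assumes s0: "0 \<le> s0" and p: "pressure M N \<alpha> s0 = 1"
  obtains e where "\<And>k. 0 \<le> e k" "press e = 1" "(\<Sum>k\<in>UNIV. e k) = s0"
    "\<And>k. e k \<le> max 1 (s0 / real CARD('d))"
    "s0 \<le> real CARD('d) \<longrightarrow> (\<forall>\<tau>\<in>perms_of. press (texp s0 \<tau>) \<le> 1)"
proof (cases "s0 \<le> real CARD('d)")
  case True
  let ?S = "(\<lambda>\<tau>. press (texp s0 \<tau>)) ` perms_of"
  have "(\<lambda>\<tau>. \<Sum>i=1..N. (\<integral>\<omega>. phi_tau s0 \<tau> (\<lambda>k. \<alpha> k [i] \<omega>) \<partial>M)) ` perms_of = ?S"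
    using s0 True by (intro image_cong refl phi_tau_integral) auto
  then have max: "Max ?S = 1" using p by (simp add: pressure_def)
  have "finite ?S" using finite_imageI [OF finite_texp [of s0], of press] by (simp add: image_image)
  moreover have "?S \<noteq> {}" using perms_of_nonempty by simp
  ultimately have "1 \<in> ?S" and le: "\<And>\<tau>. \<tau> \<in> perms_of \<Longrightarrow> press (texp s0 \<tau>) \<le> 1"
    using Max_in [of ?S] Max_ge [of ?S] max by auto
  then obtain \<tau> where \<tau>: "\<tau> \<in> perms_of" "press (texp s0 \<tau>) = 1" by auto
  show ?thesis
  proof (rule that [of "texp s0 \<tau>"])
    show "(\<Sum>k\<in>UNIV. texp s0 \<tau> k) = s0" using \<tau> s0 True by (intro sum_texp) auto
    show "texp s0 \<tau> k \<le> max 1 (s0 / real CARD('d))" for k using texp_bounds(2) [of s0 \<tau> k] by simp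
  qed (use \<tau> le texp_bounds in auto)
next
  case False
  then have eq: "(\<lambda>\<tau>. \<Sum>i=1..N. (\<integral>\<omega>. phi_tau s0 \<tau> (\<lambda>k. \<alpha> k [i] \<omega>) \<partial>M))
      = (\<lambda>\<tau> :: nat \<Rightarrow> 'd. press (\<lambda>_. s0 / real CARD('d)))"
    by (intro ext phi_tau_integral_above) simp
  have "press (\<lambda>_. s0 / real CARD('d)) = 1"
    using p perms_of_nonempty [where 'd = 'd] unfolding pressure_def eq
    by (simp only: image_constant_conv if_False Max_singleton)
  then show ?thesis using s0 False by (intro that [of "\<lambda>_. s0 / real CARD('d)"]) auto
qed

lemma sponge_dimensions:
  assumes N: "N \<ge> 2"
    and trans: "\<And>k. \<exists>i\<in>{1..N}. \<exists>j\<in>{1..N}. t i $ k \<noteq> t j $ k"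
    and smooth: "\<And>k. \<exists>l\<in>{1..N}. eventually_smooth (distr M borel (\<lambda>\<omega>. ln \<bar>\<alpha> k [l] \<omega>\<bar>))"
    and s0: "0 \<le> s0" and p: "pressure M N \<alpha> s0 = 1"
  defines "D \<equiv> min (real CARD('d)) s0"
  shows "AE \<omega> in M. hausdorff_dim (sponge N \<alpha> t \<omega>) = D \<and> has_minkowski_dim (sponge N \<alpha> t \<omega>) D"
    and "s0 > real CARD('d) \<Longrightarrow> AE \<omega> in M. emeasure lebesgue (sponge N \<alpha> t \<omega>) > 0"
proof -
  obtain e where e: "\<And>k. 0 \<le> e k" "press e = 1" "(\<Sum>k\<in>UNIV. e k) = s0"
      "\<And>k. e k \<le> max 1 (s0 / real CARD('d))"
    and le1: "s0 \<le> real CARD('d) \<longrightarrow> (\<forall>\<tau>\<in>perms_of. press (texp s0 \<tau>) \<le> 1)"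
    using pressure_root [OF s0 p] by metis
  \<comment> \<open>With all exponents 0 the pressure equals \<open>N\<close>, which is not
    1.\<close>
  have "s0 \<noteq> 0"
  proof
    assume "s0 = 0"
    then have "e k = 0" for k using e(1,3) by (simp add: sum_nonneg_eq_0_iff)
    moreover have "moment k 0 i = 1" for k i
    proof -
      have "moment k 0 i = (\<integral>\<omega>. 1 \<partial>M)"
        unfolding moment_def by (intro Bochner_Integration.integral_cong) (auto simp: env.a_nonzero)
      then show ?thesis by (simp add: prob_space)
    qed
    ultimately have "press e = real N" by (simp add: press_def mean_weight_def)
    then show False using e(2) N by simp
  qed
  then have s0_pos: "0 < s0" using s0 by simp
  have d_pos: "0 < real CARD('d)" by simp
  have D: "0 < D" using s0_pos d_pos by (simp add: D_def)
  \<comment> \<open>Proportional shrinking keeps the exponents in [0,1] and gives them the sum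
    \<open>s\<close>, by one formula for all \<open>s0\<close>. If \<open>s0\<close> exceeds the
    dimension, then at \<open>s = D\<close> all exponents are 1, as the Lebesgue statement
    needs.\<close>
  define e' where "e' = (\<lambda>s k. s / s0 * e k)"
  have sum_e': "(\<Sum>k\<in>UNIV. e' s k) = s" for s
    unfolding e'_def sum_distrib_left [symmetric] e(3) using s0_pos by simp
  have e': "0 \<le> e' s k" "e' s k \<le> 1" "e' s k \<le> e k" if s: "0 < s" "s \<le> D" for s k
  proof -
    have r: "0 \<le> s / s0" "s / s0 \<le> 1" using s s0_pos by (auto simp: D_def)
    show "0 \<le> e' s k" unfolding e'_def by (intro mult_nonneg_nonneg r(1) e(1))
    show "e' s k \<le> e k" unfolding e'_def using r e(1) by (intro mult_left_le_one_le) auto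
    have "e' s k \<le> s / s0 * max 1 (s0 / real CARD('d))"
      unfolding e'_def using r e(4) by (intro mult_left_mono) auto
    also have "\<dots> = max (s / s0) (s / real CARD('d))"
      using r s0_pos by (simp add: max_mult_distrib_left)
    also have "\<dots> \<le> 1" using r s d_pos by (simp add: D_def)
    finally show "e' s k \<le> 1" .
  qed
  have super: "press (e' s) > 1" if s: "0 < s" "s \<le> D" "s < s0" for s
  proof -
    have "1 \<le> hi powr (s0 - s) * press (e' s)"
      using press_le [of "e' s" e] e'[OF s(1,2)] by (simp add: e sum_e')
    moreover have "hi powr (s0 - s) < 1"
      using env.hi env.hi_pos s(3) powr01_less_one by auto
    moreover have "0 \<le> press (e' s)" using e'[OF s(1,2)] by (intro press_nonneg) auto
    ultimately show ?thesis by (smt (verit) mult_left_le_one_le mult_right_less_imp_less powr_ge_zero mult_le_cancel_right1)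
  qed
  have content: "AE \<omega> in M. has_content s (sponge N \<alpha> t \<omega>)" if s: "0 < s" "s < D" for s
  proof -
    \<comment> \<open>The exponents are made to sum to the midpoint of \<open>s\<close> and
      \<open>D\<close>, as the content bound needs a sum strictly above \<open>s\<close>.\<close>
    have *: "s < (s + D) / 2" "(s + D) / 2 < D" using s by auto
    then have "(s + D) / 2 < s0" by (simp add: D_def)
    then show ?thesis
      using * s e' [of "(s + D) / 2"] super [of "(s + D) / 2"]
      by (intro AE_lower(1) [OF N _ _ _ trans smooth, of "e' ((s + D) / 2)"]) (auto simp: sum_e')
  qed
  show "AE \<omega> in M. emeasure lebesgue (sponge N \<alpha> t \<omega>) > 0" if "s0 > real CARD('d)"
  proof -
    have "D = real CARD('d)" using that by (simp add: D_def)
    then show ?thesis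
      using D that e' [of D] super [of D]
      by (intro AE_lower(2) [OF N _ _ _ trans smooth, of "e' D"]) (auto simp: sum_e')
  qed
  have upper: "AE \<omega> in M. small_covers s (sponge N \<alpha> t \<omega>)" if s: "D < s" for s
  proof (cases "s < real CARD('d)")
    case True
    then have s': "s0 < s" "s0 \<le> real CARD('d)" using s by (auto simp: D_def)
    show ?thesis
    proof (rule AE_covering_number_le)
      fix \<tau> :: "nat \<Rightarrow> 'd" assume \<tau>: "\<tau> \<in> perms_of"
      have "press (texp s \<tau>) \<le> hi powr (s - s0) * press (texp s0 \<tau>)"
        using press_le [of "texp s0 \<tau>" "texp s \<tau>", OF texp_bounds(1) texp_mono [OF less_imp_le [OF s'(1)]]] s' True \<tau> s0
        by (simp add: sum_texp)
      also have "\<dots> \<le> hi powr (s - s0) * 1" using le1 s'(2) \<tau> by (intro mult_left_mono) auto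
      also have "\<dots> < 1" using env.hi env.hi_pos s'(1) powr01_less_one by auto
      finally show "press (texp s \<tau>) < 1" .
    qed (use s D True in auto)
  next
    case False
    then show ?thesis by (intro AE_I2 small_covers_trivial) simp
  qed
  \<comment> \<open>Countably many exponents tending to \<open>D\<close> from both sides keep the
    exceptional set null; monotonicity in the exponent covers all the others.\<close>
  have "AE \<omega> in M. (\<forall>n. has_content (D * (1 - 1 / real (n + 2))) (sponge N \<alpha> t \<omega>)) \<and>
      (\<forall>n. small_covers (D + 1 / real (n + 2)) (sponge N \<alpha> t \<omega>))"
    unfolding AE_conj_iff AE_all_countable
  proof (intro conjI allI content upper)
    fix n
    have "0 < 1 - 1 / real (n + 2)" "1 - 1 / real (n + 2) < 1" by auto
    then show "0 < D * (1 - 1 / real (n + 2))" "D * (1 - 1 / real (n + 2)) < D" using D by auto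
    show "D < D + 1 / real (n + 2)" by simp
  qed
  then show "AE \<omega> in M. hausdorff_dim (sponge N \<alpha> t \<omega>) = D \<and> has_minkowski_dim (sponge N \<alpha> t \<omega>) D"
  proof (rule AE_mp, intro AE_I2 impI)
    fix \<omega>
    assume *: "(\<forall>n. has_content (D * (1 - 1 / real (n + 2))) (sponge N \<alpha> t \<omega>)) \<and>
      (\<forall>n. small_covers (D + 1 / real (n + 2)) (sponge N \<alpha> t \<omega>))"
    have small: "\<exists>n. 1 / real (n + 2) < \<epsilon>" if \<epsilon>: "\<epsilon> > 0" for \<epsilon>
    proof -
      obtain n where "inverse (real (Suc n)) < \<epsilon>" using reals_Archimedean [OF \<epsilon>] by blast
      moreover have "1 / real (n + 2) \<le> inverse (real (Suc n))" by (simp add: field_simps)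
      ultimately show ?thesis by (intro exI [of _ n]) linarith
    qed
    show "hausdorff_dim (sponge N \<alpha> t \<omega>) = D \<and> has_minkowski_dim (sponge N \<alpha> t \<omega>) D"
    proof (rule dimensions_eqI [OF compact_sponge [OF env] D])
      fix s assume s: "0 < s" "s < D"
      obtain n where "1 / real (n + 2) < (D - s) / D" using small [of "(D - s) / D"] s D by auto
      then have "s \<le> D * (1 - 1 / real (n + 2))" using D by (simp add: field_simps)
      then show "has_content s (sponge N \<alpha> t \<omega>)" using * has_content_mono by blast
    next
      fix s assume s: "D < s"
      obtain n where n: "1 / real (n + 2) < s - D" using small [of "s - D"] s by auto
      then show "small_covers s (sponge N \<alpha> t \<omega>)"
        using * small_covers_mono [of "D + 1 / real (n + 2)" _ s] by auto
    qed
  qed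
qed

end

section \<open>Truncation and transfer to the given variables\<close>

lemma indep_vars_child_vec_compose:
  assumes "prob_space M" and g [measurable]: "g \<in> borel_measurable borel"
    and R1: "prob_space.indep_vars M (\<lambda>_. PiM {1..N} (\<lambda>_. borel)) (\<lambda>(u, l). child_vec N \<alpha> l u) {(u, l). u \<in> fin_words N}"
    and eq: "\<And>k u j \<omega>. u \<in> fin_words N \<Longrightarrow> j \<in> {1..N} \<Longrightarrow> \<beta> k (u @ [j]) \<omega> = g (\<alpha> k (u @ [j]) \<omega>)"
  shows "prob_space.indep_vars M (\<lambda>_. PiM {1..N} (\<lambda>_. borel)) (\<lambda>(u, l). child_vec N \<beta> l u) {(u, l). u \<in> fin_words N}"
proof -
  interpret prob_space M by fact
  let ?G = "\<lambda>x. restrict (\<lambda>j. g (x j)) {1..N}"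
  have "indep_vars (\<lambda>_. PiM {1..N} (\<lambda>_. borel)) (\<lambda>i \<omega>. ?G ((\<lambda>(u, l). child_vec N \<alpha> l u) i \<omega>)) {(u, l). u \<in> fin_words N}"
    by (rule indep_vars_compose2 [OF R1]) measurable
  then show ?thesis
    by (rule indep_vars_cong [THEN iffD1, rotated 3]) (auto simp: child_vec_def fun_eq_iff eq)
qed

lemma distr_child_vec_compose:
  fixes \<alpha> \<beta> :: "'d \<Rightarrow> nat list \<Rightarrow> 'w \<Rightarrow> real"
  assumes g [measurable]: "g \<in> borel_measurable borel"
    and m: "child_vec N \<alpha> l u \<in> measurable M (PiM {1..N} (\<lambda>_. borel))"
    and eq: "\<And>j \<omega>. j \<in> {1..N} \<Longrightarrow> \<beta> l (u @ [j]) \<omega> = g (\<alpha> l (u @ [j]) \<omega>)"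
  shows "distr M (PiM {1..N} (\<lambda>_. borel)) (child_vec N \<beta> l u)
    = distr (distr M (PiM {1..N} (\<lambda>_. borel)) (child_vec N \<alpha> l u)) (PiM {1..N} (\<lambda>_. borel)) (\<lambda>x. restrict (\<lambda>j. g (x j)) {1..N})"
  using m by (subst distr_distr) (auto simp: comp_def child_vec_def fun_eq_iff eq intro!: distr_cong)

theorem theorem1p2:
  fixes M :: "'w measure"
    and N :: nat
    and \<alpha>lo \<alpha>hi :: real
    and t :: "nat \<Rightarrow> real^'d::finite"
    and \<alpha> :: "'d \<Rightarrow> nat list \<Rightarrow> 'w \<Rightarrow> real"
    and s0 :: real
  assumes dim: "CARD('d) \<ge> 2"
    and N: "N \<ge> 2"
    and bounds: "0 < \<alpha>lo" "\<alpha>lo \<le> \<alpha>hi" "\<alpha>hi < 1"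
    and trans: "\<forall>k. \<exists>i\<in>{1..N}. \<exists>j\<in>{1..N}. t i $ k \<noteq> t j $ k"
    and prob: "prob_space M"
    and rv: "\<forall>k u. u \<in> fin_words N \<and> u \<noteq> [] \<longrightarrow> \<alpha> k u \<in> borel_measurable M"
    and R1: "prob_space.indep_vars M (\<lambda>_. PiM {1..N} (\<lambda>_. borel))
               (\<lambda>(u, l). child_vec N \<alpha> l u) {(u, l). u \<in> fin_words N}"
    and R2: "\<forall>l u. u \<in> fin_words N \<longrightarrow>
               distr M (PiM {1..N} (\<lambda>_. borel)) (child_vec N \<alpha> l u)
             = distr M (PiM {1..N} (\<lambda>_. borel)) (child_vec N \<alpha> l [])"
    and R3: "\<forall>k u. u \<in> fin_words N \<and> u \<noteq> [] \<longrightarrow>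
               (AE \<omega> in M. \<bar>\<alpha> k u \<omega>\<bar> \<in> {\<alpha>lo..\<alpha>hi})"
    and R4: "\<forall>k. \<exists>l\<in>{1..N}. eventually_smooth (distr M borel (\<lambda>\<omega>. ln \<bar>\<alpha> k [l] \<omega>\<bar>))"
    and s0_nonneg: "0 \<le> s0"
    and s0: "pressure M N \<alpha> s0 = 1"
  shows "(AE \<omega> in M. hausdorff_dim (sponge N \<alpha> t \<omega>) = min (real CARD('d)) s0
                     \<and> has_minkowski_dim (sponge N \<alpha> t \<omega>) (min (real CARD('d)) s0))
         \<and> (s0 > real CARD('d) \<longrightarrow> (AE \<omega> in M. emeasure lebesgue (sponge N \<alpha> t \<omega>) > 0))"
proof -
  interpret M: prob_space M by (rule prob)
  \<comment> \<open>Truncating on a null set makes the bounds hold surely and for all words.\<close>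
  define g where "g = (\<lambda>x. if \<bar>x\<bar> \<in> {\<alpha>lo..\<alpha>hi} then x else \<alpha>hi)"
  define \<beta> where "\<beta> = (\<lambda>k u \<omega>. if u \<in> fin_words N \<and> u \<noteq> [] then g (\<alpha> k u \<omega>) else \<alpha>hi)"
  \<comment> \<open>Only the letters from 1 to \<open>N\<close> matter; setting the other
    translations to 0 makes \<open>T\<close> a bound for all of them.\<close>
  define t' where "t' = (\<lambda>i. if i \<in> {1..N} then t i else 0)"
  define T where "T = (\<Sum>i=1..N. norm (t i))"
  have g [measurable]: "g \<in> borel_measurable borel" unfolding g_def by measurable
  have g_bounds: "\<alpha>lo \<le> \<bar>g x\<bar>" "\<bar>g x\<bar> \<le> \<alpha>hi" for x using bounds by (auto simp: g_def)
  have \<beta>_eq: "\<beta> k (u @ [j]) \<omega> = g (\<alpha> k (u @ [j]) \<omega>)" if "u \<in> fin_words N" "j \<in> {1..N}" for k u j \<omega>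
    using that by (simp add: \<beta>_def)
  have T: "\<bar>t' i $ k\<bar> \<le> T" for i k
  proof (cases "i \<in> {1..N}")
    case True
    have "\<bar>t i $ k\<bar> \<le> norm (t i)" by (rule component_le_norm_cart)
    also have "\<dots> \<le> T" unfolding T_def using True by (intro member_le_sum) auto
    finally show ?thesis using True by (simp add: t'_def)
  next
    case False
    then show ?thesis by (auto simp: t'_def T_def intro: sum_nonneg)
  qed
  have child_meas: "child_vec N \<alpha> l u \<in> measurable M (PiM {1..N} (\<lambda>_. borel))" if "u \<in> fin_words N" for l u
    using R1 that unfolding M.indep_vars_def by auto
  interpret random_sponge M N \<beta> t' \<alpha>lo \<alpha>hi T
  proof unfold_locales
    show "M.indep_vars (\<lambda>_. PiM {1..N} (\<lambda>_. borel)) (\<lambda>(u, l). child_vec N \<beta> l u) {(u, l). u \<in> fin_words N}"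
      by (rule indep_vars_child_vec_compose [OF prob g R1 \<beta>_eq])
    show "distr M (PiM {1..N} (\<lambda>_. borel)) (child_vec N \<beta> l u)
        = distr M (PiM {1..N} (\<lambda>_. borel)) (child_vec N \<beta> l [])" if u: "u \<in> fin_words N" for l u
    proof -
      have "distr M (PiM {1..N} (\<lambda>_. borel)) (child_vec N \<beta> l v)
        = distr (distr M (PiM {1..N} (\<lambda>_. borel)) (child_vec N \<alpha> l v)) (PiM {1..N} (\<lambda>_. borel))
            (\<lambda>x. restrict (\<lambda>j. g (x j)) {1..N})" if "v \<in> fin_words N" for v
        using that by (intro distr_child_vec_compose g child_meas \<beta>_eq)
      from this [OF u] this [OF fin_words_Nil] R2 u show ?thesis by metis
    qed
  qed (use bounds g_bounds T in \<open>auto simp: \<beta>_def\<close>)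
  \<comment> \<open>There are countably many words and finitely many coordinates, so almost surely
    the truncated variables agree with the given ones for all words at once; this carries sponge,
    pressure and laws over.\<close>
  have ae: "AE \<omega> in M. \<forall>k. \<forall>u. u \<in> fin_words N \<and> u \<noteq> [] \<longrightarrow> \<beta> k u \<omega> = \<alpha> k u \<omega>"
  proof (subst AE_all_countable, rule allI, subst AE_all_countable, rule allI)
    fix k and u :: "nat list"
    show "AE \<omega> in M. u \<in> fin_words N \<and> u \<noteq> [] \<longrightarrow> \<beta> k u \<omega> = \<alpha> k u \<omega>"
    proof (cases "u \<in> fin_words N \<and> u \<noteq> []")
      case True
      then have "AE \<omega> in M. \<bar>\<alpha> k u \<omega>\<bar> \<in> {\<alpha>lo..\<alpha>hi}" using R3 by blast
      then show ?thesis by (rule AE_mp) (auto simp: \<beta>_def g_def)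
    qed auto
  qed
  have ae1: "AE \<omega> in M. \<beta> k [i] \<omega> = \<alpha> k [i] \<omega>" if "i \<in> {1..N}" for k i
    using ae by eventually_elim (use that in auto)
  have \<alpha>1 [measurable]: "\<alpha> k [i] \<in> borel_measurable M" if "i \<in> {1..N}" for k i
    using rv that by simp
  have \<beta>1 [measurable]: "\<beta> k [i] \<in> borel_measurable M" if "i \<in> {1..N}" for k i
    using \<alpha>_measurable1 [OF that] .
  have eq: "AE \<omega> in M. sponge N \<beta> t' \<omega> = sponge N \<alpha> t \<omega>"
    using ae
  proof eventually_elim
    case (elim \<omega>)
    have "sponge_proj \<beta> t' \<omega> w = sponge_proj \<alpha> t \<omega> w" if w: "w \<in> inf_words N" for w
    proof -
      have "diagA \<beta> k (prefix_word w m) \<omega> = diagA \<alpha> k (prefix_word w m) \<omega>" for k m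
        using elim prefix_word_in [OF w, of m] by (auto simp: diagA_def)
      moreover have "t' (w j) = t (w j)" for j using w by (auto simp: t'_def inf_words_def)
      ultimately show ?thesis by (simp add: sponge_proj_def)
    qed
    then show ?case by (simp add: sponge_def cong: image_cong)
  qed
  have "pressure M N \<beta> s0 = pressure M N \<alpha> s0"
  proof -
    have "(\<integral>\<omega>. phi_tau s0 \<tau> (\<lambda>k. \<beta> k [i] \<omega>) \<partial>M) = (\<integral>\<omega>. phi_tau s0 \<tau> (\<lambda>k. \<alpha> k [i] \<omega>) \<partial>M)"
      if i: "i \<in> {1..N}" for \<tau> i
    proof (rule integral_cong_AE)
      have "AE \<omega> in M. \<forall>k. \<beta> k [i] \<omega> = \<alpha> k [i] \<omega>"
        by (subst AE_all_countable) (use ae1 i in auto)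
      then show "AE \<omega> in M. phi_tau s0 \<tau> (\<lambda>k. \<beta> k [i] \<omega>) = phi_tau s0 \<tau> (\<lambda>k. \<alpha> k [i] \<omega>)"
        by eventually_elim simp
      show "(\<lambda>\<omega>. phi_tau s0 \<tau> (\<lambda>k. \<beta> k [i] \<omega>)) \<in> borel_measurable M"
        using \<beta>1 [OF i] unfolding phi_tau_def by measurable
      show "(\<lambda>\<omega>. phi_tau s0 \<tau> (\<lambda>k. \<alpha> k [i] \<omega>)) \<in> borel_measurable M"
        using \<alpha>1 [OF i] unfolding phi_tau_def by measurable
    qed
    then show ?thesis
      unfolding pressure_def by (intro arg_cong [where f = Max] image_cong refl sum.cong)
  qed
  then have p: "pressure M N \<beta> s0 = 1" using s0 by simp
  have trans': "\<exists>i\<in>{1..N}. \<exists>j\<in>{1..N}. t' i $ k \<noteq> t' j $ k" for k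
    using trans by (simp add: t'_def)
  have smooth': "\<exists>l\<in>{1..N}. eventually_smooth (distr M borel (\<lambda>\<omega>. ln \<bar>\<beta> k [l] \<omega>\<bar>))" for k
  proof -
    obtain l where l: "l \<in> {1..N}" "eventually_smooth (distr M borel (\<lambda>\<omega>. ln \<bar>\<alpha> k [l] \<omega>\<bar>))"
      using R4 by blast
    have "distr M borel (\<lambda>\<omega>. ln \<bar>\<beta> k [l] \<omega>\<bar>) = distr M borel (\<lambda>\<omega>. ln \<bar>\<alpha> k [l] \<omega>\<bar>)"
    proof (rule distr_cong_AE)
      show "AE \<omega> in M. ln \<bar>\<beta> k [l] \<omega>\<bar> = ln \<bar>\<alpha> k [l] \<omega>\<bar>"
        using ae1 [OF l(1), of k] by eventually_elim simp
    qed (use \<alpha>1 [OF l(1)] \<beta>1 [OF l(1)] in measurable)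
    then show ?thesis using l by metis
  qed
  note dims = sponge_dimensions [OF N trans' smooth' s0_nonneg p]
  show ?thesis
  proof (intro conjI impI)
    show "AE \<omega> in M. hausdorff_dim (sponge N \<alpha> t \<omega>) = min (real CARD('d)) s0
        \<and> has_minkowski_dim (sponge N \<alpha> t \<omega>) (min (real CARD('d)) s0)"
      using dims(1) eq by eventually_elim simp
    show "AE \<omega> in M. emeasure lebesgue (sponge N \<alpha> t \<omega>) > 0" if "s0 > real CARD('d)"
      using dims(2) [OF that] eq by eventually_elim simp
  qed
qed

end
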